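(* For every fixed positive integer $k$, the following problem is decidable non-deterministically using logarithmic work-space (i.e. it lies in NL): given a list $Q=(q_1,\ldots,q_k)$ of $k$ sequences of bins with pallet symbols and a positive integer $p$, decide whether there is a processing of $Q$ with at most $p$ stack-up places.
   Context: A bin $b$ carries a pallet symbol $\mathit{plt}(b)$ (a positive integer). In an instance, all bins are pairwise distinct, and for every pallet symbol occurring, the sequences together contain at least two bins destined for it. A subsequence of $q=(b_1,\ldots,b_n)$ is a suffix $q'=(b_j,\ldots,b_n)$ (possibly empty), and $q-q'=(b_1,\ldots,b_{j-1})$. A configuration is $(Q,Q')$ with $Q'=(q'_1,\ldots,q'_k)$, each $q'_j$ a subsequence of $q_j$. A pallet $t$ is open in $(Q,Q')$ if some bin for $t$ lies in some $q'_i$ and some bin for $t$ lies in some $q_j-q'_j$. A transformation step removes the first bin of one nonempty $q'_i$. A processing of $Q$ is a sequence of transformation steps transforming $(Q,Q)$ into the configuration with all sequences empty; it uses at most $p$ stack-up places if every configuration along it has at most $p$ open pallets. *)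

theory Defs
  imports Main
begin

text \<open>A bin is a pair (identifier, pallet symbol); bins with different
identifiers are different bins.\<close>
type_synonym bin = "nat \<times> nat"

definition plt :: "bin \<Rightarrow> nat" where
  "plt b = snd b"

definition valid_instance :: "bin list list \<Rightarrow> bool" where
  "valid_instance Q \<longleftrightarrow> distinct (concat Q) \<and>
     (\<forall>b\<in>set (concat Q). plt b > 0 \<and> (\<exists>b'\<in>set (concat Q). b' \<noteq> b \<and> plt b' = plt b))"

text \<open>q - q' for a suffix q' of q.\<close>
definition seq_minus :: "'a list \<Rightarrow> 'a list \<Rightarrow> 'a list" where
  "seq_minus q q' = take (length q - length q') q"

definition is_configuration :: "bin list list \<Rightarrow> bin list list \<Rightarrow> bool" where
  "is_configuration Q Q' \<longleftrightarrow> length Q' = length Q \<and>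
     (\<forall>j<length Q. \<exists>n. Q' ! j = drop n (Q ! j))"

definition open_pallets :: "bin list list \<Rightarrow> bin list list \<Rightarrow> nat set" where
  "open_pallets Q Q' = {t. (\<exists>i<length Q'. \<exists>b\<in>set (Q' ! i). plt b = t) \<and>
       (\<exists>j<length Q. \<exists>b\<in>set (seq_minus (Q ! j) (Q' ! j)). plt b = t)}"

definition transformation_step :: "bin list list \<Rightarrow> bin list list \<Rightarrow> bool" where
  "transformation_step Q' Q'' \<longleftrightarrow>
     (\<exists>i<length Q'. Q' ! i \<noteq> [] \<and> Q'' = Q'[i := tl (Q' ! i)])"

text \<open>A processing, given as the list of configurations (second components)
it passes through, starting at (Q,Q) and ending with all sequences empty.\<close>
definition is_processing :: "bin list list \<Rightarrow> bin list list list \<Rightarrow> bool" where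
  "is_processing Q cs \<longleftrightarrow> cs \<noteq> [] \<and> hd cs = Q \<and>
     (\<forall>i. Suc i < length cs \<longrightarrow> transformation_step (cs ! i) (cs ! Suc i)) \<and>
     (\<forall>q\<in>set (last cs). q = [])"

definition has_processing_with :: "bin list list \<Rightarrow> nat \<Rightarrow> bool" where
  "has_processing_with Q p \<longleftrightarrow>
     (\<exists>cs. is_processing Q cs \<and> (\<forall>c\<in>set cs. card (open_pallets Q c) \<le> p))"

datatype sym = S0 | S1 | SNum | SSeq

fun bits :: "nat \<Rightarrow> sym list" where
  "bits n = (if n = 0 then [] else (if odd n then S1 else S0) # bits (n div 2))"

definition enc_num :: "nat \<Rightarrow> sym list" where
  "enc_num n = bits n @ [SNum]"

definition enc_bin :: "bin \<Rightarrow> sym list" where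
  "enc_bin b = enc_num (fst b) @ enc_num (snd b)"

definition enc_seq :: "bin list \<Rightarrow> sym list" where
  "enc_seq q = concat (map enc_bin q) @ [SSeq]"

definition encode :: "bin list list \<Rightarrow> nat \<Rightarrow> sym list" where
  "encode Q p = enc_num p @ concat (map enc_seq Q)"

definition stackup_lang :: "nat \<Rightarrow> sym list set" where
  "stackup_lang k = {encode Q p | Q p. length Q = k \<and> valid_instance Q \<and> p > 0 \<and>
                                      has_processing_with Q p}"

datatype insym = LEnd | In sym | REnd
datatype dir = Lft | Stay | Rgt

record ntm =
  states :: "nat set"
  work_alph :: "nat set"
  blank :: nat
  start :: nat
  accepting :: "nat set"
  trans :: "nat \<Rightarrow> insym \<Rightarrow> nat \<Rightarrow> (nat \<times> nat \<times> dir \<times> dir) set"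

definition wf_ntm :: "ntm \<Rightarrow> bool" where
  "wf_ntm M \<longleftrightarrow> finite (states M) \<and> finite (work_alph M) \<and> blank M \<in> work_alph M \<and>
     start M \<in> states M \<and> accepting M \<subseteq> states M \<and>
     (\<forall>s\<in>states M. \<forall>a. \<forall>g\<in>work_alph M.
        trans M s a g \<subseteq> states M \<times> work_alph M \<times> (UNIV :: dir set) \<times> (UNIV :: dir set))"

text \<open>Configuration: (state, input head, work tape, work head).
Input tape: read-only, with end markers at positions 0 and length w + 1.\<close>
type_synonym tconf = "nat \<times> nat \<times> (nat \<Rightarrow> nat) \<times> nat"

definition input_at :: "sym list \<Rightarrow> nat \<Rightarrow> insym" where
  "input_at w i = (if i = 0 then LEnd else if i \<le> length w then In (w ! (i - 1)) else REnd)"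

definition move :: "dir \<Rightarrow> nat \<Rightarrow> nat" where
  "move d i = (case d of Lft \<Rightarrow> i - 1 | Stay \<Rightarrow> i | Rgt \<Rightarrow> i + 1)"

definition ntm_step :: "ntm \<Rightarrow> sym list \<Rightarrow> tconf \<Rightarrow> tconf \<Rightarrow> bool" where
  "ntm_step M w c c' \<longleftrightarrow> (case c of (s, i, t, h) \<Rightarrow>
     (\<exists>(s', g, d1, d2)\<in>trans M s (input_at w i) (t h).
        c' = (s', min (move d1 i) (length w + 1), t(h := g), move d2 h)))"

definition init_conf :: "ntm \<Rightarrow> tconf" where
  "init_conf M = (start M, 0, \<lambda>_. blank M, 0)"

definition reachable :: "ntm \<Rightarrow> sym list \<Rightarrow> tconf \<Rightarrow> bool" where
  "reachable M w c \<longleftrightarrow> (ntm_step M w)\<^sup>*\<^sup>* (init_conf M) c"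

definition accepts :: "ntm \<Rightarrow> sym list \<Rightarrow> bool" where
  "accepts M w \<longleftrightarrow> (\<exists>c. reachable M w c \<and> fst c \<in> accepting M)"

definition space_bounded :: "ntm \<Rightarrow> (nat \<Rightarrow> nat) \<Rightarrow> bool" where
  "space_bounded M f \<longleftrightarrow> (\<forall>w c. reachable M w c \<longrightarrow> snd (snd (snd c)) < f (length w))"

text \<open>NL: decided by a nondeterministic machine with O(log n) work space;
length (bits n) = floor(log2 n) + 1 for n > 0.\<close>
definition in_NL :: "sym list set \<Rightarrow> bool" where
  "in_NL L \<longleftrightarrow> (\<exists>M c. wf_ntm M \<and> space_bounded M (\<lambda>n. c * (length (bits n) + 1)) \<and>
                      (\<forall>w. w \<in> L \<longleftrightarrow> accepts M w))"

end

theory Submission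
  imports Defs
begin

text \<open>
A processing is a path through configurations, and a configuration is determined by one position in
each of the \<open>k\<close> sequences. So a nondeterministic machine guesses the path, keeping only \<open>k\<close> input
positions and a counter bounding the number of open pallets. Removing a bin opens its pallet unless
an earlier bin of that pallet is already gone, and closes it if no bin of it remains; both
conditions, like validity of the instance, quantify over boundedly many input positions.

The machine model is reached through programs, i.e. regular expressions over elementary instructions
for one input head and finitely many registers holding input positions (pebbles). A register is
written as the current head position or compared with it, hence binary increment by one is the only
arithmetic that the work tape has to support. A register never exceeds \<open>length w + 1\<close>, so the
registers fit on parallel tracks of logarithmic length. The predicates decided by programs are
closed under conjunction, disjunction, bounded existential quantification and transitive closure
of relations between tuples of positions.
\<close>

section \<open>Machines over arbitrary state and symbol types\<close>

text \<open>A program accepts as soon as one run succeeds, and the closure properties listed above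
  contain no complement. This shapes all predicates: each negative condition gets a positive
  formulation of its own. Two numerals differ if a first differing symbol can be found; all bins
  have a property if a walk over the whole word gets past each of them; a pallet is exhausted if
  every bin is gone or has another pallet. The counter of open pallets is handled in the same
  spirit. It is only an upper bound, so too large a value can cost acceptance but never cause a
  wrong one. Raising it is free, and only keeping or lowering it calls for evidence. The number
  \<open>p\<close> is given in binary, so it can be exponential in the input length and fits into no
  register. The counter does fit, being bounded by the number of bins, and is compared with the
  numeral for \<open>p\<close> where that stands, by halving the counter bit by bit. A machine
  cannot tell where its input head is. Storing a pebble therefore presupposes a binary copy of the
  head position on the work tape, updated with every move.\<close>

declare bits.simps [simp del]

definition tstep :: "('s \<times> insym \<times> 'g \<times> 's \<times> 'g \<times> dir \<times> dir) set \<Rightarrow> sym list \<Rightarrow>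
    's \<times> nat \<times> (nat \<Rightarrow> 'g) \<times> nat \<Rightarrow> 's \<times> nat \<times> (nat \<Rightarrow> 'g) \<times> nat \<Rightarrow> bool" where
  "tstep T w c c' \<longleftrightarrow> (case c of (s, i, t, h) \<Rightarrow>
     \<exists>s' g d1 d2. (s, input_at w i, t h, s', g, d1, d2) \<in> T \<and>
        c' = (s', min (move d1 i) (length w + 1), t(h := g), move d2 h))"

text \<open>The type \<open>ntm\<close> fixes natural numbers as states and symbols, whereas
  residual programs and sets of tracks are the natural choice below. Finite sets embed into the
  naturals, but the embeddings are injective only on \<open>S\<close> and \<open>G\<close>. Hence a
  step of the coded machine can be pulled back only from configurations that stay inside these sets,
  and the induction for \<open>r2\<close> carries this along.\<close>

lemma in_NL_typed:
  fixes T :: "('s \<times> insym \<times> 'g \<times> 's \<times> 'g \<times> dir \<times> dir) set"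
  assumes fin: "finite S" "finite G"
    and T: "T \<subseteq> S \<times> UNIV \<times> G \<times> S \<times> G \<times> UNIV \<times> UNIV"
    and mem: "b \<in> G" "s0 \<in> S" "F \<subseteq> S"
    and space: "\<And>w s i t h. (tstep T w)\<^sup>*\<^sup>* (s0, 0, \<lambda>_. b, 0) (s, i, t, h) \<Longrightarrow>
      h < c * (length (bits (length w)) + 1)"
    and lang: "\<And>w. w \<in> L \<longleftrightarrow>
      (\<exists>s i t h. (tstep T w)\<^sup>*\<^sup>* (s0, 0, \<lambda>_. b, 0) (s, i, t, h) \<and> s \<in> F)"
  shows "in_NL L"
proof -
  obtain f :: "'s \<Rightarrow> nat" where f: "inj_on f S"
    using finite_imp_inj_to_nat_seg[OF fin(1)] by blast
  obtain e :: "'g \<Rightarrow> nat" where e: "inj_on e G"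
    using finite_imp_inj_to_nat_seg[OF fin(2)] by blast
  define M where "M = \<lparr>states = f ` S, work_alph = e ` G, blank = e b, start = f s0,
    accepting = f ` F, trans = (\<lambda>s a x. {(f s', e y, d1, d2) | s' y d1 d2.
      \<exists>s1 x1. f s1 = s \<and> e x1 = x \<and> (s1, a, x1, s', y, d1, d2) \<in> T})\<rparr>"
  define cm where "cm = (\<lambda>(s, i :: nat, t, h :: nat). (f s, i, (\<lambda>n :: nat. e (t n)), h))"
  have wf: "wf_ntm M"
    unfolding wf_ntm_def using fin mem T by (auto simp: M_def)
  have pres: "s' \<in> S \<and> (\<forall>n. t' n \<in> G)"
    if "tstep T w (s, i, t, h) (s', i', t', h')" "s \<in> S" "\<forall>n. t n \<in> G" for w s i t h s' i' t' h'
    using that T by (auto simp: tstep_def)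
  have fwd: "ntm_step M w (cm c) (cm c')" if "tstep T w c c'" for w c c'
    using that unfolding tstep_def ntm_step_def cm_def M_def
    by (auto split: prod.splits) (fastforce simp: fun_eq_iff)
  have bwd: "\<exists>c'. d = cm c' \<and> tstep T w (s, i, t, h) c'"
    if st: "ntm_step M w (cm (s, i, t, h)) d" and S: "s \<in> S" "\<forall>n. t n \<in> G" for w s i t h d
  proof -
    from st obtain s1 x1 s' y d1 d2 where
      a: "f s1 = f s" "e x1 = e (t h)" "(s1, input_at w i, x1, s', y, d1, d2) \<in> T"
      and d: "d = (f s', min (move d1 i) (length w + 1), (\<lambda>n. e (t n))(h := e y), move d2 h)"
      by (auto simp: ntm_step_def cm_def M_def)
    have "s1 = s" "x1 = t h"
      using a S T f e by (auto dest!: inj_onD)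
    then show ?thesis
      using a d by (intro exI[of _ "(s', min (move d1 i) (length w + 1), t(h := y), move d2 h)"])
        (auto simp: cm_def tstep_def fun_eq_iff)
  qed
  have init: "init_conf M = cm (s0, 0, \<lambda>_. b, 0)"
    by (simp add: init_conf_def cm_def M_def)
  have r1: "reachable M w (cm c)" if "(tstep T w)\<^sup>*\<^sup>* (s0, 0, \<lambda>_. b, 0) c" for w c
    using that unfolding reachable_def init
    by (induction rule: rtranclp_induct) (auto intro: rtranclp.rtrancl_into_rtrancl fwd)
  have r2: "\<exists>s i t h. d = cm (s, i, t, h) \<and> s \<in> S \<and> (\<forall>n. t n \<in> G) \<and>
      (tstep T w)\<^sup>*\<^sup>* (s0, 0, \<lambda>_. b, 0) (s, i, t, h)"
    if "reachable M w d" for w d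
    using that unfolding reachable_def init
  proof (induction rule: rtranclp_induct)
    case base
    then show ?case using mem by (intro exI) (auto simp: cm_def)
  next
    case (step y z)
    then obtain s i t h where y: "y = cm (s, i, t, h)" "s \<in> S" "\<forall>n. t n \<in> G"
      "(tstep T w)\<^sup>*\<^sup>* (s0, 0, \<lambda>_. b, 0) (s, i, t, h)" by blast
    obtain s' i' t' h' where z: "z = cm (s', i', t', h')" "tstep T w (s, i, t, h) (s', i', t', h')"
      using bwd[OF step.hyps(2)[unfolded y(1)] y(2,3)] by (metis prod_cases4)
    have "(tstep T w)\<^sup>*\<^sup>* (s0, 0, \<lambda>_. b, 0) (s', i', t', h')"
      using y(4) z(2) by (rule rtranclp.rtrancl_into_rtrancl)
    then show ?case using pres[OF z(2) y(2,3)] z(1) by blast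
  qed
  have "space_bounded M (\<lambda>n. c * (length (bits n) + 1))"
    unfolding space_bounded_def
  proof (intro allI impI)
    fix w d assume "reachable M w d"
    then obtain s i t h where "d = cm (s, i, t, h)"
      "(tstep T w)\<^sup>*\<^sup>* (s0, 0, \<lambda>_. b, 0) (s, i, t, h)" using r2 by blast
    then show "snd (snd (snd d)) < c * (length (bits (length w)) + 1)"
      using space by (auto simp: cm_def)
  qed
  moreover have "w \<in> L \<longleftrightarrow> accepts M w" for w
  proof
    assume "w \<in> L"
    then obtain s i t h where "(tstep T w)\<^sup>*\<^sup>* (s0, 0, \<lambda>_. b, 0) (s, i, t, h)" "s \<in> F"
      using lang by blast
    then show "accepts M w"
      unfolding accepts_def using r1 by (intro exI[of _ "cm (s, i, t, h)"]) (auto simp: cm_def M_def)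
  next
    assume "accepts M w"
    then obtain d where d: "reachable M w d" "fst d \<in> f ` F" by (auto simp: accepts_def M_def)
    then obtain s i t h where *: "d = cm (s, i, t, h)" "s \<in> S"
      "(tstep T w)\<^sup>*\<^sup>* (s0, 0, \<lambda>_. b, 0) (s, i, t, h)" using r2 by blast
    have "s \<in> F" using d(2) *(1,2) f mem(3) by (auto simp: cm_def dest: inj_onD)
    with * show "w \<in> L" using lang by blast
  qed
  ultimately show ?thesis
    unfolding in_NL_def using wf by blast
qed

section \<open>Pebble programs\<close>

datatype instr = Rew | Right | Store nat | Eq nat | Neq nat | Sym "insym set"

datatype prog = Skip | I instr | Seq prog prog | Choice prog prog | Star prog

type_synonym pst = "nat \<times> (nat \<Rightarrow> nat)"

text \<open>\<open>Right\<close> is blocked at the right end marker, where the head of the machine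
  would be clamped. A successful \<open>Right\<close> thus always adds exactly one to the position,
  in step with the binary copy on the tape.\<close>

fun exec :: "sym list \<Rightarrow> instr \<Rightarrow> pst \<Rightarrow> pst \<Rightarrow> bool" where
  "exec w Rew (i, r) s \<longleftrightarrow> s = (0, r)"
| "exec w Right (i, r) s \<longleftrightarrow> i \<le> length w \<and> s = (Suc i, r)"
| "exec w (Store j) (i, r) s \<longleftrightarrow> s = (i, r(j := i))"
| "exec w (Eq j) (i, r) s \<longleftrightarrow> r j = i \<and> s = (i, r)"
| "exec w (Neq j) (i, r) s \<longleftrightarrow> r j \<noteq> i \<and> s = (i, r)"
| "exec w (Sym A) (i, r) s \<longleftrightarrow> input_at w i \<in> A \<and> s = (i, r)"

fun sem :: "sym list \<Rightarrow> prog \<Rightarrow> (pst \<times> pst) set" where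
  "sem w Skip = Id"
| "sem w (I a) = {(s, s'). exec w a s s'}"
| "sem w (Seq P Q) = sem w P O sem w Q"
| "sem w (Choice P Q) = sem w P \<union> sem w Q"
| "sem w (Star P) = (sem w P)\<^sup>*"

text \<open>Breaks \<open>sem\<close> into single instructions. The residual program is the control
  state of the machine, and resolving \<open>Choice\<close> or \<open>Star\<close> is a silent step
  that touches neither head nor registers.\<close>

inductive lstep :: "prog \<Rightarrow> instr option \<Rightarrow> prog \<Rightarrow> bool" where
  "lstep (I a) (Some a) Skip"
| "lstep (Seq Skip Q) None Q"
| "lstep P l P' \<Longrightarrow> lstep (Seq P Q) l (Seq P' Q)"
| "lstep (Choice P Q) None P"
| "lstep (Choice P Q) None Q"
| "lstep (Star P) None Skip"
| "lstep (Star P) None (Seq P (Star P))"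

inductive pstep :: "sym list \<Rightarrow> prog \<times> pst \<Rightarrow> prog \<times> pst \<Rightarrow> bool" for w where
  "lstep P None P' \<Longrightarrow> pstep w (P, s) (P', s)"
| "lstep P (Some a) P' \<Longrightarrow> exec w a s s' \<Longrightarrow> pstep w (P, s) (P', s')"

text \<open>Steps are pulled back: whatever the residual achieves was already possible for the
  program before the step. Induction from the end of a run then shows that small steps produce only
  behaviour allowed by \<open>sem\<close>.\<close>

lemma lstep_sem:
  "lstep P l P' \<Longrightarrow> (s', s'') \<in> sem w P' \<Longrightarrow>
    (case l of None \<Rightarrow> s = s' | Some a \<Rightarrow> exec w a s s') \<Longrightarrow> (s, s'') \<in> sem w P"
proof (induction arbitrary: s s' s'' rule: lstep.induct)
  case (3 P l P' Q)
  from 3(3) obtain t where "(s', t) \<in> sem w P'" and t: "(t, s'') \<in> sem w Q" by auto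
  then have "(s, t) \<in> sem w P" using 3(2,4) by blast
  with t show ?case by auto
next
  case (7 P)
  then show ?case by (auto intro: converse_rtrancl_into_rtrancl)
qed auto

lemma psteps_sem: "(pstep w)\<^sup>*\<^sup>* (P, s) (Skip, s') \<Longrightarrow> (s, s') \<in> sem w P"
proof (induction "(P, s)" arbitrary: P s rule: converse_rtranclp_induct)
  case base
  then show ?case by simp
next
  case (step y)
  from step(1,3) show ?case by cases (auto intro: lstep_sem)
qed

lemma psteps_Seq:
  "(pstep w)\<^sup>*\<^sup>* (P, s) (P', s') \<Longrightarrow> (pstep w)\<^sup>*\<^sup>* (Seq P Q, s) (Seq P' Q, s')"
proof (induction "(P', s')" arbitrary: P' s' rule: rtranclp_induct)
  case (step y)
  from step(2) obtain P1 s1 where y: "y = (P1, s1)" and "pstep w (Seq P1 Q, s1) (Seq P' Q, s')"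
    by cases (auto intro: lstep.intros pstep.intros)
  with step(3)[OF y] show ?case by (meson rtranclp.rtrancl_into_rtrancl)
qed auto

lemma sem_psteps: "(s, s') \<in> sem w P \<Longrightarrow> (pstep w)\<^sup>*\<^sup>* (P, s) (Skip, s')"
proof (induction P arbitrary: s s')
  case (Seq P Q)
  then obtain s1 where "(s, s1) \<in> sem w P" "(s1, s') \<in> sem w Q" by auto
  then have "(pstep w)\<^sup>*\<^sup>* (Seq P Q, s) (Seq Skip Q, s1)" "(pstep w)\<^sup>*\<^sup>* (Q, s1) (Skip, s')"
    using Seq.IH psteps_Seq by blast+
  moreover have "pstep w (Seq Skip Q, s1) (Q, s1)" by (intro pstep.intros lstep.intros)
  ultimately show ?case by (meson rtranclp_trans converse_rtranclp_into_rtranclp)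
next
  case (Choice P Q)
  moreover have "pstep w (Choice P Q, s) (P, s)" "pstep w (Choice P Q, s) (Q, s)"
    by (intro pstep.intros lstep.intros)+
  moreover have "(pstep w)\<^sup>*\<^sup>* (P, s) (Skip, s') \<or> (pstep w)\<^sup>*\<^sup>* (Q, s) (Skip, s')"
    using Choice.IH Choice.prems unfolding sem.simps by blast
  ultimately show ?case by (meson converse_rtranclp_into_rtranclp)
next
  case (Star P)
  from Star.prems have "(s, s') \<in> (sem w P)\<^sup>*" by simp
  then show ?case
  proof (induction rule: converse_rtrancl_induct)
    case base
    show ?case by (intro r_into_rtranclp pstep.intros lstep.intros)
  next
    case (step y z)
    have "pstep w (Star P, y) (Seq P (Star P), y)"
      and "pstep w (Seq Skip (Star P), z) (Star P, z)" by (intro pstep.intros lstep.intros)+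
    moreover have "(pstep w)\<^sup>*\<^sup>* (Seq P (Star P), y) (Seq Skip (Star P), z)"
      by (intro psteps_Seq Star.IH step.hyps)
    ultimately show ?case using step.IH
      by (meson rtranclp_trans converse_rtranclp_into_rtranclp)
  qed
qed (auto intro!: r_into_rtranclp pstep.intros lstep.intros)

text \<open>A program and its partial derivatives (as for regular expressions); since there are only
finitely many, they can serve as machine states.\<close>
fun conts :: "prog \<Rightarrow> prog set" where
  "conts Skip = {Skip}"
| "conts (I a) = {I a, Skip}"
| "conts (Seq P Q) = (\<lambda>P'. Seq P' Q) ` conts P \<union> conts Q"
| "conts (Choice P Q) = {Choice P Q} \<union> conts P \<union> conts Q"
| "conts (Star P) = {Star P, Skip} \<union> (\<lambda>P'. Seq P' (Star P)) ` conts P"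

lemma finite_conts: "finite (conts P)"
  by (induction P) auto

lemma conts_refl: "P \<in> conts P"
  by (induction P) auto

text \<open>This makes \<open>conts\<close> usable as a set of states. Leaving a finished first
  component leads to \<open>Q\<close> itself, and finishing a loop body leads back to the
  \<open>Star\<close>, so no new residuals arise.\<close>

lemma conts_lstep: "lstep P' l P'' \<Longrightarrow> P' \<in> conts P \<Longrightarrow> P'' \<in> conts P"
proof (induction P arbitrary: P' P'')
  case (Seq P Q)
  then show ?case using conts_refl by (auto elim!: lstep.cases[of "Seq _ _"])
next
  case (Choice P Q)
  then show ?case using conts_refl by (auto elim!: lstep.cases[of "Choice _ _"])
next
  case (Star P)
  then show ?case using conts_refl
    by (auto elim!: lstep.cases[of "Seq _ _"] lstep.cases[of "Star _"] lstep.cases[of Skip])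
qed (auto elim: lstep.cases)

fun instrs :: "prog \<Rightarrow> instr set" where
  "instrs Skip = {}"
| "instrs (I a) = {a}"
| "instrs (Seq P Q) = instrs P \<union> instrs Q"
| "instrs (Choice P Q) = instrs P \<union> instrs Q"
| "instrs (Star P) = instrs P"

lemma finite_instrs: "finite (instrs P)"
  by (induction P) auto

lemma lstep_instrs: "lstep P l P' \<Longrightarrow> instrs P' \<subseteq> instrs P \<and> set_option l \<subseteq> instrs P"
  by (induction rule: lstep.induct) auto

text \<open>The default 0 is harmless: the function only feeds a strict upper bound on register
  indices.\<close>

fun reg_of :: "instr \<Rightarrow> nat" where
  "reg_of (Store j) = j"
| "reg_of (Eq j) = j"
| "reg_of (Neq j) = j"
| "reg_of _ = 0"

section \<open>Simulating programs in logarithmic space\<close>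

text \<open>The work tape holds a left end marker and then columns of bits, least significant column
first. A column is the set of tracks carrying a 1; track 0 stores the position of the input head
and track \<open>Suc j\<close> stores register \<open>j\<close>.\<close>

datatype tsym = Mk | Bl | Col "nat set"

text \<open>One instruction on registers or head is one round trip of the work head: rewind the
  input head if demanded, sweep right through all columns in \<open>Pass\<close>, come back in
  \<open>Ret\<close>. In \<open>Ready\<close> the work head is on the left end marker.\<close>

datatype tstate = Init | Ready prog | Rewind prog | Pass instr bool prog | Ret prog

fun val :: "nat set list \<Rightarrow> nat \<Rightarrow> nat" where
  "val [] j = 0"
| "val (c # cs) j = (if j \<in> c then 1 else 0) + 2 * val cs j"

definition decode :: "nat set list \<Rightarrow> pst" where
  "decode cs = (val cs 0, \<lambda>j. val cs (Suc j))"

definition tape :: "nat set list \<Rightarrow> nat \<Rightarrow> tsym" where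
  "tape cs h = (case h of 0 \<Rightarrow> Mk | Suc n \<Rightarrow> if n < length cs then Col (cs ! n) else Bl)"

text \<open>The flag is the carry for \<open>Right\<close> and the equality found so far for \<open>Eq\<close> and \<open>Neq\<close>.\<close>
fun pass1 :: "instr \<Rightarrow> bool \<Rightarrow> nat set \<Rightarrow> nat set \<times> bool" where
  "pass1 Rew f c = (c - {0}, f)"
| "pass1 Right f c = (if f then if 0 \<in> c then (c - {0}, True) else (insert 0 c, False) else (c, False))"
| "pass1 (Store j) f c = (if 0 \<in> c then insert (Suc j) c else c - {Suc j}, f)"
| "pass1 (Eq j) f c = (c, f \<and> (0 \<in> c \<longleftrightarrow> Suc j \<in> c))"
| "pass1 (Neq j) f c = (c, f \<and> (0 \<in> c \<longleftrightarrow> Suc j \<in> c))"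
| "pass1 (Sym A) f c = (c, f)"

text \<open>A carry that survives the last column opens a new one. Columns are thus allocated on
  demand as the input head travels, and the tape length need not be computed in advance.\<close>

fun pass :: "instr \<Rightarrow> bool \<Rightarrow> nat set list \<Rightarrow> nat set list \<times> bool" where
  "pass a f [] = (if a = Right \<and> f then [{0}] else [], f)"
| "pass a f (c # cs) = (fst (pass1 a f c) # fst (pass a (snd (pass1 a f c)) cs),
     snd (pass a (snd (pass1 a f c)) cs))"

fun endok :: "instr \<Rightarrow> bool \<Rightarrow> bool" where
  "endok (Eq j) f = f"
| "endok (Neq j) f = (\<not> f)"
| "endok _ f = True"

text \<open>The nondeterminism lies in the choice of a residual at \<open>Ready\<close>; the rest
  merely executes the chosen instruction. A failed test and \<open>Right\<close> on the right end
  marker have no successor, so such a branch dies.\<close>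

inductive ttr :: "prog \<Rightarrow> tstate \<Rightarrow> insym \<Rightarrow> tsym \<Rightarrow> tstate \<Rightarrow> tsym \<Rightarrow> dir \<Rightarrow> dir \<Rightarrow> bool" for P0 where
  t_init: "ttr P0 Init a Bl (Ready P0) Mk Stay Stay"
| t_eps: "lstep P None P' \<Longrightarrow> ttr P0 (Ready P) a Mk (Ready P') Mk Stay Stay"
| t_sym: "lstep P (Some (Sym A)) P' \<Longrightarrow> a \<in> A \<Longrightarrow> ttr P0 (Ready P) a Mk (Ready P') Mk Stay Stay"
| t_rew: "lstep P (Some Rew) P' \<Longrightarrow> ttr P0 (Ready P) a Mk (Rewind P') Mk Stay Stay"
| t_rew1: "a \<noteq> LEnd \<Longrightarrow> ttr P0 (Rewind P) a Mk (Rewind P) Mk Lft Stay"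
| t_rew2: "ttr P0 (Rewind P) LEnd Mk (Pass Rew True P) Mk Stay Rgt"
| t_right: "lstep P (Some Right) P' \<Longrightarrow> a \<noteq> REnd \<Longrightarrow>
    ttr P0 (Ready P) a Mk (Pass Right True P') Mk Rgt Rgt"
| t_other: "lstep P (Some i) P' \<Longrightarrow> i \<in> range Store \<union> range Eq \<union> range Neq \<Longrightarrow>
    ttr P0 (Ready P) a Mk (Pass i True P') Mk Stay Rgt"
| t_pass: "ttr P0 (Pass i f P) a (Col c) (Pass i (snd (pass1 i f c)) P) (Col (fst (pass1 i f c))) Stay Rgt"
| t_pend: "endok i f \<Longrightarrow>
    ttr P0 (Pass i f P) a Bl (Ret P) (if i = Right \<and> f then Col {0} else Bl) Stay Lft"
| t_ret: "ttr P0 (Ret P) a (Col c) (Ret P) (Col c) Stay Lft"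
| t_ret2: "ttr P0 (Ret P) a Mk (Ready P) Mk Stay Stay"

section \<open>One sweep over the columns as binary arithmetic\<close>

lemma pass_Right_False: "pass Right False cs = (cs, False)"
  by (induction cs) auto

lemma val_pass_Rew: "val (fst (pass Rew f cs)) j = (if j = 0 then 0 else val cs j)"
  by (induction cs arbitrary: f) auto

lemma val_pass_Right: "val (fst (pass Right f cs)) j = (if j = 0 \<and> f then Suc (val cs 0) else val cs j)"
proof (induction cs arbitrary: f)
  case (Cons c cs)
  then show ?case by (cases f) (auto simp: pass_Right_False)
qed auto

lemma val_pass_Store: "val (fst (pass (Store k) f cs)) j = (if j = Suc k then val cs 0 else val cs j)"
  by (induction cs arbitrary: f) auto

lemma pass_test: "fst (pass (Eq k) f cs) = cs" "fst (pass (Neq k) f cs) = cs"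
  "fst (pass (Sym A) f cs) = cs"
  by (induction cs arbitrary: f) auto

lemma bit_plus_double_eq_iff: "(if a then 1 else 0) + 2 * x = (if b then 1 else 0) + 2 * (y :: nat) \<longleftrightarrow>
    (a \<longleftrightarrow> b) \<and> x = y"
  by (cases a; cases b; simp; presburger)

lemma pass_flag:
  "snd (pass (Eq k) f cs) \<longleftrightarrow> f \<and> val cs 0 = val cs (Suc k)"
  "snd (pass (Neq k) f cs) \<longleftrightarrow> f \<and> val cs 0 = val cs (Suc k)"
  by (induction cs arbitrary: f) (simp_all only: pass.simps pass1.simps val.simps snd_conv bit_plus_double_eq_iff, auto)

text \<open>The link between tape and semantics. \<open>Sym\<close> is excluded because it inspects
  the input and is performed without a sweep; the side condition on \<open>Right\<close> is what the
  machine sees as not standing on the right end marker.\<close>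

lemma exec_pass:
  assumes "\<And>A. a \<noteq> Sym A"
  shows "exec w a (decode cs) s \<longleftrightarrow> s = decode (fst (pass a True cs)) \<and>
    endok a (snd (pass a True cs)) \<and> (a = Right \<longrightarrow> val cs 0 \<le> length w)"
  using assms
  by (cases a) (auto simp: decode_def val_pass_Rew val_pass_Right val_pass_Store pass_test pass_flag
    fun_eq_iff)

text \<open>Source of the space bound. The carry survives only if track 0 consists of ones, so a
  column is added exactly when the new head position is the power of two given by the old number of
  columns.\<close>

lemma length_pass:
  "length (fst (pass a f cs)) = length cs \<or>
   (a = Right \<and> f \<and> length (fst (pass a f cs)) = Suc (length cs) \<and> 2 ^ length cs = Suc (val cs 0))"
proof (induction cs arbitrary: f)
  case (Cons c cs)
  from Cons[of "snd (pass1 a f c)"] show ?case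
    by (cases a; cases f) (auto simp: pass_Right_False)
qed auto

lemma pass_cols: "reg_of a < m \<Longrightarrow> \<forall>c\<in>set cs. c \<subseteq> {..m} \<Longrightarrow> \<forall>c\<in>set (fst (pass a f cs)). c \<subseteq> {..m}"
proof (induction cs arbitrary: f)
  case (Cons c cs)
  then show ?case by (cases a) (auto split: if_splits)
qed auto

lemma less_two_power_bits: "n < 2 ^ length (bits n)"
proof (induction n rule: bits.induct)
  case (1 n)
  then have "n \<noteq> 0 \<Longrightarrow> n div 2 < 2 ^ length (bits (n div 2))" by simp
  then show ?case by (subst bits.simps) (cases "n = 0", simp_all)
qed

lemma power_le_bits: "2 ^ l \<le> Suc n \<Longrightarrow> l \<le> length (bits n)"
  using less_two_power_bits[of n] by (metis Suc_leI le_trans nat_power_eq_Suc_0_iff one_less_numeral_iff power_le_imp_le_exp semiring_norm(76))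

lemma exec_bound: "exec w a (i, r) (i', r') \<Longrightarrow> i \<le> Suc (length w) \<Longrightarrow> i' \<le> Suc (length w)"
  by (cases a) auto

lemma input_at_LEnd: "input_at w i = LEnd \<longleftrightarrow> i = 0"
  by (simp add: input_at_def)

lemma input_at_REnd: "input_at w i = REnd \<longleftrightarrow> length w < i"
  by (auto simp: input_at_def)

section \<open>Soundness of the simulation by an invariant on machine configurations\<close>

context
  fixes P0 :: prog and m :: nat
  assumes m: "\<And>a. a \<in> instrs P0 \<Longrightarrow> reg_of a < m"
begin

definition sim_states :: "tstate set" where
  "sim_states = {Init} \<union> Ready ` conts P0 \<union> Rewind ` conts P0 \<union> Ret ` conts P0 \<union>
     (\<lambda>(a, f, P). Pass a f P) ` (instrs P0 \<times> UNIV \<times> conts P0)"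

definition sim_syms :: "tsym set" where
  "sim_syms = {Mk, Bl} \<union> Col ` Pow {..m}"

definition sim_trans :: "(tstate \<times> insym \<times> tsym \<times> tstate \<times> tsym \<times> dir \<times> dir) set" where
  "sim_trans = {(s, a, g, s', g', d1, d2). ttr P0 s a g s' g' d1 d2} \<inter>
     sim_states \<times> UNIV \<times> sim_syms \<times> sim_states \<times> sim_syms \<times> UNIV \<times> UNIV"

abbreviation "sim w \<equiv> (tstep sim_trans w)\<^sup>*\<^sup>*"

text \<open>Columns are never released, not even when \<open>Rew\<close> clears track 0. Their
  number must therefore be bounded in terms of \<open>w\<close>, as the current head position may
  long be smaller than the one that created them.\<close>

definition reps :: "sym list \<Rightarrow> prog \<Rightarrow> nat set list \<Rightarrow> bool" where
  "reps w P cs \<longleftrightarrow> (pstep w)\<^sup>*\<^sup>* (P0, 0, \<lambda>_. 0) (P, decode cs) \<and> val cs 0 \<le> Suc (length w) \<and>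
     (cs = [] \<or> 2 ^ (length cs - 1) \<le> Suc (length w))"

text \<open>An unfinished sweep is described by its outcome: the columns done so far followed by the
  sweep of the remaining ones must be the complete sweep of the columns \<open>cs0\<close> at its
  start. Each sweep step is then an unfolding of \<open>pass\<close>. The input head has already
  moved by then, hence \<open>i\<close> is read off the outcome. While rewinding, it agrees with
  nothing on the tape and is left free.\<close>

fun inv :: "sym list \<Rightarrow> tstate \<times> nat \<times> (nat \<Rightarrow> tsym) \<times> nat \<Rightarrow> bool" where
  "inv w (Init, i, t, h) \<longleftrightarrow> i = 0 \<and> t = (\<lambda>_. Bl) \<and> h = 0"
| "inv w (Ready P, i, t, h) \<longleftrightarrow> (\<exists>cs. t = tape cs \<and> h = 0 \<and> i = val cs 0 \<and> reps w P cs)"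
| "inv w (Rewind P, i, t, h) \<longleftrightarrow>
     (\<exists>cs Q. t = tape cs \<and> h = 0 \<and> lstep Q (Some Rew) P \<and> reps w Q cs)"
| "inv w (Pass a f P, i, t, h) \<longleftrightarrow> (\<exists>cs0 pre cs Q. t = tape (pre @ cs) \<and> h = Suc (length pre) \<and>
     length cs0 = length (pre @ cs) \<and> fst (pass a True cs0) = pre @ fst (pass a f cs) \<and>
     snd (pass a True cs0) = snd (pass a f cs) \<and> lstep Q (Some a) P \<and> reps w Q cs0 \<and>
     i = val (fst (pass a True cs0)) 0 \<and> (a = Right \<longrightarrow> val cs0 0 \<le> length w) \<and> (\<forall>A. a \<noteq> Sym A))"
| "inv w (Ret P, i, t, h) \<longleftrightarrow> (\<exists>cs. t = tape cs \<and> h \<le> length cs \<and> i = val cs 0 \<and> reps w P cs)"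

lemma reps_None: "reps w P cs \<Longrightarrow> lstep P None P' \<Longrightarrow> reps w P' cs"
  unfolding reps_def by (meson pstep.intros(1) rtranclp.rtrancl_into_rtrancl)

lemma reps_Sym: "reps w P cs \<Longrightarrow> lstep P (Some (Sym A)) P' \<Longrightarrow> input_at w (val cs 0) \<in> A \<Longrightarrow> reps w P' cs"
  unfolding reps_def
  by (metis decode_def exec.simps(6) pstep.intros(2) rtranclp.rtrancl_into_rtrancl)

lemma reps_pass:
  assumes "reps w P cs" "lstep P (Some a) P'" "\<And>A. a \<noteq> Sym A" "endok a (snd (pass a True cs))"
    "a = Right \<longrightarrow> val cs 0 \<le> length w"
  shows "reps w P' (fst (pass a True cs))"
proof -
  have ex: "exec w a (decode cs) (decode (fst (pass a True cs)))"
    using assms exec_pass by blast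
  then have "(pstep w)\<^sup>*\<^sup>* (P0, 0, \<lambda>_. 0) (P', decode (fst (pass a True cs)))"
    using assms(1,2) unfolding reps_def by (meson pstep.intros(2) rtranclp.rtrancl_into_rtrancl)
  moreover have "val (fst (pass a True cs)) 0 \<le> Suc (length w)"
    using ex assms(1) exec_bound unfolding reps_def decode_def by blast
  \<comment> \<open>Only \<open>Right\<close> opens a column, and then \<open>2 ^ length cs\<close>
    is the new head position, which is at most \<open>Suc (length w)\<close>. Otherwise the old
    bound persists.\<close>
  moreover have "fst (pass a True cs) = [] \<or>
      2 ^ (length (fst (pass a True cs)) - 1) \<le> Suc (length w)"
    using length_pass[of a True cs] assms(1,5) unfolding reps_def by (auto split: if_splits)
  ultimately show ?thesis unfolding reps_def by blast
qed

lemma tape_simps [simp]: "tape cs 0 = Mk"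
  "tape (pre @ c # cs) (Suc (length pre)) = Col c" "tape pre (Suc (length pre)) = Bl"
  by (auto simp: tape_def nth_append)

lemma tape_upd: "(tape cs)(0 := Mk) = tape cs"
  "(tape (pre @ c # cs))(Suc (length pre) := Col c') = tape (pre @ c' # cs)"
  "(tape pre)(Suc (length pre) := Bl) = tape pre"
  "(tape pre)(Suc (length pre) := Col c') = tape (pre @ [c'])"
  "(\<lambda>_. Bl)(0 := Mk) = tape []"
  by (auto simp: tape_def fun_eq_iff nth_append split: nat.splits)

lemma inv_Pass:
  assumes "lstep Q (Some a) P" "reps w Q cs" "a = Right \<longrightarrow> val cs 0 \<le> length w" "\<forall>A. a \<noteq> Sym A"
    "i = val (fst (pass a True cs)) 0"
  shows "inv w (Pass a True P, i, tape cs, Suc 0)"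
  unfolding inv.simps using assms
  by - (rule exI[of _ cs], rule exI[of _ "[]"], rule exI[of _ cs], rule exI[of _ Q], simp)

lemma inv_step:
  assumes inv: "inv w (s, i, t, h)" and st: "tstep sim_trans w (s, i, t, h) c'"
  shows "inv w c'"
proof -
  from st obtain s' g d1 d2 where tr: "ttr P0 s (input_at w i) (t h) s' g d1 d2"
    and c': "c' = (s', min (move d1 i) (length w + 1), t(h := g), move d2 h)"
    by (auto simp: tstep_def sim_trans_def)
  from tr show ?thesis
  proof cases
    case t_init
    then show ?thesis using inv c'
      by (auto simp: move_def tape_upd reps_def decode_def intro!: exI[of _ "[]"])
  next
    case (t_eps P P')
    then obtain cs where cs: "t = tape cs" "h = 0" "i = val cs 0" "reps w P cs" using inv by auto
    then have "reps w P' cs" using t_eps reps_None by blast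
    then show ?thesis using cs c' t_eps by (auto simp: move_def tape_upd reps_def)
  next
    case (t_sym P A P')
    then obtain cs where cs: "t = tape cs" "h = 0" "i = val cs 0" "reps w P cs" using inv by auto
    then have "reps w P' cs" using t_sym reps_Sym by blast
    then show ?thesis using cs c' t_sym by (auto simp: move_def tape_upd reps_def)
  next
    case (t_rew P P')
    then show ?thesis using inv c' by (auto simp: move_def tape_upd)
  next
    case (t_rew1 P)
    then show ?thesis using inv c' by (auto simp: move_def tape_upd)
  next
    case (t_rew2 P)
    then obtain cs Q where cs: "t = tape cs" "h = 0" "lstep Q (Some Rew) P" "reps w Q cs"
      using inv by auto
    have "i = 0" using t_rew2 by (simp add: input_at_LEnd)
    then show ?thesis using cs c' t_rew2 inv_Pass[of Q Rew P w cs 0]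
      by (simp add: move_def tape_upd val_pass_Rew)
  next
    case (t_right P P')
    then obtain cs where cs: "t = tape cs" "h = 0" "i = val cs 0" "reps w P cs" using inv by auto
    have "i \<le> length w" using t_right by (simp add: input_at_REnd)
    then show ?thesis using cs c' t_right inv_Pass[of P Right P' w cs "Suc i"]
      by (simp add: move_def tape_upd val_pass_Right min_absorb1)
  next
    case (t_other P a P')
    then obtain cs where cs: "t = tape cs" "h = 0" "i = val cs 0" "reps w P cs" using inv by auto
    moreover have "val (fst (pass a True cs)) 0 = val cs 0"
      using t_other by (auto simp: val_pass_Store pass_test)
    moreover have "i \<le> Suc (length w)" using cs by (simp add: reps_def)
    ultimately show ?thesis using c' t_other inv_Pass[of P a P' w cs i]
      by (auto simp: move_def tape_upd min_absorb1 simp del: inv.simps)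
  next
    case (t_pass a f P c)
    then obtain cs0 pre cs Q where cs: "t = tape (pre @ cs)" "h = Suc (length pre)"
      "length cs0 = length (pre @ cs)" "fst (pass a True cs0) = pre @ fst (pass a f cs)"
      "snd (pass a True cs0) = snd (pass a f cs)" "lstep Q (Some a) P" "reps w Q cs0"
      "i = val (fst (pass a True cs0)) 0" "a = Right \<longrightarrow> val cs0 0 \<le> length w" "\<forall>A. a \<noteq> Sym A"
      using inv by auto
    obtain cs' where cs': "cs = c # cs'" using t_pass cs(1,2) by (cases cs) auto
    \<comment> \<open>Shows that clamping the input head with \<open>min\<close> has no effect in
      this step.\<close>
    have "i \<le> Suc (length w)"
      using cs(7-10) unfolding reps_def
      by (cases a) (auto simp: val_pass_Rew val_pass_Right val_pass_Store pass_test)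
    then have c1: "c' = (Pass a (snd (pass1 a f c)) P, i, tape ((pre @ [fst (pass1 a f c)]) @ cs'),
        Suc (length (pre @ [fst (pass1 a f c)])))"
      using c' t_pass cs cs' by (simp add: move_def tape_upd)
    moreover have "fst (pass a True cs0) = (pre @ [fst (pass1 a f c)]) @ fst (pass a (snd (pass1 a f c)) cs')"
      "snd (pass a True cs0) = snd (pass a (snd (pass1 a f c)) cs')"
      "length cs0 = length ((pre @ [fst (pass1 a f c)]) @ cs')"
      using cs cs' by auto
    ultimately have "inv w (Pass a (snd (pass1 a f c)) P, i, tape ((pre @ [fst (pass1 a f c)]) @ cs'),
        Suc (length (pre @ [fst (pass1 a f c)])))"
      using cs(6-) unfolding inv.simps by blast
    then show ?thesis unfolding c1 .
  next
    case (t_pend a f P)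
    then obtain cs0 pre cs Q where cs: "t = tape (pre @ cs)" "h = Suc (length pre)"
      "length cs0 = length (pre @ cs)" "fst (pass a True cs0) = pre @ fst (pass a f cs)"
      "snd (pass a True cs0) = snd (pass a f cs)" "lstep Q (Some a) P" "reps w Q cs0"
      "i = val (fst (pass a True cs0)) 0" "a = Right \<longrightarrow> val cs0 0 \<le> length w" "\<forall>A. a \<noteq> Sym A"
      using inv by auto
    have [simp]: "cs = []" using t_pend cs(1,2) by (cases cs) auto
    have r: "reps w P (fst (pass a True cs0))"
      using cs t_pend by (intro reps_pass[of w Q]) auto
    then have "i \<le> Suc (length w)" using cs(8) by (auto simp: reps_def)
    then have "c' = (Ret P, i, tape (fst (pass a True cs0)), length pre)"
      using c' t_pend cs(1,2,4) by (auto simp: move_def tape_upd)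
    then show ?thesis using r cs by auto
  next
    case (t_ret P c)
    then obtain cs where cs: "t = tape cs" "h \<le> length cs" "i = val cs 0" "reps w P cs"
      using inv by auto
    have "(tape cs)(h := Col c) = tape cs" using t_ret cs by auto
    then show ?thesis using cs c' t_ret by (auto simp: move_def reps_def)
  next
    case (t_ret2 P)
    then obtain cs where cs: "t = tape cs" "h \<le> length cs" "i = val cs 0" "reps w P cs"
      using inv by auto
    have "h = 0" using t_ret2 cs by (auto simp: tape_def split: nat.splits if_splits)
    then show ?thesis using cs c' t_ret2 by (auto simp: move_def tape_upd reps_def)
  qed
qed

lemma inv_reach: "sim w (Init, 0, \<lambda>_. Bl, 0) c \<Longrightarrow> inv w c"
proof (induction rule: rtranclp_induct)
  case (step y z)
  then show ?case using inv_step by (cases y) blast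
qed simp

lemma reps_width: "reps w P cs \<Longrightarrow> length cs \<le> Suc (length (bits (length w)))"
  using power_le_bits[of "length cs - 1" "length w"] unfolding reps_def by (cases cs) auto

text \<open>With \<open>l\<close> bits for the input length there are at most \<open>l + 1\<close>
  columns, and a sweep ends on the blank after them, in cell \<open>l + 2\<close>. For the empty
  input this is cell 2, which is why the factor is 3.\<close>

lemma inv_space: "inv w (s, i, t, h) \<Longrightarrow> h < 3 * (length (bits (length w)) + 1)"
  by (cases s) (auto dest!: reps_width simp del: bits.simps)

section \<open>Completeness of the simulation: machine runs realizing one program step\<close>

lemma sim_step:
  assumes "ttr P0 s (input_at w i) (t h) s' g d1 d2" "s \<in> sim_states" "s' \<in> sim_states"
    "t h \<in> sim_syms" "g \<in> sim_syms"
  shows "tstep sim_trans w (s, i, t, h) (s', min (move d1 i) (Suc (length w)), t(h := g), move d2 h)"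
  using assms unfolding tstep_def sim_trans_def by auto

lemma sim_statesI [simp]:
  "Init \<in> sim_states" "Ready P \<in> sim_states \<longleftrightarrow> P \<in> conts P0"
  "Rewind P \<in> sim_states \<longleftrightarrow> P \<in> conts P0" "Ret P \<in> sim_states \<longleftrightarrow> P \<in> conts P0"
  "Pass a f P \<in> sim_states \<longleftrightarrow> a \<in> instrs P0 \<and> P \<in> conts P0"
  by (auto simp: sim_states_def image_iff)

lemma sim_symsI [simp]: "Mk \<in> sim_syms" "Bl \<in> sim_syms" "Col c \<in> sim_syms \<longleftrightarrow> c \<subseteq> {..m}"
  by (auto simp: sim_syms_def)

lemma run_ret:
  assumes "P \<in> conts P0" "i \<le> Suc (length w)" "\<forall>c\<in>set cs. c \<subseteq> {..m}" "h \<le> length cs"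
  shows "sim w (Ret P, i, tape cs, h) (Ready P, i, tape cs, 0)"
  using assms(4)
proof (induction h)
  case 0
  have "tstep sim_trans w (Ret P, i, tape cs, 0) (Ready P, i, tape cs, 0)"
    using sim_step[of "Ret P" w i "tape cs" 0 "Ready P" Mk Stay Stay]
      t_ret2[of P0 P "input_at w i"] assms
    by (simp add: move_def tape_upd min_absorb1)
  then show ?case by blast
next
  case (Suc h)
  have t: "tape cs (Suc h) = Col (cs ! h)" using Suc.prems by (simp add: tape_def)
  then have "(tape cs)(Suc h := Col (cs ! h)) = tape cs" by auto
  then have "tstep sim_trans w (Ret P, i, tape cs, Suc h) (Ret P, i, tape cs, h)"
    using sim_step[of "Ret P" w i "tape cs" "Suc h" "Ret P" "Col (cs ! h)" Stay Lft]
      t_ret[of P0 P "input_at w i" "cs ! h"] t assms Suc.prems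
    by (simp add: move_def min_absorb1)
  with Suc show ?case by (simp add: converse_rtranclp_into_rtranclp)
qed

lemma run_pass:
  assumes "P \<in> conts P0" "a \<in> instrs P0" "i \<le> Suc (length w)"
    "\<forall>c\<in>set (pre @ cs). c \<subseteq> {..m}" "endok a (snd (pass a f cs))"
  shows "sim w (Pass a f P, i, tape (pre @ cs), Suc (length pre))
    (Ret P, i, tape (pre @ fst (pass a f cs)), length (pre @ cs))"
  using assms(4,5)
proof (induction cs arbitrary: pre f)
  case Nil
  have "tstep sim_trans w (Pass a f P, i, tape pre, Suc (length pre))
      (Ret P, i, tape (pre @ fst (pass a f [])), length pre)"
    using sim_step[of "Pass a f P" w i "tape pre" "Suc (length pre)" "Ret P"
        "if a = Right \<and> f then Col {0} else Bl" Stay Lft]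
      t_pend[of a f P0 P "input_at w i"] assms(1-3) Nil
    by (auto simp: move_def min_absorb1 tape_upd split: if_splits)
  then show ?case by auto
next
  case (Cons c cs)
  let ?c = "fst (pass1 a f c)"
  have c: "?c \<subseteq> {..m}" using m[OF assms(2)] Cons.prems(1) by (cases a) auto
  have "tstep sim_trans w (Pass a f P, i, tape (pre @ c # cs), Suc (length pre))
      (Pass a (snd (pass1 a f c)) P, i, tape ((pre @ [?c]) @ cs), Suc (length (pre @ [?c])))"
    using sim_step[of "Pass a f P" w i "tape (pre @ c # cs)" "Suc (length pre)"
        "Pass a (snd (pass1 a f c)) P" "Col ?c" Stay Rgt]
      t_pass[of P0 a f P "input_at w i" c] assms(1-3) Cons.prems c
    by (simp add: move_def min_absorb1 tape_upd)
  moreover have "sim w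
      (Pass a (snd (pass1 a f c)) P, i, tape ((pre @ [?c]) @ cs), Suc (length (pre @ [?c])))
      (Ret P, i, tape ((pre @ [?c]) @ fst (pass a (snd (pass1 a f c)) cs)), length ((pre @ [?c]) @ cs))"
    using Cons.prems c by (intro Cons.IH) auto
  ultimately show ?case by (simp add: converse_rtranclp_into_rtranclp)
qed

lemma run_rewind:
  assumes "P \<in> conts P0" "Rew \<in> instrs P0" "i \<le> Suc (length w)"
  shows "sim w (Rewind P, i, tape cs, 0) (Pass Rew True P, 0, tape cs, Suc 0)"
  using assms(3)
proof (induction i)
  case 0
  have "tstep sim_trans w (Rewind P, 0, tape cs, 0) (Pass Rew True P, 0, tape cs, Suc 0)"
    using sim_step[of "Rewind P" w 0 "tape cs" 0 "Pass Rew True P" Mk Stay Rgt]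
      t_rew2[of P0 P] assms by (simp add: move_def tape_upd input_at_def)
  then show ?case by blast
next
  case (Suc i)
  have "tstep sim_trans w (Rewind P, Suc i, tape cs, 0) (Rewind P, i, tape cs, 0)"
    using sim_step[of "Rewind P" w "Suc i" "tape cs" 0 "Rewind P" Mk Lft Stay]
      t_rew1[of "input_at w (Suc i)" P0 P] assms Suc.prems
    by (simp add: move_def tape_upd input_at_LEnd min_absorb1)
  with Suc show ?case by (simp add: converse_rtranclp_into_rtranclp)
qed

lemma sim_pstep:
  assumes st: "pstep w (P, decode cs) (P', s')" and P: "P \<in> conts P0" "instrs P \<subseteq> instrs P0"
    and cs: "\<forall>c\<in>set cs. c \<subseteq> {..m}" "val cs 0 \<le> Suc (length w)"
  shows "\<exists>cs'. s' = decode cs' \<and> (\<forall>c\<in>set cs'. c \<subseteq> {..m}) \<and> val cs' 0 \<le> Suc (length w) \<and>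
    sim w (Ready P, val cs 0, tape cs, 0) (Ready P', val cs' 0, tape cs', 0)"
  using st
proof cases
  case 1
  have "tstep sim_trans w (Ready P, val cs 0, tape cs, 0) (Ready P', val cs 0, tape cs, 0)"
    using sim_step[of "Ready P" w "val cs 0" "tape cs" 0 "Ready P'" Mk Stay Stay]
      t_eps[of P P' P0 "input_at w (val cs 0)"] 1 P cs conts_lstep
    by (simp add: move_def tape_upd min_absorb1)
  then show ?thesis using 1 cs by blast
next
  case (2 a)
  have P': "P' \<in> conts P0" and a: "a \<in> instrs P0"
    using conts_lstep[OF 2(1) P(1)] lstep_instrs[OF 2(1)] P by auto
  show ?thesis
  proof (cases "\<exists>A. a = Sym A")
    case True
    then obtain A where A: "a = Sym A" by blast
    then have "s' = decode cs" "input_at w (val cs 0) \<in> A" using 2 by (auto simp: decode_def)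
    moreover have "tstep sim_trans w (Ready P, val cs 0, tape cs, 0) (Ready P', val cs 0, tape cs, 0)"
      using sim_step[of "Ready P" w "val cs 0" "tape cs" 0 "Ready P'" Mk Stay Stay]
        t_sym[of P A P' "input_at w (val cs 0)" P0] 2 A P P' cs calculation
      by (simp add: move_def tape_upd min_absorb1)
    ultimately show ?thesis using cs by blast
  next
    case False
    let ?cs = "fst (pass a True cs)"
    have ex: "s' = decode ?cs" "endok a (snd (pass a True cs))" "a = Right \<longrightarrow> val cs 0 \<le> length w"
      using exec_pass[of a w cs s'] 2 False by auto
    have b: "val ?cs 0 \<le> Suc (length w)"
      using exec_bound 2(2) ex(1) cs(2) by (auto simp: decode_def)
    have c: "\<forall>c\<in>set ?cs. c \<subseteq> {..m}" using pass_cols[OF m[OF a] cs(1)] .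
    have l: "length cs \<le> length ?cs" using length_pass[of a True cs] by auto
    have "sim w (Ready P, val cs 0, tape cs, 0) (Pass a True P', val ?cs 0, tape cs, Suc 0)"
    proof (cases "a = Rew")
      case True
      then have "tstep sim_trans w (Ready P, val cs 0, tape cs, 0) (Rewind P', val cs 0, tape cs, 0)"
        using sim_step[of "Ready P" w "val cs 0" "tape cs" 0 "Rewind P'" Mk Stay Stay]
          t_rew[of P P' P0 "input_at w (val cs 0)"] 2 P P' cs
        by (simp add: move_def tape_upd min_absorb1)
      then show ?thesis using run_rewind[OF P', of "val cs 0" w cs] cs a True
        by (simp add: val_pass_Rew converse_rtranclp_into_rtranclp)
    next
      case nr: False
      have "tstep sim_trans w (Ready P, val cs 0, tape cs, 0) (Pass a True P', val ?cs 0, tape cs, Suc 0)"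
      proof (cases "a = Right")
        case True
        then show ?thesis
          using sim_step[of "Ready P" w "val cs 0" "tape cs" 0 "Pass a True P'" Mk Rgt Rgt]
            t_right[of P P' "input_at w (val cs 0)" P0] 2 P P' cs a ex
          by (simp add: move_def tape_upd min_absorb1 val_pass_Right input_at_REnd)
      next
        case False
        then have r: "a \<in> range Store \<union> range Eq \<union> range Neq"
          using nr \<open>\<nexists>A. a = Sym A\<close> by (cases a) auto
        then have "val ?cs 0 = val cs 0" by (auto simp: val_pass_Store pass_test)
        then show ?thesis
          using sim_step[of "Ready P" w "val cs 0" "tape cs" 0 "Pass a True P'" Mk Stay Rgt]
            t_other[of P a P' P0 "input_at w (val cs 0)"] 2 P P' cs a r
          by (simp add: move_def tape_upd min_absorb1)
      qed
      then show ?thesis by blast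
    qed
    moreover have "sim w (Pass a True P', val ?cs 0, tape cs, Suc 0)
        (Ret P', val ?cs 0, tape ?cs, length cs)"
      using run_pass[OF P' a b, of "[]" cs True] cs ex by simp
    moreover have "sim w (Ret P', val ?cs 0, tape ?cs, length cs)
        (Ready P', val ?cs 0, tape ?cs, 0)"
      using run_ret[OF P' b c l] .
    ultimately have "sim w (Ready P, val cs 0, tape cs, 0)
        (Ready P', val ?cs 0, tape ?cs, 0)" by (meson rtranclp_trans)
    then show ?thesis using ex(1) b c by blast
  qed
qed

lemma sim_psteps:
  assumes "(pstep w)\<^sup>*\<^sup>* (P0, 0, \<lambda>_. 0) (P, s)"
  shows "P \<in> conts P0 \<and> instrs P \<subseteq> instrs P0 \<and> (\<exists>cs. s = decode cs \<and> (\<forall>c\<in>set cs. c \<subseteq> {..m}) \<and>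
    val cs 0 \<le> Suc (length w) \<and>
    sim w (Init, 0, \<lambda>_. Bl, 0) (Ready P, val cs 0, tape cs, 0))"
  using assms
proof (induction "(P, s)" arbitrary: P s rule: rtranclp_induct)
  case base
  have "tstep sim_trans w (Init, 0, \<lambda>_. Bl, 0) (Ready P0, 0, tape [], 0)"
    using sim_step[of Init w 0 "\<lambda>_. Bl" 0 "Ready P0" Mk Stay Stay] t_init[of P0] conts_refl
    by (simp add: move_def tape_upd)
  then have "sim w (Init, 0, \<lambda>_. Bl, 0) (Ready P0, val [] 0, tape [], 0)"
    by simp
  moreover have "(0, \<lambda>_. 0) = decode []" by (simp add: decode_def)
  moreover have "\<forall>c\<in>set []. c \<subseteq> {..m}" "val [] 0 \<le> Suc (length w)" by simp_all
  ultimately show ?case using conts_refl by blast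
next
  case (step y)
  obtain P1 s1 where y: "y = (P1, s1)" by (cases y)
  then obtain cs where cs: "P1 \<in> conts P0" "instrs P1 \<subseteq> instrs P0" "s1 = decode cs"
    "\<forall>c\<in>set cs. c \<subseteq> {..m}" "val cs 0 \<le> Suc (length w)"
    "sim w (Init, 0, \<lambda>_. Bl, 0) (Ready P1, val cs 0, tape cs, 0)"
    using step.hyps(3) by blast
  have "P \<in> conts P0 \<and> instrs P \<subseteq> instrs P0"
    using step.hyps(2) cs(1,2) unfolding y by cases (auto dest: conts_lstep lstep_instrs)
  moreover obtain cs' where "s = decode cs'" "\<forall>c\<in>set cs'. c \<subseteq> {..m}" "val cs' 0 \<le> Suc (length w)"
    "sim w (Ready P1, val cs 0, tape cs, 0) (Ready P, val cs' 0, tape cs', 0)"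
    using sim_pstep[of w P1 cs P s] step.hyps(2) cs unfolding y by blast
  ultimately show ?case using cs(6) rtranclp_trans by fast
qed

lemma in_NL_aux: "in_NL {w. \<exists>s. ((0, \<lambda>_. 0), s) \<in> sem w P0}"
proof (rule in_NL_typed[where T = sim_trans and S = sim_states and G = sim_syms and b = Bl and ?s0.0 = Init
      and F = "{Ready Skip} \<inter> sim_states" and c = 3])
  show "finite sim_states" "finite sim_syms"
    by (auto simp: sim_states_def sim_syms_def finite_conts finite_instrs)
  show "sim_trans \<subseteq> sim_states \<times> UNIV \<times> sim_syms \<times> sim_states \<times> sim_syms \<times> UNIV \<times> UNIV"
    by (auto simp: sim_trans_def)
  show "h < 3 * (length (bits (length w)) + 1)"
    if "sim w (Init, 0, \<lambda>_. Bl, 0) (s, i, t, h)" for w s i t h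
    using inv_space[OF inv_reach[OF that]] .
  show "w \<in> {w. \<exists>s. ((0, \<lambda>_. 0), s) \<in> sem w P0} \<longleftrightarrow>
    (\<exists>s i t h. sim w (Init, 0, \<lambda>_. Bl, 0) (s, i, t, h) \<and>
      s \<in> {Ready Skip} \<inter> sim_states)" for w
  proof
    assume "w \<in> {w. \<exists>s. ((0, \<lambda>_. 0), s) \<in> sem w P0}"
    then obtain s where "((0, \<lambda>_. 0), s) \<in> sem w P0" by blast
    from sim_psteps[OF sem_psteps[OF this]] obtain cs where "Skip \<in> conts P0"
      "sim w (Init, 0, \<lambda>_. Bl, 0) (Ready Skip, val cs 0, tape cs, 0)" by blast
    then show "\<exists>s i t h. sim w (Init, 0, \<lambda>_. Bl, 0) (s, i, t, h) \<and>
        s \<in> {Ready Skip} \<inter> sim_states"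
      by (intro exI conjI) (assumption, simp)
  next
    assume "\<exists>s i t h. sim w (Init, 0, \<lambda>_. Bl, 0) (s, i, t, h) \<and>
        s \<in> {Ready Skip} \<inter> sim_states"
    then obtain i t h where "sim w (Init, 0, \<lambda>_. Bl, 0) (Ready Skip, i, t, h)" by blast
    from inv_reach[OF this] obtain cs where "reps w Skip cs" by auto
    then have "((0, \<lambda>_. 0), decode cs) \<in> sem w P0" unfolding reps_def using psteps_sem by blast
    then show "w \<in> {w. \<exists>s. ((0, \<lambda>_. 0), s) \<in> sem w P0}" by blast
  qed
qed auto

end

theorem in_NL_prog: "in_NL {w. \<exists>s. ((0, \<lambda>_. 0), s) \<in> sem w P}"
\<comment> \<open>Register \<open>j\<close> lives on track \<open>Suc j\<close> and columns are
  subsets of \<open>{..m}\<close>, so \<open>m\<close> has to exceed every register index of the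
  program.\<close>
proof (rule in_NL_aux[of P "Suc (Max (reg_of ` instrs P))"])
  fix a assume "a \<in> instrs P"
  then show "reg_of a < Suc (Max (reg_of ` instrs P))"
    by (simp add: finite_instrs less_Suc_eq_le)
qed

section \<open>Definable predicates and their closure properties\<close>

abbreviation bdd :: "sym list \<Rightarrow> (nat \<Rightarrow> nat) \<Rightarrow> bool" where
  "bdd w e \<equiv> \<forall>j. e j \<le> Suc (length w)"

text \<open>A register beyond the right end marker could never be matched by the head. Staying in
  range is therefore what allows \<open>goto\<close> to succeed at every point of a run.\<close>

lemma sem_bounded:
  "((i, r), (i', r')) \<in> sem w P \<Longrightarrow> i \<le> Suc (length w) \<Longrightarrow> bdd w r \<Longrightarrow>
    i' \<le> Suc (length w) \<and> bdd w r'"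
proof (induction P arbitrary: i r i' r')
  case (I a)
  then show ?case by (cases a) auto
next
  case (Star P)
  from Star.prems(1) have "((i, r), (i', r')) \<in> (sem w P)\<^sup>*" by simp
  then show ?case
  proof (induction "(i', r')" arbitrary: i' r' rule: rtrancl_induct)
    case (step y)
    then show ?case using Star.IH by (cases y) blast
  qed (use Star.prems in auto)
qed (fastforce+)

section \<open>Elementary programs on registers\<close>

definition anywhere :: prog where
  "anywhere = Seq (I Rew) (Star (I Right))"

text \<open>Guess and verify: the head stops at an arbitrary position, and all runs but the one at
  register \<open>x\<close> die in the test.\<close>

definition goto :: "nat \<Rightarrow> prog" where
  "goto x = Seq anywhere (I (Eq x))"

definition guess :: "nat \<Rightarrow> prog" where
  "guess x = Seq anywhere (I (Store x))"

definition copy :: "nat \<Rightarrow> nat \<Rightarrow> prog" where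
  "copy x y = Seq (goto x) (I (Store y))"

definition test_eq :: "nat \<Rightarrow> nat \<Rightarrow> prog" where
  "test_eq x y = Seq (goto x) (I (Eq y))"

lemma sem_anywhere: "((i, r), (i', r')) \<in> sem w anywhere \<longleftrightarrow> r' = r \<and> i' \<le> Suc (length w)"
proof
  assume "((i, r), (i', r')) \<in> sem w anywhere"
  then have "((0, r), (i', r')) \<in> (sem w (I Right))\<^sup>*" by (auto simp: anywhere_def)
  then show "r' = r \<and> i' \<le> Suc (length w)"
    by (induction "(i', r')" arbitrary: i' r' rule: rtrancl_induct) auto
next
  have "((0, r), (i', r)) \<in> (sem w (I Right))\<^sup>*" if "i' \<le> Suc (length w)"
    using that
  proof (induction i')
    case (Suc i')
    then have "((i', r), (Suc i', r)) \<in> sem w (I Right)" by simp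
    with Suc show ?case by (meson Suc_leD rtrancl.rtrancl_into_rtrancl)
  qed simp
  then show "r' = r \<and> i' \<le> Suc (length w) \<Longrightarrow> ((i, r), (i', r')) \<in> sem w anywhere"
    by (auto simp: anywhere_def)
qed

lemma sem_goto:
  "r x \<le> Suc (length w) \<Longrightarrow> ((i, r), (i', r')) \<in> sem w (goto x) \<longleftrightarrow> r' = r \<and> i' = r x"
  by (auto simp: goto_def sem_anywhere relcomp_unfold)

lemma sem_guess:
  "((i, r), (i', r')) \<in> sem w (guess x) \<longleftrightarrow> i' \<le> Suc (length w) \<and> r' = r(x := i')"
  by (auto simp: guess_def sem_anywhere relcomp_unfold)

lemma sem_copy:
  "r x \<le> Suc (length w) \<Longrightarrow> ((i, r), (i', r')) \<in> sem w (copy x y) \<longleftrightarrow> i' = r x \<and> r' = r(y := r x)"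
  by (auto simp: copy_def sem_goto relcomp_unfold)

lemma sem_test_eq:
  "r x \<le> Suc (length w) \<Longrightarrow>
    ((i, r), (i', r')) \<in> sem w (test_eq x y) \<longleftrightarrow> i' = r x \<and> r' = r \<and> r x = r y"
  by (auto simp: test_eq_def sem_goto relcomp_unfold)

text \<open>Registers below \<open>k\<close> are arguments, the others are scratch space.\<close>
definition decides :: "prog \<Rightarrow> nat \<Rightarrow> (sym list \<Rightarrow> (nat \<Rightarrow> nat) \<Rightarrow> bool) \<Rightarrow> bool" where
  "decides P k \<phi> \<longleftrightarrow> (\<forall>w i r. i \<le> Suc (length w) \<and> bdd w r \<longrightarrow>
     ((\<exists>i' r'. ((i, r), (i', r')) \<in> sem w P) \<longleftrightarrow> \<phi> w r) \<and>
     (\<forall>i' r'. ((i, r), (i', r')) \<in> sem w P \<longrightarrow> (\<forall>j<k. r' j = r j)))"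

text \<open>Locality is what makes composition work. A program may leave arbitrary values in its
  scratch registers, and the next program starts from them; a predicate that reads only the first
  \<open>k\<close> registers has the same truth value there.\<close>

definition definable :: "nat \<Rightarrow> (sym list \<Rightarrow> (nat \<Rightarrow> nat) \<Rightarrow> bool) \<Rightarrow> bool" where
  "definable k \<phi> \<longleftrightarrow>
     (\<forall>w e e'. (\<forall>j<k. e j = e' j) \<longrightarrow> \<phi> w e = \<phi> w e') \<and> (\<exists>P. decides P k \<phi>)"

lemma decidesD:
  assumes "decides P k \<phi>" "i \<le> Suc (length w)" "bdd w r"
  shows "\<phi> w r \<Longrightarrow> \<exists>i' r'. ((i, r), (i', r')) \<in> sem w P"
    and "((i, r), (i', r')) \<in> sem w P \<Longrightarrow> \<phi> w r"
    and "((i, r), (i', r')) \<in> sem w P \<Longrightarrow> j < k \<Longrightarrow> r' j = r j"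
  using assms unfolding decides_def by blast+

lemma definableI:
  assumes "\<And>w e e'. (\<And>j. j < k \<Longrightarrow> e j = e' j) \<Longrightarrow> \<phi> w e = \<phi> w e'"
    and "\<And>w i r. i \<le> Suc (length w) \<Longrightarrow> bdd w r \<Longrightarrow> \<phi> w r \<Longrightarrow>
      \<exists>i' r'. ((i, r), (i', r')) \<in> sem w P"
    and "\<And>w i r i' r'. i \<le> Suc (length w) \<Longrightarrow> bdd w r \<Longrightarrow>
      ((i, r), (i', r')) \<in> sem w P \<Longrightarrow> \<phi> w r \<and> (\<forall>j<k. r' j = r j)"
  shows "definable k \<phi>"
proof -
  have "decides P k \<phi>" unfolding decides_def using assms(2,3) by blast
  then show ?thesis unfolding definable_def using assms(1) by blast
qed

lemma definable_local:
  "definable k \<phi> \<Longrightarrow> (\<And>j. j < k \<Longrightarrow> e j = e' j) \<Longrightarrow> \<phi> w e = \<phi> w e'"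
  unfolding definable_def by blast

lemma definableE:
  assumes "definable k \<phi>"
  obtains P where "decides P k \<phi>"
  using assms unfolding definable_def by blast

lemma in_NL_definable:
  assumes "definable 0 (\<lambda>w e. \<phi> w)"
  shows "in_NL {w. \<phi> w}"
proof -
  obtain P where P: "decides P 0 (\<lambda>w e. \<phi> w)"
    using definableE[OF assms] by blast
  have "(\<exists>i' r'. ((0, \<lambda>_. 0), (i', r')) \<in> sem w P) \<longleftrightarrow> \<phi> w" for w
    using P[unfolded decides_def, rule_format, of 0 w "\<lambda>_. 0"] by simp
  then have "{w. \<phi> w} = {w. \<exists>s. ((0, \<lambda>_. 0), s) \<in> sem w P}" by simp
  then show ?thesis using in_NL_prog by simp
qed

section \<open>Closure properties of definable predicates\<close>

lemma definable_False: "definable k (\<lambda>w e. False)"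
  by (rule definableI[where P = "I (Sym {})"]) auto

lemma definable_True: "definable k (\<lambda>w e. True)"
  by (rule definableI[where P = Skip]) auto

lemma definable_eq: "x < k \<Longrightarrow> y < k \<Longrightarrow> definable k (\<lambda>w e. e x = e y)"
  by (rule definableI[where P = "test_eq x y"]) (auto simp: sem_test_eq)

lemma definable_neq: "x < k \<Longrightarrow> y < k \<Longrightarrow> definable k (\<lambda>w e. e x \<noteq> e y)"
  by (rule definableI[where P = "Seq (goto x) (I (Neq y))"]) (auto simp: sem_goto relcomp_unfold)

lemma definable_Suc: "x < k \<Longrightarrow> y < k \<Longrightarrow> definable k (\<lambda>w e. e y = Suc (e x))"
  by (rule definableI[where P = "Seq (goto x) (Seq (I Right) (I (Eq y)))"])
    (auto simp: sem_goto relcomp_unfold, metis Suc_le_mono)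

lemma definable_input: "x < k \<Longrightarrow> definable k (\<lambda>w e. input_at w (e x) \<in> A)"
  by (rule definableI[where P = "Seq (goto x) (I (Sym A))"]) (auto simp: sem_goto relcomp_unfold)

lemma definable_conj:
  assumes "definable k \<phi>" "definable k \<psi>"
  shows "definable k (\<lambda>w e. \<phi> w e \<and> \<psi> w e)"
proof -
  obtain P where "decides P k \<phi>"
    using definableE[OF assms(1)] by blast
  note P = decidesD[OF this]
  obtain Q where "decides Q k \<psi>"
    using definableE[OF assms(2)] by blast
  note Q = decidesD[OF this]
  show ?thesis
  proof (rule definableI[where P = "Seq P Q"])
    show "(\<phi> w e \<and> \<psi> w e) = (\<phi> w e' \<and> \<psi> w e')" if "\<And>j. j < k \<Longrightarrow> e j = e' j" for w e e'
      using definable_local[OF assms(1) that] definable_local[OF assms(2) that] by simp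
  next
    fix w i r
    assume r: "i \<le> Suc (length w)" "bdd w r" and "\<phi> w r \<and> \<psi> w r"
    then obtain i1 r1 where 1: "((i, r), (i1, r1)) \<in> sem w P" using P(1) by blast
    have b: "i1 \<le> Suc (length w)" "bdd w r1" using sem_bounded[OF 1] r by auto
    have "r1 j = r j" if "j < k" for j using P(3)[OF r 1 that] .
    then have "\<psi> w r1" using definable_local[OF assms(2), of r1 r w] \<open>\<phi> w r \<and> \<psi> w r\<close> by simp
    then obtain i2 r2 where "((i1, r1), (i2, r2)) \<in> sem w Q" using Q(1) b by blast
    with 1 show "\<exists>i' r'. ((i, r), (i', r')) \<in> sem w (Seq P Q)" by auto
  next
    fix w i r i' r'
    assume r: "i \<le> Suc (length w)" "bdd w r"
      and "((i, r), (i', r')) \<in> sem w (Seq P Q)"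
    then obtain i1 r1 where 1: "((i, r), (i1, r1)) \<in> sem w P" and 2: "((i1, r1), (i', r')) \<in> sem w Q"
      by auto
    have b: "i1 \<le> Suc (length w)" "bdd w r1" using sem_bounded[OF 1] r by auto
    have a: "r1 j = r j" if "j < k" for j using P(3)[OF r 1 that] .
    then have "\<psi> w r" using definable_local[OF assms(2), of r1 r w] Q(2)[OF b 2] by simp
    then show "(\<phi> w r \<and> \<psi> w r) \<and> (\<forall>j<k. r' j = r j)"
      using P(2)[OF r 1] a Q(3)[OF b 2] by simp
  qed
qed

lemma definable_disj:
  assumes "definable k \<phi>" "definable k \<psi>"
  shows "definable k (\<lambda>w e. \<phi> w e \<or> \<psi> w e)"
proof -
  obtain P where "decides P k \<phi>"
    using definableE[OF assms(1)] by blast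
  note P = decidesD[OF this]
  obtain Q where "decides Q k \<psi>"
    using definableE[OF assms(2)] by blast
  note Q = decidesD[OF this]
  show ?thesis
  proof (rule definableI[where P = "Choice P Q"])
    show "(\<phi> w e \<or> \<psi> w e) = (\<phi> w e' \<or> \<psi> w e')" if "\<And>j. j < k \<Longrightarrow> e j = e' j" for w e e'
      using definable_local[OF assms(1) that] definable_local[OF assms(2) that] by simp
    show "\<exists>i' r'. ((i, r), (i', r')) \<in> sem w (Choice P Q)"
      if "i \<le> Suc (length w)" "bdd w r" "\<phi> w r \<or> \<psi> w r" for w i r
      using P(1)[OF that(1,2)] Q(1)[OF that(1,2)] that(3) unfolding sem.simps by blast
    show "(\<phi> w r \<or> \<psi> w r) \<and> (\<forall>j<k. r' j = r j)"
      if "i \<le> Suc (length w)" "bdd w r" "((i, r), (i', r')) \<in> sem w (Choice P Q)"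
      for w i r i' r'
      using P(2,3)[OF that(1,2)] Q(2,3)[OF that(1,2)] that(3) unfolding sem.simps by blast
  qed
qed

lemma definable_ball:
  fixes n :: nat
  assumes "\<And>i. i < n \<Longrightarrow> definable k (\<phi> i)"
  shows "definable k (\<lambda>w e. \<forall>i<n. \<phi> i w e)"
  using assms
proof (induction n)
  case (Suc n)
  then have "definable k (\<lambda>w e. (\<forall>i<n. \<phi> i w e) \<and> \<phi> n w e)" by (intro definable_conj) auto
  then show ?case by (simp add: All_less_Suc conj_commute)
qed (simp add: definable_True)

lemma definable_bex:
  fixes n :: nat
  assumes "\<And>i. i < n \<Longrightarrow> definable k (\<phi> i)"
  shows "definable k (\<lambda>w e. \<exists>i<n. \<phi> i w e)"
  using assms
proof (induction n)
  case (Suc n)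
  then have "definable k (\<lambda>w e. (\<exists>i<n. \<phi> i w e) \<or> \<phi> n w e)" by (intro definable_disj) auto
  then show ?case by (simp add: Ex_less_Suc disj_commute)
qed (simp add: definable_False)

text \<open>The bound variable is guessed into register \<open>k\<close>, the first scratch
  register. Since \<open>\<psi> w e v\<close> reads only arguments from \<open>e\<close>,
  overwriting that register leaves its truth value alone.\<close>

lemma definable_ex:
  assumes "definable (Suc k) (\<lambda>w e. \<psi> w e (e k))"
    and loc: "\<And>w e e' v. (\<And>j. j < k \<Longrightarrow> e j = e' j) \<Longrightarrow> \<psi> w e v = \<psi> w e' v"
  shows "definable k (\<lambda>w e. \<exists>v\<le>Suc (length w). \<psi> w e v)"
proof -
  obtain P where "decides P (Suc k) (\<lambda>w e. \<psi> w e (e k))"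
    using definableE[OF assms(1)] by blast
  note P = decidesD[OF this]
  have upd: "\<psi> w (e(k := u)) v = \<psi> w e v" for w e u v by (rule loc) auto
  show ?thesis
  proof (rule definableI[where P = "Seq (guess k) P"])
    show "(\<exists>v\<le>Suc (length w). \<psi> w e v) = (\<exists>v\<le>Suc (length w). \<psi> w e' v)"
      if "\<And>j. j < k \<Longrightarrow> e j = e' j" for w e e'
      using loc[OF that] by simp
  next
    fix w i r
    assume r: "i \<le> Suc (length w)" "bdd w r" and "\<exists>v\<le>Suc (length w). \<psi> w r v"
    then obtain v where v: "v \<le> Suc (length w)" "\<psi> w r v" by blast
    then have "\<exists>i' r'. ((v, r(k := v)), (i', r')) \<in> sem w P" using r by (intro P(1)) (auto simp: upd)
    then show "\<exists>i' r'. ((i, r), (i', r')) \<in> sem w (Seq (guess k) P)"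
      using v by (auto simp: relcomp_unfold sem_guess)
  next
    fix w i r i' r'
    assume r: "i \<le> Suc (length w)" "bdd w r"
      and "((i, r), (i', r')) \<in> sem w (Seq (guess k) P)"
    then obtain v where v: "v \<le> Suc (length w)" "((v, r(k := v)), (i', r')) \<in> sem w P"
      by (auto simp: relcomp_unfold sem_guess)
    have b: "\<forall>j. (r(k := v)) j \<le> Suc (length w)" using r v by simp
    show "(\<exists>v\<le>Suc (length w). \<psi> w r v) \<and> (\<forall>j<k. r' j = r j)"
      using P(2)[OF v(1) b v(2)] P(3)[OF v(1) b v(2)] v(1) by (auto simp: upd)
  qed
qed

lemma definable_exs:
  assumes "definable (k + a) (\<lambda>w e. \<psi> w e (map e [k..<k + a]))"
    and "\<And>w e e' s. (\<And>j. j < k \<Longrightarrow> e j = e' j) \<Longrightarrow> \<psi> w e s = \<psi> w e' s"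
  shows "definable k (\<lambda>w e. \<exists>s. length s = a \<and> (\<forall>x\<in>set s. x \<le> Suc (length w)) \<and> \<psi> w e s)"
  using assms
proof (induction a arbitrary: k \<psi>)
  case (Suc a)
  have "definable (Suc k) (\<lambda>w e. \<exists>s. length s = a \<and> (\<forall>x\<in>set s. x \<le> Suc (length w)) \<and> \<psi> w e (e k # s))"
  proof (rule Suc.IH)
    show "definable (Suc k + a) (\<lambda>w e. \<psi> w e (e k # map e [Suc k..<Suc k + a]))"
      using Suc.prems(1) by (simp add: upt_conv_Cons del: upt_Suc)
    show "\<psi> w e (e k # s) = \<psi> w e' (e' k # s)" if "\<And>j. j < Suc k \<Longrightarrow> e j = e' j" for w e e' s
      using Suc.prems(2)[of e e' w] that by simp
  qed
  then have "definable k (\<lambda>w e. \<exists>v\<le>Suc (length w).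
      \<exists>s. length s = a \<and> (\<forall>x\<in>set s. x \<le> Suc (length w)) \<and> \<psi> w e (v # s))"
  proof (rule definable_ex)
    fix w v and e e' :: "nat \<Rightarrow> nat"
    assume e: "\<And>j. j < k \<Longrightarrow> e j = e' j"
    have "\<psi> w e (v # s) = \<psi> w e' (v # s)" for s using Suc.prems(2) e .
    then show "(\<exists>s. length s = a \<and> (\<forall>x\<in>set s. x \<le> Suc (length w)) \<and> \<psi> w e (v # s)) =
      (\<exists>s. length s = a \<and> (\<forall>x\<in>set s. x \<le> Suc (length w)) \<and> \<psi> w e' (v # s))" by simp
  qed
  moreover have "(\<exists>s. length s = Suc a \<and> (\<forall>x\<in>set s. x \<le> Suc (length w)) \<and> \<psi> w e s) \<longleftrightarrow>
     (\<exists>v\<le>Suc (length w). \<exists>s. length s = a \<and> (\<forall>x\<in>set s. x \<le> Suc (length w)) \<and> \<psi> w e (v # s))"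
    (is "?l w e \<longleftrightarrow> ?r w e") for w e
  proof
    assume "?l w e"
    then obtain s where s: "length s = Suc a" "\<forall>x\<in>set s. x \<le> Suc (length w)" "\<psi> w e s" by blast
    then obtain v s' where "s = v # s'" by (cases s) auto
    with s show "?r w e" by (intro exI[of _ v] conjI exI[of _ s']) auto
  next
    assume "?r w e"
    then obtain v s where "v \<le> Suc (length w)" "length s = a" "\<forall>x\<in>set s. x \<le> Suc (length w)"
      "\<psi> w e (v # s)" by blast
    then show "?l w e" by (intro exI[of _ "v # s"]) auto
  qed
  ultimately show ?case by simp
next
  case 0
  show ?case using "0.prems"(1) by simp
qed

section \<open>Transitive closure of relations between tuples of positions\<close>

definition copies :: "(nat \<times> nat) list \<Rightarrow> prog" where
  "copies ps = foldr (\<lambda>(x, y). Seq (copy x y)) ps Skip"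

definition guesses :: "nat list \<Rightarrow> prog" where
  "guesses js = foldr (\<lambda>j. Seq (guess j)) js Skip"

definition tests :: "(nat \<times> nat) list \<Rightarrow> prog" where
  "tests ps = foldr (\<lambda>(x, y). Seq (test_eq x y)) ps Skip"

lemma sem_copies_ex: "bdd w r \<Longrightarrow> \<exists>i' r'. ((i, r), (i', r')) \<in> sem w (copies ps)"
proof (induction ps arbitrary: i r)
  case (Cons p ps)
  obtain x y where p: "p = (x, y)" by fastforce
  have "\<forall>j. (r(y := r x)) j \<le> Suc (length w)" using Cons.prems by simp
  then obtain i' r' where "((r x, r(y := r x)), (i', r')) \<in> sem w (copies ps)"
    using Cons.IH by blast
  then show ?case using Cons.prems by (auto simp: copies_def p relcomp_unfold sem_copy)
qed (auto simp: copies_def)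

text \<open>Sources and targets are disjoint and the targets distinct, so copying one register after
  the other acts as a simultaneous assignment.\<close>

lemma sem_copies:
  assumes "((i, r), (i', r')) \<in> sem w (copies ps)" "bdd w r"
    "distinct (map snd ps)" "fst ` set ps \<inter> snd ` set ps = {}"
  shows "(\<forall>(x, y)\<in>set ps. r' y = r x) \<and> (\<forall>j. j \<notin> snd ` set ps \<longrightarrow> r' j = r j)"
  using assms
proof (induction ps arbitrary: i r)
  case (Cons p ps)
  obtain x y where p: "p = (x, y)" by fastforce
  have 1: "((r x, r(y := r x)), (i', r')) \<in> sem w (copies ps)"
    using Cons.prems(1,2) by (auto simp: copies_def p relcomp_unfold sem_copy)
  have 2: "(\<forall>(a, b)\<in>set ps. r' b = (r(y := r x)) a) \<and> (\<forall>j. j \<notin> snd ` set ps \<longrightarrow> r' j = (r(y := r x)) j)"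
    using Cons.prems p by (intro Cons.IH[OF 1]) auto
  show ?case
  proof (intro conjI ballI allI impI)
    fix q assume "q \<in> set (p # ps)"
    then show "case q of (x, y) \<Rightarrow> r' y = r x"
      using 2 Cons.prems(3,4) p by (fastforce simp: image_iff)
  qed (use 2 p in auto)
qed (auto simp: copies_def)

lemma sem_guesses_ex:
  assumes "bdd w r'" "\<forall>j. j \<notin> set js \<longrightarrow> r' j = r j"
  shows "\<exists>i'. ((i, r), (i', r')) \<in> sem w (guesses js)"
  using assms
proof (induction js arbitrary: i r)
  case (Cons j js)
  have "\<forall>l. l \<notin> set js \<longrightarrow> r' l = (r(j := r' j)) l" using Cons.prems by simp
  then obtain i' where "((r' j, r(j := r' j)), (i', r')) \<in> sem w (guesses js)"
    using Cons.IH Cons.prems(1) by blast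
  then show ?case using Cons.prems by (auto simp: guesses_def relcomp_unfold sem_guess)
next
  case Nil
  then have "r' = r" by auto
  then show ?case by (auto simp: guesses_def)
qed

lemma sem_guesses: "((i, r), (i', r')) \<in> sem w (guesses js) \<Longrightarrow> j \<notin> set js \<Longrightarrow> r' j = r j"
  by (induction js arbitrary: i r) (force simp: guesses_def relcomp_unfold sem_guess)+

lemma sem_tests_ex:
  "bdd w r \<Longrightarrow> \<forall>(x, y)\<in>set ps. r x = r y \<Longrightarrow> \<exists>i'. ((i, r), (i', r)) \<in> sem w (tests ps)"
proof (induction ps arbitrary: i)
  case (Cons p ps)
  obtain x y where p: "p = (x, y)" by fastforce
  obtain i' where "((r x, r), (i', r)) \<in> sem w (tests ps)"
    using Cons.IH[of "r x"] Cons.prems by auto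
  then show ?case using Cons.prems p by (auto simp: tests_def relcomp_unfold sem_test_eq)
qed (auto simp: tests_def)

lemma sem_tests:
  "((i, r), (i', r')) \<in> sem w (tests ps) \<Longrightarrow> bdd w r \<Longrightarrow>
    r' = r \<and> (\<forall>(x, y)\<in>set ps. r x = r y)"
proof (induction ps arbitrary: i)
  case (Cons p ps)
  obtain x y where p: "p = (x, y)" by fastforce
  have "((r x, r), (i', r')) \<in> sem w (tests ps)" "r x = r y"
    using Cons.prems p by (auto simp: tests_def relcomp_unfold sem_test_eq)
  with Cons.IH[OF this(1) Cons.prems(2)] show ?case using p by simp
qed (auto simp: tests_def)

text \<open>Only the target is constrained, because it is the tuple that gets guessed into
  registers. Along a path every tuple but the first is a target, and the first comes from registers
  already in range.\<close>

definition bounded_rel :: "nat \<Rightarrow> sym list \<Rightarrow> (nat list \<Rightarrow> nat list \<Rightarrow> bool) \<Rightarrow> nat list \<Rightarrow> nat list \<Rightarrow> bool" where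
  "bounded_rel a w R s s' \<longleftrightarrow> length s' = a \<and> (\<forall>x\<in>set s'. x \<le> Suc (length w)) \<and> R s s'"

text \<open>Nondeterministic graph search: registers \<open>k\<close> to \<open>k + a - 1\<close>
  hold the current tuple and the next \<open>a\<close> registers a guessed successor. A round
  guesses, checks the edge and copies, so the space is that of two tuples for paths of any length.
  The relation may depend on the arguments, which rounds leave unchanged.\<close>

lemma definable_TC:
  assumes R: "definable (k + a + a) (\<lambda>w e. R w e (map e [k..<k + a]) (map e [k + a..<k + a + a]))"
    and loc: "\<And>w e e' s s'. (\<And>j. j < k \<Longrightarrow> e j = e' j) \<Longrightarrow> R w e s s' = R w e' s s'"
    and xs: "length xs = a" "set xs \<subseteq> {..<k}" and ys: "length ys = a" "set ys \<subseteq> {..<k}"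
  shows "definable k (\<lambda>w e. (bounded_rel a w (R w e))\<^sup>*\<^sup>* (map e xs) (map e ys))"
proof -
  obtain P where "decides P (k + a + a) (\<lambda>w e. R w e (map e [k..<k + a]) (map e [k + a..<k + a + a]))"
    using definableE[OF R] by blast
  note P = decidesD[OF this]
  define cur where "cur r = map r [k..<k + a]" for r :: "nat \<Rightarrow> nat"
  define nxt where "nxt r = map r [k + a..<k + a + a]" for r :: "nat \<Rightarrow> nat"
  define mv where "mv = map (\<lambda>j. (k + a + j, k + j)) [0..<a]"
  define B where "B = Seq (guesses [k + a..<k + a + a]) (Seq P (copies mv))"
  have mv: "set mv = (\<lambda>j. (k + a + j, k + j)) ` {..<a}" "distinct (map snd mv)"
    by (auto simp: mv_def atLeast0LessThan distinct_map inj_on_def)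
  have R_eq: "R w e s s' = R w e' s s'" if "\<forall>j<k. e j = e' j" for w e e' s s'
    using loc that by blast
  \<comment> \<open>Soundness of one round: the current block moves along an edge.\<close>
  have B1: "(\<forall>j<k. r' j = r j) \<and> bounded_rel a w (R w r) (cur r) (cur r')"
    if run: "((i, r), (i', r')) \<in> sem w B" and b: "i \<le> Suc (length w)" "bdd w r"
    for w i r i' r'
  proof -
    from run obtain i1 r1 i2 r2 where 1: "((i, r), (i1, r1)) \<in> sem w (guesses [k + a..<k + a + a])"
      and 2: "((i1, r1), (i2, r2)) \<in> sem w P" and 3: "((i2, r2), (i', r')) \<in> sem w (copies mv)"
      by (auto simp: B_def)
    have b1: "i1 \<le> Suc (length w)" "bdd w r1" using sem_bounded[OF 1] b by auto
    then have b2: "i2 \<le> Suc (length w)" "bdd w r2" using sem_bounded[OF 2] by auto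
    have e1: "r1 j = r j" if "j < k + a" for j using sem_guesses[OF 1, of j] that by simp
    have e2: "r2 j = r1 j" if "j < k + a + a" for j using P(3)[OF _ _ 2] b1 that by simp
    have "(\<forall>(x, y)\<in>set mv. r' y = r2 x) \<and> (\<forall>j. j \<notin> snd ` set mv \<longrightarrow> r' j = r2 j)"
      using b2 by (intro sem_copies[OF 3]) (auto simp: mv)
    then have e3: "\<forall>j<a. r' (k + j) = r2 (k + a + j)" "\<forall>j<k. r' j = r2 j"
      by (auto simp: mv image_iff)
    have c: "cur r' = nxt r1"
      by (rule nth_equalityI) (auto simp: cur_def nxt_def e3 e2)
    have "R w r1 (cur r1) (nxt r1)" unfolding cur_def nxt_def using P(2)[OF _ _ 2] b1 by simp
    moreover have "cur r1 = cur r" using e1 by (simp add: cur_def)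
    ultimately have "R w r (cur r) (cur r')" using R_eq[of r1 r] e1 c by simp
    moreover have "\<forall>x\<in>set (cur r'). x \<le> Suc (length w)" using b1 by (auto simp: c nxt_def)
    ultimately show ?thesis using e1 e2 e3 by (simp add: bounded_rel_def) (simp add: cur_def)
  qed
  have B2: "\<exists>i' r'. ((i, r), (i', r')) \<in> sem w B \<and> cur r' = s'"
    if s': "bounded_rel a w (R w r) (cur r) s'" and b: "i \<le> Suc (length w)" "bdd w r"
    for w i r s'
  proof -
    \<comment> \<open>The registers after the lucky guess, with \<open>s'\<close> in the block for
      the successor.\<close>
    define r1 where "r1 j = (if k + a \<le> j \<and> j < k + a + a then s' ! (j - (k + a)) else r j)" for j
    have l: "length s' = a" "\<forall>x\<in>set s'. x \<le> Suc (length w)" "R w r (cur r) s'"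
      using s' by (auto simp: bounded_rel_def)
    have b1: "bdd w r1" using l b by (auto simp: r1_def)
    have r1: "\<forall>j. j \<notin> set [k + a..<k + a + a] \<longrightarrow> r1 j = r j" by (simp add: r1_def)
    obtain i1 where 1: "((i, r), (i1, r1)) \<in> sem w (guesses [k + a..<k + a + a])"
      using sem_guesses_ex[OF b1, of "[k + a..<k + a + a]" r i] r1 by auto
    have i1: "i1 \<le> Suc (length w)" using sem_bounded[OF 1] b by auto
    have n: "nxt r1 = s'" by (rule nth_equalityI) (auto simp: nxt_def r1_def l)
    have c: "cur r1 = cur r" by (simp add: cur_def r1_def)
    have "R w r1 (cur r1) (nxt r1)" using R_eq[of r1 r] l n c by (simp add: r1_def)
    then obtain i2 r2 where 2: "((i1, r1), (i2, r2)) \<in> sem w P"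
      using P(1)[OF i1, of r1] b1 unfolding cur_def nxt_def by auto
    have b2: "i2 \<le> Suc (length w)" "bdd w r2" using sem_bounded[OF 2] b1 i1 by auto
    have e2: "r2 j = r1 j" if "j < k + a + a" for j using P(3)[OF _ _ 2] b1 i1 that by simp
    obtain i' r' where 3: "((i2, r2), (i', r')) \<in> sem w (copies mv)"
      using sem_copies_ex b2(2) by blast
    have "(\<forall>(x, y)\<in>set mv. r' y = r2 x) \<and> (\<forall>j. j \<notin> snd ` set mv \<longrightarrow> r' j = r2 j)"
      using b2 by (intro sem_copies[OF 3]) (auto simp: mv)
    then have e3: "\<forall>j<a. r' (k + j) = r2 (k + a + j)" by (auto simp: mv)
    have "cur r' = nxt r1"
      by (rule nth_equalityI) (auto simp: cur_def nxt_def e3 e2)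
    then show ?thesis using 1 2 3 n unfolding B_def by auto
  qed
  define px where "px = map (\<lambda>j. (xs ! j, k + j)) [0..<a]"
  define py where "py = map (\<lambda>j. (k + j, ys ! j)) [0..<a]"
  define Q where "Q = Seq (copies px) (Seq (Star B) (tests py))"
  have zx: "set px = (\<lambda>j. (xs ! j, k + j)) ` {..<a}" "distinct (map snd px)"
    by (auto simp: px_def atLeast0LessThan distinct_map inj_on_def)
  have zy: "set py = (\<lambda>j. (k + j, ys ! j)) ` {..<a}"
    by (auto simp: py_def atLeast0LessThan)
  have xk: "xs ! j < k" "ys ! j < k" if "j < a" for j
    using subsetD[OF xs(2) nth_mem] subsetD[OF ys(2) nth_mem] that xs(1) ys(1) by simp_all
  \<comment> \<open>The argument registers are the same in every round, so all rounds follow the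
    same relation although it is evaluated on different register contents.\<close>
  have br_eq: "bounded_rel a w (R w e) = bounded_rel a w (R w e')" if "\<forall>j<k. e j = e' j" for w e e'
    unfolding bounded_rel_def using R_eq[OF that] by simp
  have S1: "(\<forall>j<k. r' j = r j) \<and> (bounded_rel a w (R w r))\<^sup>*\<^sup>* (cur r) (cur r') \<and>
      i' \<le> Suc (length w) \<and> bdd w r'"
    if "((i, r), (i', r')) \<in> (sem w B)\<^sup>*" "i \<le> Suc (length w)" "bdd w r" for w i r i' r'
    using that
  proof (induction "(i', r')" arbitrary: i' r' rule: rtrancl_induct)
    case (step y)
    obtain i1 r1 where y: "y = (i1, r1)" by fastforce
    with step have *: "\<forall>j<k. r1 j = r j" "(bounded_rel a w (R w r))\<^sup>*\<^sup>* (cur r) (cur r1)"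
      "i1 \<le> Suc (length w)" "bdd w r1" by auto
    have run: "((i1, r1), (i', r')) \<in> sem w B" using step y by simp
    note br_eq[OF *(1), of w]
    then show ?case using B1[OF run *(3,4)] * sem_bounded[OF run *(3,4)]
      by (simp add: rtranclp.rtrancl_into_rtrancl)
  qed auto
  have S2: "\<exists>i' r'. ((i, r), (i', r')) \<in> (sem w B)\<^sup>* \<and> cur r' = s'"
    if "(bounded_rel a w (R w r))\<^sup>*\<^sup>* (cur r) s'" and b: "i \<le> Suc (length w)" "bdd w r"
    for w i r s'
    using that(1)
  proof (induction rule: rtranclp_induct)
    case (step s1 s2)
    then obtain i1 r1 where 1: "((i, r), (i1, r1)) \<in> (sem w B)\<^sup>*" "cur r1 = s1" by blast
    have *: "\<forall>j<k. r1 j = r j" "i1 \<le> Suc (length w)" "bdd w r1"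
      using S1[OF 1(1) b] by auto
    note br_eq[OF *(1), of w]
    then obtain i2 r2 where 2: "((i1, r1), (i2, r2)) \<in> sem w B" "cur r2 = s2"
      using B2[of w r1 s2 i1] step.hyps(2) 1(2) * by auto
    have "((i, r), (i2, r2)) \<in> (sem w B)\<^sup>*" using 1(1) 2(1) by (rule rtrancl.rtrancl_into_rtrancl)
    with 2(2) show ?case by blast
  qed auto
  have cx: "\<forall>j<k. r' j = r j" "cur r' = map r xs"
    if run: "((i, r), (i', r')) \<in> sem w (copies px)" and b: "bdd w r"
    for w i r i' r'
  proof -
    have "(\<forall>(x, y)\<in>set px. r' y = r x) \<and>
        (\<forall>j. j \<notin> snd ` set px \<longrightarrow> r' j = r j)"
      by (rule sem_copies[OF run b]) (use xk in \<open>fastforce simp: zx\<close>)+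
    then have *: "\<forall>j<a. r' (k + j) = r (xs ! j)" "\<forall>j. j \<notin> snd ` set px \<longrightarrow> r' j = r j"
      by (auto simp: zx)
    show "\<forall>j<k. r' j = r j" using *(2) by (auto simp: zx image_iff)
    show "cur r' = map r xs" by (rule nth_equalityI) (auto simp: cur_def * xs)
  qed
  show ?thesis
  proof (rule definableI[where P = Q])
    fix w and e e' :: "nat \<Rightarrow> nat"
    assume e: "\<And>j. j < k \<Longrightarrow> e j = e' j"
    have "map e xs = map e' xs" "map e ys = map e' ys" using e xs ys by auto
    moreover have "bounded_rel a w (R w e) = bounded_rel a w (R w e')"
      using br_eq[of e e'] e by simp
    ultimately show "(bounded_rel a w (R w e))\<^sup>*\<^sup>* (map e xs) (map e ys) =
      (bounded_rel a w (R w e'))\<^sup>*\<^sup>* (map e' xs) (map e' ys)" by (simp only:)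
  next
    fix w i r
    assume b: "i \<le> Suc (length w)" "bdd w r"
      and tc: "(bounded_rel a w (R w r))\<^sup>*\<^sup>* (map r xs) (map r ys)"
    obtain i1 r1 where 1: "((i, r), (i1, r1)) \<in> sem w (copies px)"
      using sem_copies_ex b by blast
    have b1: "i1 \<le> Suc (length w)" "bdd w r1" using sem_bounded[OF 1] b by auto
    have c1: "\<forall>j<k. r1 j = r j" "cur r1 = map r xs" using cx[OF 1] b by auto
    note br = br_eq[OF c1(1), of w]
    obtain i2 r2 where 2: "((i1, r1), (i2, r2)) \<in> (sem w B)\<^sup>*" "cur r2 = map r ys"
      using S2[OF _ b1, of "map r ys"] tc br c1 by auto
    have c2: "\<forall>j<k. r2 j = r1 j" "bdd w r2" using S1[OF 2(1) b1] by auto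
    have "r2 (k + j) = r2 (ys ! j)" if "j < a" for j
    proof -
      have "r2 (k + j) = cur r2 ! j" using that by (simp add: cur_def)
      then show ?thesis using 2(2) that ys xk c1 c2 by simp
    qed
    then obtain i3 where "((i2, r2), (i3, r2)) \<in> sem w (tests py)"
      using sem_tests_ex[OF c2(2), of py i2] by (auto simp: zy)
    then show "\<exists>i' r'. ((i, r), (i', r')) \<in> sem w Q"
      using 1 2(1) unfolding Q_def by auto
  next
    fix w i r i' r'
    assume b: "i \<le> Suc (length w)" "bdd w r" and "((i, r), (i', r')) \<in> sem w Q"
    then obtain i1 r1 i2 r2 where 1: "((i, r), (i1, r1)) \<in> sem w (copies px)"
      and 2: "((i1, r1), (i2, r2)) \<in> (sem w B)\<^sup>*"
      and 3: "((i2, r2), (i', r')) \<in> sem w (tests py)"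
      unfolding Q_def by auto
    have b1: "i1 \<le> Suc (length w)" "bdd w r1" using sem_bounded[OF 1] b by auto
    have c1: "\<forall>j<k. r1 j = r j" "cur r1 = map r xs" using cx[OF 1] b by auto
    note br = br_eq[OF c1(1), of w]
    have c2: "\<forall>j<k. r2 j = r1 j" "bdd w r2"
      "(bounded_rel a w (R w r))\<^sup>*\<^sup>* (map r xs) (cur r2)"
      using S1[OF 2 b1] br c1 by auto
    have t: "r' = r2" "\<forall>(x, y)\<in>set py. r2 x = r2 y"
      using sem_tests[OF 3 c2(2)] by auto
    have "cur r2 = map r ys"
      by (rule nth_equalityI) (use t(2) c1 c2 xk ys in \<open>auto simp: cur_def zy\<close>)
    then show "(bounded_rel a w (R w r))\<^sup>*\<^sup>* (map r xs) (map r ys) \<and> (\<forall>j<k. r' j = r j)"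
      using c1 c2 t(1) by simp
  qed
qed

section \<open>Regular factors and comparison of binary numbers\<close>

text \<open>Here \<open>x\<close> and \<open>y\<close> are head positions. Position 0 is the left
  end marker, whence the \<open>Suc\<close>, and \<open>y\<close> is the position just behind the
  factor, possibly the right end marker.\<close>

definition factor :: "sym list \<Rightarrow> nat \<Rightarrow> nat \<Rightarrow> sym list set \<Rightarrow> bool" where
  "factor w x y A \<longleftrightarrow> (\<exists>u v z. w = u @ v @ z \<and> v \<in> A \<and> x = Suc (length u) \<and> y = x + length v)"

definition conc :: "'a list set \<Rightarrow> 'a list set \<Rightarrow> 'a list set" where
  "conc A B = {u @ v | u v. u \<in> A \<and> v \<in> B}"

definition kstar :: "'a list set \<Rightarrow> 'a list set" where
  "kstar A = {concat us | us. set us \<subseteq> A}"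

text \<open>The head itself scans the factor, and registers are untouched. The start has to be right
  of the left end marker, since position 0 is the start of no factor.\<close>

definition recognizes :: "prog \<Rightarrow> sym list set \<Rightarrow> bool" where
  "recognizes P A \<longleftrightarrow> (\<forall>w i r i' r'. 1 \<le> i \<and> i \<le> Suc (length w) \<longrightarrow>
     (((i, r), (i', r')) \<in> sem w P \<longleftrightarrow> r' = r \<and> factor w i i' A))"

definition regular :: "sym list set \<Rightarrow> bool" where
  "regular A \<longleftrightarrow> (\<exists>P. recognizes P A)"

lemma recognizesD:
  "recognizes P A \<Longrightarrow> 1 \<le> i \<Longrightarrow> i \<le> Suc (length w) \<Longrightarrow>
    ((i, r), (i', r')) \<in> sem w P \<longleftrightarrow> r' = r \<and> factor w i i' A"
  unfolding recognizes_def by blast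

lemma factor_range: "factor w x y A \<Longrightarrow> 1 \<le> x \<and> x \<le> y \<and> y \<le> Suc (length w)"
  by (auto simp: factor_def)

lemma factor_Un: "factor w x y (A \<union> B) \<longleftrightarrow> factor w x y A \<or> factor w x y B"
  unfolding factor_def by blast

lemma factor_Nil: "factor w x y {[]} \<longleftrightarrow> 1 \<le> x \<and> x \<le> Suc (length w) \<and> y = x"
proof
  assume "1 \<le> x \<and> x \<le> Suc (length w) \<and> y = x"
  then show "factor w x y {[]}" unfolding factor_def
    by (intro exI[of _ "take (x - 1) w"] exI[of _ "[]"] exI[of _ "drop (x - 1) w"]) auto
qed (auto simp: factor_def)

lemma input_at_In: "input_at w i = In a \<longleftrightarrow> (\<exists>u z. w = u @ a # z \<and> i = Suc (length u))"
proof
  assume "input_at w i = In a"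
  then have i: "0 < i" "i \<le> length w" "w ! (i - 1) = a"
    by (auto simp: input_at_def split: if_splits)
  then have "w = take (i - 1) w @ a # drop i w"
    using id_take_nth_drop[of "i - 1" w] by simp
  with i show "\<exists>u z. w = u @ a # z \<and> i = Suc (length u)"
    by (intro exI[of _ "take (i - 1) w"] exI[of _ "drop i w"]) simp
qed (auto simp: input_at_def)

lemma factor_single: "factor w x y {[a]} \<longleftrightarrow> input_at w x = In a \<and> y = Suc x"
  by (auto simp: factor_def input_at_In)

lemma factor_conc: "factor w x y (conc A B) \<longleftrightarrow> (\<exists>m. factor w x m A \<and> factor w m y B)"
proof
  assume "factor w x y (conc A B)"
  then obtain u v1 v2 z where *: "w = u @ (v1 @ v2) @ z" "v1 \<in> A" "v2 \<in> B" "x = Suc (length u)"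
    "y = x + length (v1 @ v2)" by (auto simp: factor_def conc_def)
  then have "factor w x (x + length v1) A" unfolding factor_def
    by (intro exI[of _ u] exI[of _ v1] exI[of _ "v2 @ z"]) simp
  moreover have "factor w (x + length v1) y B" unfolding factor_def using *
    by (intro exI[of _ "u @ v1"] exI[of _ v2] exI[of _ z]) simp
  ultimately show "\<exists>m. factor w x m A \<and> factor w m y B" by blast
next
  assume "\<exists>m. factor w x m A \<and> factor w m y B"
  then obtain m where "factor w x m A" "factor w m y B" by blast
  then obtain u v1 z1 u' v2 z where 1: "w = u @ v1 @ z1" "v1 \<in> A" "x = Suc (length u)" "m = x + length v1"
    and 2: "w = u' @ v2 @ z" "v2 \<in> B" "m = Suc (length u')" "y = m + length v2"
    unfolding factor_def by blast
  have "(u @ v1) @ z1 = u' @ v2 @ z" "length (u @ v1) = length u'" using 1 2 by auto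
  then have "z1 = v2 @ z" using append_eq_append_conv by blast
  with 1 2 show "factor w x y (conc A B)" unfolding factor_def conc_def
    by (intro exI[of _ u] exI[of _ "v1 @ v2"] exI[of _ z]) auto
qed

lemma kstar_unfold: "kstar A = {[]} \<union> conc A (kstar A)"
proof (intro set_eqI iffI)
  fix v assume "v \<in> kstar A"
  then obtain us where us: "v = concat us" "set us \<subseteq> A" by (auto simp: kstar_def)
  then show "v \<in> {[]} \<union> conc A (kstar A)"
    by (cases us) (auto simp: conc_def kstar_def)
next
  fix v assume "v \<in> {[]} \<union> conc A (kstar A)"
  then consider "v = []" | a us where "v = a @ concat us" "a \<in> A" "set us \<subseteq> A"
    by (auto simp: conc_def kstar_def)
  then show "v \<in> kstar A"
  proof cases
    case 1
    then show ?thesis by (auto simp: kstar_def intro!: exI[of _ "[]"])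
  next
    case 2
    then show ?thesis by (auto simp: kstar_def intro!: exI[of _ "a # us"])
  qed
qed

text \<open>The range condition on \<open>x\<close> is due to reflexivity: the closure relates every
  number to itself, the empty factor only positions of the word.\<close>

lemma factor_kstar:
  assumes "1 \<le> x" "x \<le> Suc (length w)"
  shows "factor w x y (kstar A) \<longleftrightarrow> (\<lambda>x y. factor w x y A)\<^sup>*\<^sup>* x y"
proof
  have "(\<lambda>x y. factor w x y A)\<^sup>*\<^sup>* x y" if "factor w x y {concat us}" "set us \<subseteq> A" for us
    using that
  proof (induction us arbitrary: x)
    case Nil
    then show ?case by (simp add: factor_Nil)
  next
    case (Cons a us)
    have "{concat (a # us)} = conc {a} {concat us}" by (auto simp: conc_def)
    with Cons.prems(1) obtain m where m: "factor w x m {a}" "factor w m y {concat us}"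
      by (auto simp: factor_conc simp del: concat.simps)
    then have "(\<lambda>x y. factor w x y A)\<^sup>*\<^sup>* m y" using Cons.IH Cons.prems(2) by simp
    moreover have "factor w x m A" using m(1) Cons.prems(2) by (auto simp: factor_def)
    ultimately show ?case by (simp add: converse_rtranclp_into_rtranclp)
  qed
  then show "factor w x y (kstar A) \<Longrightarrow> (\<lambda>x y. factor w x y A)\<^sup>*\<^sup>* x y"
    unfolding kstar_def factor_def by blast
next
  assume "(\<lambda>x y. factor w x y A)\<^sup>*\<^sup>* x y"
  then show "factor w x y (kstar A)"
    using assms
  proof (induction rule: converse_rtranclp_induct)
    case base
    then show ?case by (subst kstar_unfold) (simp only: factor_Un factor_Nil, simp)
  next
    case (step x m)
    have "factor w m y (kstar A)" using factor_range[OF step.hyps(1)] step.IH by auto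
    with step.hyps(1) show ?case
      by (subst kstar_unfold) (simp only: factor_Un factor_conc, blast)
  qed
qed

section \<open>Closure properties of regular sets\<close>

lemma regular_single: "regular {[a]}"
  unfolding regular_def recognizes_def
proof (intro exI[of _ "Seq (I (Sym {In a})) (I Right)"] allI impI)
  fix w :: "sym list" and i r i' r'
  show "((i, r), (i', r')) \<in> sem w (Seq (I (Sym {In a})) (I Right)) \<longleftrightarrow> r' = r \<and> factor w i i' {[a]}"
    by (auto simp: factor_single relcomp_unfold input_at_In)
qed

lemma regular_Nil: "regular {[]}"
  unfolding regular_def recognizes_def by (intro exI[of _ Skip]) (auto simp: factor_Nil)

lemma regular_Un:
  assumes "regular A" "regular B"
  shows "regular (A \<union> B)"
proof -
  from assms obtain P Q where "recognizes P A" "recognizes Q B" unfolding regular_def by blast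
  then have "recognizes (Choice P Q) (A \<union> B)"
    by (auto simp: recognizes_def factor_Un)
  then show ?thesis unfolding regular_def by blast
qed

lemma regular_conc:
  assumes "regular A" "regular B"
  shows "regular (conc A B)"
proof -
  from assms obtain P Q where "recognizes P A" "recognizes Q B" unfolding regular_def by blast
  note P = recognizesD[OF this(1)] and Q = recognizesD[OF this(2)]
  have "((i, r), (i', r')) \<in> sem w (Seq P Q) \<longleftrightarrow> r' = r \<and> factor w i i' (conc A B)"
    if i: "1 \<le> i" "i \<le> Suc (length w)" for w i r i' and r' :: "nat \<Rightarrow> nat"
  proof -
    have "((i, r), (i', r')) \<in> sem w (Seq P Q) \<longleftrightarrow>
        (\<exists>m. factor w i m A \<and> ((m, r), (i', r')) \<in> sem w Q)"
      using P[OF i] by (auto simp: relcomp_unfold)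
    also have "\<dots> \<longleftrightarrow> (\<exists>m. factor w i m A \<and> r' = r \<and> factor w m i' B)"
    proof -
      have "((m, r), (i', r')) \<in> sem w Q \<longleftrightarrow> r' = r \<and> factor w m i' B" if "factor w i m A" for m
        using factor_range[OF that] by (intro Q) auto
      then show ?thesis by blast
    qed
    finally show ?thesis by (auto simp: factor_conc)
  qed
  then have "recognizes (Seq P Q) (conc A B)" unfolding recognizes_def by blast
  then show ?thesis unfolding regular_def by blast
qed

lemma regular_kstar:
  assumes "regular A"
  shows "regular (kstar A)"
proof -
  from assms obtain P where "recognizes P A" unfolding regular_def by blast
  note P = recognizesD[OF this]
  have 1: "r' = r \<and> (\<lambda>x y. factor w x y A)\<^sup>*\<^sup>* i i' \<and> 1 \<le> i' \<and> i' \<le> Suc (length w)"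
    if "((i, r), (i', r')) \<in> (sem w P)\<^sup>*" "1 \<le> i" "i \<le> Suc (length w)" for w i r i' r'
    using that
  proof (induction "(i', r')" arbitrary: i' r' rule: rtrancl_induct)
    case (step y)
    obtain m r1 where y: "y = (m, r1)" by fastforce
    with step have *: "r1 = r" "(\<lambda>x y. factor w x y A)\<^sup>*\<^sup>* i m" "1 \<le> m" "m \<le> Suc (length w)" by auto
    then have "r' = r" "factor w m i' A" using step.hyps(2) P[of m w r1 i' r'] y by auto
    with * factor_range[of w m i' A] show ?case by (auto intro: rtranclp.rtrancl_into_rtrancl)
  qed auto
  have 2: "((i, r), (i', r)) \<in> (sem w P)\<^sup>*"
    if "(\<lambda>x y. factor w x y A)\<^sup>*\<^sup>* i i'" for w i r i'
    using that
  proof (induction rule: rtranclp_induct)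
    case (step m i')
    have "((m, r), (i', r)) \<in> sem w P" using P[of m w r i' r] factor_range[OF step.hyps(2)] step.hyps(2)
      by simp
    with step.IH show ?case by (rule rtrancl.rtrancl_into_rtrancl)
  qed simp
  show ?thesis unfolding regular_def recognizes_def
  proof (intro exI[of _ "Star P"] allI impI)
    fix w :: "sym list" and i r i' r'
    assume "1 \<le> i \<and> i \<le> Suc (length w)"
    then show "((i, r), (i', r')) \<in> sem w (Star P) \<longleftrightarrow> r' = r \<and> factor w i i' (kstar A)"
      using 1[of i r i' r' w] 2[of w i i' r] factor_kstar[of i w i' A] by auto
  qed
qed

lemma definable_factor:
  assumes "regular A" "x < k" "y < k"
  shows "definable k (\<lambda>w e. factor w (e x) (e y) A)"
proof -
  from assms obtain P where "recognizes P A" unfolding regular_def by blast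
  note P = recognizesD[OF this]
  \<comment> \<open>The test against \<open>LEnd\<close> rules out position 0, for which
    \<open>recognizes\<close> promises nothing.\<close>
  have run: "((i, r), (i', r')) \<in> sem w (Seq (goto x) (Seq (I (Sym (- {LEnd}))) (Seq P (I (Eq y))))) \<longleftrightarrow>
      r' = r \<and> i' = r y \<and> factor w (r x) (r y) A"
    if r: "bdd w r" for w i r i' r'
  proof (cases "r x = 0")
    case True
    then show ?thesis using factor_range[of w "r x" "r y" A] r
      by (auto simp: relcomp_unfold sem_goto input_at_LEnd)
  next
    case False
    then have "((i, r), (i', r')) \<in> sem w (Seq (goto x) (Seq (I (Sym (- {LEnd}))) (Seq P (I (Eq y))))) \<longleftrightarrow>
      ((r x, r), (i', r')) \<in> sem w P \<and> r' y = i'"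
      using r by (auto simp: relcomp_unfold sem_goto input_at_LEnd)
    then show ?thesis using P[of "r x" w r i' r'] r False by auto
  qed
  show ?thesis
    by (rule definableI[where P = "Seq (goto x) (Seq (I (Sym (- {LEnd}))) (Seq P (I (Eq y))))"])
      (use run assms(2,3) in auto)
qed

text \<open>Agreement on registers in range is enough. This lets a definition go through
  intermediate positions, which exist as witnesses only if the registers are bounded.\<close>

lemma definable_cong:
  assumes \<phi>: "definable k \<phi>"
    and eq: "\<And>w e. bdd w e \<Longrightarrow> \<phi> w e = \<psi> w e"
    and loc: "\<And>w e e'. (\<And>j. j < k \<Longrightarrow> e j = e' j) \<Longrightarrow> \<psi> w e = \<psi> w e'"
  shows "definable k \<psi>"
proof -
  obtain P where "decides P k \<phi>" using definableE[OF \<phi>] by blast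
  then have "decides P k \<psi>" unfolding decides_def using eq by simp
  then show ?thesis unfolding definable_def using loc by blast
qed

section \<open>Arithmetic on head positions: successors, doubling, halving\<close>

lemma definable_0: "x < k \<Longrightarrow> definable k (\<lambda>w e. e x = 0)"
  using definable_input[of x k "{LEnd}"] by (simp add: input_at_LEnd)

lemma definable_last: "x < k \<Longrightarrow> definable k (\<lambda>w e. e x = Suc (length w))"
  by (rule definable_cong[OF definable_input[of x k "{REnd}"]])
    (auto simp: input_at_REnd intro: le_antisym)

lemma definable_1: "x < k \<Longrightarrow> definable k (\<lambda>w e. e x = Suc 0)"
proof (rule definable_cong)
  show "x < k \<Longrightarrow> definable k (\<lambda>w e. \<exists>v\<le>Suc (length w). v = 0 \<and> e x = Suc v)"
    by (intro definable_ex definable_conj definable_0 definable_Suc) auto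
qed auto

lemma definable_Suc_Suc:
  assumes "x < k" "y < k"
  shows "definable k (\<lambda>w e. e y = Suc (Suc (e x)))"
proof (rule definable_cong)
  show "definable k (\<lambda>w e. \<exists>v\<le>Suc (length w). v = Suc (e x) \<and> e y = Suc v)"
    by (intro definable_ex definable_conj definable_Suc) (use assms in auto)
  fix w :: "sym list" and e :: "nat \<Rightarrow> nat"
  assume "bdd w e"
  then have "e y \<le> Suc (length w)" by simp
  then show "(\<exists>v\<le>Suc (length w). v = Suc (e x) \<and> e y = Suc v) \<longleftrightarrow> e y = Suc (Suc (e x))" by auto
qed (use assms in auto)

lemma definable_TC1:
  assumes "definable (k + 2) (\<lambda>w e. R w e (e k) (e (Suc k)))"
    and "\<And>w e e' x x'. (\<And>j. j < k \<Longrightarrow> e j = e' j) \<Longrightarrow> R w e x x' = R w e' x x'"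
    and "x < k" "y < k"
  shows "definable k (\<lambda>w e. (bounded_rel 1 w (\<lambda>s s'. R w e (s ! 0) (s' ! 0)))\<^sup>*\<^sup>* [e x] [e y])"
proof -
  have "definable k (\<lambda>w e. (bounded_rel 1 w (\<lambda>s s'. R w e (s ! 0) (s' ! 0)))\<^sup>*\<^sup>* (map e [x]) (map e [y]))"
  proof (rule definable_TC)
    show "definable (k + 1 + 1) (\<lambda>w e. R w e (map e [k..<k + 1] ! 0) (map e [k + 1..<k + 1 + 1] ! 0))"
      using assms(1) by simp
    show "R w e (s ! 0) (s' ! 0) = R w e' (s ! 0) (s' ! 0)"
      if "\<And>j. j < k \<Longrightarrow> e j = e' j" for w e e' s s' using assms(2)[OF that] .
  qed (use assms(3,4) in auto)
  then show ?thesis by simp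
qed

lemma definable_TC2:
  assumes "definable (k + 4) (\<lambda>w e. R w e (e k) (e (Suc k)) (e (k + 2)) (e (k + 3)))"
    and "\<And>w e e' x x' y y'. (\<And>j. j < k \<Longrightarrow> e j = e' j) \<Longrightarrow> R w e x x' y y' = R w e' x x' y y'"
    and "x < k" "y < k" "x' < k" "y' < k"
  shows "definable k (\<lambda>w e. (bounded_rel 2 w (\<lambda>s s'. R w e (s ! 0) (s ! 1) (s' ! 0) (s' ! 1)))\<^sup>*\<^sup>*
    [e x, e y] [e x', e y'])"
proof -
  have "definable k (\<lambda>w e. (bounded_rel 2 w (\<lambda>s s'. R w e (s ! 0) (s ! 1) (s' ! 0) (s' ! 1)))\<^sup>*\<^sup>*
    (map e [x, y]) (map e [x', y']))"
  proof (rule definable_TC)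
    have "[k..<k + 2] = [k, Suc k]" "[k + 2..<k + 2 + 2] = [k + 2, k + 3]"
      by (simp_all add: upt_rec)
    then show "definable (k + 2 + 2) (\<lambda>w e. R w e (map e [k..<k + 2] ! 0) (map e [k..<k + 2] ! 1)
        (map e [k + 2..<k + 2 + 2] ! 0) (map e [k + 2..<k + 2 + 2] ! 1))"
      using assms(1) by (simp add: numeral_eq_Suc)
    show "R w e (s ! 0) (s ! 1) (s' ! 0) (s' ! 1) = R w e' (s ! 0) (s ! 1) (s' ! 0) (s' ! 1)"
      if "\<And>j. j < k \<Longrightarrow> e j = e' j" for w e e' s s' using assms(2)[OF that] .
  qed (use assms(3-6) in auto)
  then show ?thesis by simp
qed

text \<open>Doubling is reachability from the pair of zeros by adding one to the first and two to
  the second component. Both components only grow, so all intermediate pairs are in range if the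
  last one is.\<close>

lemma definable_double:
  assumes "s < k" "z < k"
  shows "definable k (\<lambda>w e. e z = 2 * e s)"
proof (rule definable_cong)
  let ?R = "\<lambda>w :: sym list. bounded_rel 2 w (\<lambda>s s'. s' ! 0 = Suc (s ! 0) \<and> s' ! 1 = Suc (Suc (s ! 1)))"
  show "definable k (\<lambda>w e. \<exists>v\<le>Suc (length w). v = 0 \<and> (?R w)\<^sup>*\<^sup>* [v, v] [e s, e z])"
  proof (rule definable_ex, intro definable_conj)
    show "definable (Suc k) (\<lambda>w e. (?R w)\<^sup>*\<^sup>* [e k, e k] [e s, e z])"
    proof (rule definable_TC2)
      show "definable (Suc k + 4) (\<lambda>w e. e (Suc k + 2) = Suc (e (Suc k)) \<and>
        e (Suc k + 3) = Suc (Suc (e (Suc (Suc k)))))"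
        by (intro definable_conj definable_Suc definable_Suc_Suc) auto
    qed (use assms in auto)
  qed (use assms definable_0 in auto)
  fix w :: "sym list" and e :: "nat \<Rightarrow> nat"
  assume b: "bdd w e"
  have 1: "s' ! 1 = 2 * s' ! 0 \<and> length s' = 2" if "(?R w)\<^sup>*\<^sup>* [0, 0] s'" for w s'
    using that by (induction rule: rtranclp_induct) (auto simp: bounded_rel_def)
  have 2: "(?R w)\<^sup>*\<^sup>* [0, 0] [n, 2 * n]" if "2 * n \<le> Suc (length w)" for w n
    using that
  proof (induction n)
    case (Suc n)
    have "?R w [n, 2 * n] [Suc n, 2 * Suc n]" using Suc.prems by (simp add: bounded_rel_def)
    with Suc show ?case by (simp add: rtranclp.rtrancl_into_rtrancl)
  qed simp
  have "e z \<le> Suc (length w)" using b by simp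
  then show "(\<exists>v\<le>Suc (length w). v = 0 \<and> (?R w)\<^sup>*\<^sup>* [v, v] [e s, e z]) \<longleftrightarrow> e z = 2 * e s"
  proof (intro iffI)
    assume "\<exists>v\<le>Suc (length w). v = 0 \<and> (?R w)\<^sup>*\<^sup>* [v, v] [e s, e z]"
    then have "(?R w)\<^sup>*\<^sup>* [0, 0] [e s, e z]" by blast
    from 1[OF this] show "e z = 2 * e s" by simp
  next
    assume z: "e z = 2 * e s"
    have "(?R w)\<^sup>*\<^sup>* [0, 0] [e s, e z]" using 2[of "e s" w] \<open>e z \<le> _\<close> unfolding z .
    then show "\<exists>v\<le>Suc (length w). v = 0 \<and> (?R w)\<^sup>*\<^sup>* [v, v] [e s, e z]" by blast
  qed
qed (use assms in auto)

lemma definable_half: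
  assumes "c < k" "d < k"
  shows "definable k (\<lambda>w e. e d = e c div 2)"
proof (rule definable_cong)
  show "definable k (\<lambda>w e. \<exists>z\<le>Suc (length w). z = 2 * e d \<and> (e c = z \<or> e c = Suc z))"
    by (intro definable_ex definable_conj definable_disj definable_double definable_Suc definable_eq)
      (use assms in auto)
  fix w :: "sym list" and e :: "nat \<Rightarrow> nat"
  assume "bdd w e"
  then have "e c \<le> Suc (length w)" by simp
  then show "(\<exists>z\<le>Suc (length w). z = 2 * e d \<and> (e c = z \<or> e c = Suc z)) \<longleftrightarrow> e d = e c div 2"
    by auto
qed (use assms in auto)

text \<open>Rounding up is the delicate half: neither \<open>Suc (e c)\<close> nor, for odd
  \<open>e c\<close>, the double of \<open>e d\<close> need be in range. The odd case therefore goes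
  through \<open>s\<close>, the predecessor of \<open>e d\<close>, with
  \<open>e c = 2 * s + 1\<close>.\<close>

lemma definable_Suc_half:
  assumes "c < k" "d < k"
  shows "definable k (\<lambda>w e. e d = Suc (e c) div 2)"
proof (rule definable_cong)
  show "definable k (\<lambda>w e. e c = 2 * e d \<or>
      (\<exists>s\<le>Suc (length w). e d = Suc s \<and> (\<exists>z\<le>Suc (length w). z = 2 * s \<and> e c = Suc z)))"
    by (intro definable_ex definable_conj definable_disj definable_double definable_Suc definable_eq)
      (use assms in auto)
  fix w :: "sym list" and e :: "nat \<Rightarrow> nat"
  assume "bdd w e"
  then have "e c \<le> Suc (length w)" "e d \<le> Suc (length w)" by simp_all
  then show "(e c = 2 * e d \<or> (\<exists>s\<le>Suc (length w). e d = Suc s \<and>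
      (\<exists>z\<le>Suc (length w). z = 2 * s \<and> e c = Suc z))) \<longleftrightarrow> e d = Suc (e c) div 2"
    by (cases "e d") auto
qed (use assms in auto)

section \<open>Comparison of binary numerals in the input\<close>

lemma reach_unfold:
  "(\<exists>t. R\<^sup>*\<^sup>* s t \<and> F t) \<longleftrightarrow> F s \<or> (\<exists>s'. R s s' \<and> (\<exists>t. R\<^sup>*\<^sup>* s' t \<and> F t))"
  by (metis converse_rtranclpE converse_rtranclp_into_rtranclp rtranclp.rtrancl_refl)

definition same_bit :: "sym list \<Rightarrow> nat \<Rightarrow> nat \<Rightarrow> bool" where
  "same_bit w x y \<longleftrightarrow> (input_at w x \<in> {In S0} \<and> input_at w y \<in> {In S0}) \<or>
     (input_at w x \<in> {In S1} \<and> input_at w y \<in> {In S1})"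

definition agree_until :: "insym set \<Rightarrow> insym set \<Rightarrow> sym list \<Rightarrow> nat \<Rightarrow> nat \<Rightarrow> bool" where
  "agree_until A B w x y \<longleftrightarrow> (\<exists>x'\<le>Suc (length w). \<exists>y'\<le>Suc (length w).
     (bounded_rel 2 w (\<lambda>s s'. same_bit w (s ! 0) (s ! 1) \<and> s' ! 0 = Suc (s ! 0) \<and>
        s' ! 1 = Suc (s ! 1)))\<^sup>*\<^sup>* [x, y] [x', y'] \<and> input_at w x' \<in> A \<and> input_at w y' \<in> B)"

definition same_num :: "sym list \<Rightarrow> nat \<Rightarrow> nat \<Rightarrow> bool" where
  "same_num w x y \<longleftrightarrow> agree_until {In SNum} {In SNum} w x y"

text \<open>A search of its own instead of the negation of \<open>same_num\<close>. The cases name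
  the first numeral's symbol at the earliest difference. The closing \<open>SNum\<close> counts as a
  symbol, so a proper prefix is detected too.\<close>

definition diff_num :: "sym list \<Rightarrow> nat \<Rightarrow> nat \<Rightarrow> bool" where
  "diff_num w x y \<longleftrightarrow> agree_until {In S0} (- {In S0}) w x y \<or> agree_until {In S1} (- {In S1}) w x y \<or>
     agree_until {In SNum} (- {In SNum}) w x y"

lemma definable_agree_until:
  assumes "x < k" "y < k"
  shows "definable k (\<lambda>w e. agree_until A B w (e x) (e y))"
  unfolding agree_until_def same_bit_def using assms
  by (intro definable_ex definable_conj definable_TC2 definable_disj definable_input definable_Suc) auto

lemma definable_same_num: "x < k \<Longrightarrow> y < k \<Longrightarrow> definable k (\<lambda>w e. same_num w (e x) (e y))"
  unfolding same_num_def by (rule definable_agree_until)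

lemma definable_diff_num: "x < k \<Longrightarrow> y < k \<Longrightarrow> definable k (\<lambda>w e. diff_num w (e x) (e y))"
  unfolding diff_num_def by (intro definable_disj definable_agree_until)

lemma rtranclp_bounded_rel:
  "(bounded_rel a w R)\<^sup>*\<^sup>* s t \<Longrightarrow> length s = a \<Longrightarrow> \<forall>x\<in>set s. x \<le> Suc (length w) \<Longrightarrow>
    length t = a \<and> (\<forall>x\<in>set t. x \<le> Suc (length w))"
  by (induction rule: rtranclp_induct) (auto simp: bounded_rel_def)

lemma agree_until_unfold:
  assumes "x \<le> Suc (length w)" "y \<le> Suc (length w)"
  shows "agree_until A B w x y \<longleftrightarrow> (input_at w x \<in> A \<and> input_at w y \<in> B) \<or>
    (same_bit w x y \<and> agree_until A B w (Suc x) (Suc y))"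
proof -
  let ?R = "bounded_rel 2 w (\<lambda>s s'. same_bit w (s ! 0) (s ! 1) \<and> s' ! 0 = Suc (s ! 0) \<and>
        s' ! 1 = Suc (s ! 1))"
  let ?F = "\<lambda>s. input_at w (s ! 0) \<in> A \<and> input_at w (s ! 1) \<in> B"
  have ag: "agree_until A B w x y \<longleftrightarrow> (\<exists>t. ?R\<^sup>*\<^sup>* [x, y] t \<and> ?F t)"
    if xy: "x \<le> Suc (length w)" "y \<le> Suc (length w)" for x y
  proof
    assume "\<exists>t. ?R\<^sup>*\<^sup>* [x, y] t \<and> ?F t"
    then obtain t where t: "?R\<^sup>*\<^sup>* [x, y] t" "?F t" by blast
    then have "length t = 2 \<and> (\<forall>x\<in>set t. x \<le> Suc (length w))"
      using rtranclp_bounded_rel[of 2 w _ "[x, y]" t] xy by simp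
    then obtain x' y' where "t = [x', y']" "x' \<le> Suc (length w)" "y' \<le> Suc (length w)"
      by (auto simp: length_Suc_conv numeral_2_eq_2)
    with t show "agree_until A B w x y" unfolding agree_until_def by auto
  qed (fastforce simp: agree_until_def)
  \<comment> \<open>Equal bits lie inside the word, so both successor positions are in
    range.\<close>
  have lt: "x \<le> length w \<and> y \<le> length w" if "same_bit w x y"
    using that by (auto simp: same_bit_def input_at_def split: if_splits)
  have R: "?R [x, y] t \<longleftrightarrow> same_bit w x y \<and> t = [Suc x, Suc y]" for t
    using lt by (auto simp: bounded_rel_def length_Suc_conv numeral_2_eq_2)
  have "agree_until A B w x y \<longleftrightarrow> ?F [x, y] \<or> (\<exists>s'. ?R [x, y] s' \<and> (\<exists>t. ?R\<^sup>*\<^sup>* s' t \<and> ?F t))"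
    unfolding ag[OF assms] by (rule reach_unfold)
  also have "\<dots> \<longleftrightarrow> ?F [x, y] \<or> (same_bit w x y \<and> (\<exists>t. ?R\<^sup>*\<^sup>* [Suc x, Suc y] t \<and> ?F t))"
    unfolding R by blast
  finally show ?thesis using ag[of "Suc x" "Suc y"] lt by auto
qed

text \<open>The same word is decomposed twice, so the numerals may stand anywhere, in either order,
  or coincide. Both scans peel off one symbol per step, and the two equivalences follow by one
  induction.\<close>

lemma compare_bits:
  assumes "w = u1 @ bs1 @ SNum # z1" "w = u2 @ bs2 @ SNum # z2" "set bs1 \<subseteq> {S0, S1}" "set bs2 \<subseteq> {S0, S1}"
  shows "(same_num w (Suc (length u1)) (Suc (length u2)) \<longleftrightarrow> bs1 = bs2) \<and>
    (diff_num w (Suc (length u1)) (Suc (length u2)) \<longleftrightarrow> bs1 \<noteq> bs2)"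
  using assms
proof (induction bs1 arbitrary: u1 u2 bs2)
  case Nil
  let ?x = "Suc (length u1)" and ?y = "Suc (length u2)"
  have "?x \<le> Suc (length w)" using Nil(1) by simp
  moreover have "?y \<le> Suc (length w)" using Nil(2) by simp
  ultimately have b: "?x \<le> Suc (length w)" "?y \<le> Suc (length w)" .
  have x: "input_at w ?x = In SNum" using Nil(1) by (auto simp: input_at_In)
  have y: "input_at w ?y = In SNum \<longleftrightarrow> bs2 = []"
  proof (cases bs2)
    case (Cons c cs)
    then have "input_at w ?y = In c" using Nil(2) by (auto simp: input_at_In)
    then show ?thesis using Nil(4) Cons by auto
  qed (use Nil(2) in \<open>auto simp: input_at_In\<close>)
  show ?case using x y unfolding same_num_def diff_num_def agree_until_unfold[OF b]
    by (auto simp: same_bit_def)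
next
  case (Cons b bs1)
  let ?x = "Suc (length u1)" and ?y = "Suc (length u2)"
  have "?x \<le> Suc (length w)" using Cons.prems(1) by simp
  moreover have "?y \<le> Suc (length w)" using Cons.prems(2) by simp
  ultimately have bd: "?x \<le> Suc (length w)" "?y \<le> Suc (length w)" .
  have x: "input_at w ?x = In b" using Cons.prems(1) by (auto simp: input_at_In)
  show ?case
  proof (cases bs2)
    case Nil
    then have y: "input_at w ?y = In SNum" using Cons.prems(2) by (auto simp: input_at_In)
    show ?thesis using x y Cons.prems(3) Nil
      unfolding same_num_def diff_num_def agree_until_unfold[OF bd] by (auto simp: same_bit_def)
  next
    case c: (Cons c cs)
    then have y: "input_at w ?y = In c" using Cons.prems(2) by (auto simp: input_at_In)
    have IH: "(same_num w (Suc ?x) (Suc ?y) \<longleftrightarrow> bs1 = cs) \<and> (diff_num w (Suc ?x) (Suc ?y) \<longleftrightarrow> bs1 \<noteq> cs)"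
      using Cons.IH[of "u1 @ [b]" "u2 @ [c]" cs] Cons.prems c by simp
    show ?thesis using x y Cons.prems(3,4) IH c
      unfolding same_num_def diff_num_def agree_until_unfold[OF bd] by (auto simp: same_bit_def)
  qed
qed

text \<open>Uses that \<open>c \<le> 2 * v + 1\<close> iff \<open>c div 2 \<le> v\<close>, and \<open>c \<le> 2 * v\<close> iff \<open>Suc c div 2 \<le> v\<close>.\<close>
definition le_num :: "sym list \<Rightarrow> nat \<Rightarrow> nat \<Rightarrow> bool" where
  "le_num w x c \<longleftrightarrow> (\<exists>x'\<le>Suc (length w). \<exists>c'\<le>Suc (length w).
     (bounded_rel 2 w (\<lambda>s s'. s' ! 0 = Suc (s ! 0) \<and>
        ((input_at w (s ! 0) \<in> {In S1} \<and> s' ! 1 = (s ! 1) div 2) \<or>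
         (input_at w (s ! 0) \<in> {In S0} \<and> s' ! 1 = Suc (s ! 1) div 2))))\<^sup>*\<^sup>* [x, c] [x', c'] \<and>
     input_at w x' \<in> {In SNum} \<and> c' = 0)"

lemma definable_le_num:
  assumes "x < k" "c < k"
  shows "definable k (\<lambda>w e. le_num w (e x) (e c))"
  unfolding le_num_def using assms
  by (intro definable_ex definable_conj definable_TC2 definable_disj definable_input definable_Suc
    definable_0 definable_half definable_Suc_half) auto

lemma le_num_unfold:
  assumes "x \<le> Suc (length w)" "c \<le> Suc (length w)"
  shows "le_num w x c \<longleftrightarrow> (input_at w x = In SNum \<and> c = 0) \<or>
    (input_at w x = In S1 \<and> le_num w (Suc x) (c div 2)) \<or>
    (input_at w x = In S0 \<and> le_num w (Suc x) (Suc c div 2))"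
proof -
  let ?R = "bounded_rel 2 w (\<lambda>s s'. s' ! 0 = Suc (s ! 0) \<and>
        ((input_at w (s ! 0) \<in> {In S1} \<and> s' ! 1 = (s ! 1) div 2) \<or>
         (input_at w (s ! 0) \<in> {In S0} \<and> s' ! 1 = Suc (s ! 1) div 2)))"
  let ?F = "\<lambda>s. input_at w (s ! 0) \<in> {In SNum} \<and> s ! 1 = 0"
  have le: "le_num w x c \<longleftrightarrow> (\<exists>t. ?R\<^sup>*\<^sup>* [x, c] t \<and> ?F t)"
    if xc: "x \<le> Suc (length w)" "c \<le> Suc (length w)" for x c
  proof
    assume "\<exists>t. ?R\<^sup>*\<^sup>* [x, c] t \<and> ?F t"
    then obtain t where t: "?R\<^sup>*\<^sup>* [x, c] t" "?F t" by blast
    then have "length t = 2 \<and> (\<forall>x\<in>set t. x \<le> Suc (length w))"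
      using rtranclp_bounded_rel[of 2 w _ "[x, c]" t] xc by simp
    then obtain x' c' where "t = [x', c']" "x' \<le> Suc (length w)" "c' \<le> Suc (length w)"
      by (auto simp: length_Suc_conv numeral_2_eq_2)
    with t show "le_num w x c" unfolding le_num_def by auto
  qed (fastforce simp: le_num_def)
  have lt: "x \<le> length w" if "input_at w x = In a" for a
    using that by (auto simp: input_at_def split: if_splits)
  have R: "?R [x, c] t \<longleftrightarrow> (input_at w x = In S1 \<and> t = [Suc x, c div 2]) \<or>
      (input_at w x = In S0 \<and> t = [Suc x, Suc c div 2])" for t
  proof -
    have "c div 2 \<le> Suc (length w)" "Suc c div 2 \<le> Suc (length w)" using assms(2) by auto
    then show ?thesis using lt by (auto simp: bounded_rel_def length_Suc_conv numeral_2_eq_2)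
  qed
  have "le_num w x c \<longleftrightarrow> ?F [x, c] \<or> (\<exists>s'. ?R [x, c] s' \<and> (\<exists>t. ?R\<^sup>*\<^sup>* s' t \<and> ?F t))"
    unfolding le[OF assms] by (rule reach_unfold)
  also have "\<dots> \<longleftrightarrow> ?F [x, c] \<or> (input_at w x = In S1 \<and> (\<exists>t. ?R\<^sup>*\<^sup>* [Suc x, c div 2] t \<and> ?F t)) \<or>
      (input_at w x = In S0 \<and> (\<exists>t. ?R\<^sup>*\<^sup>* [Suc x, Suc c div 2] t \<and> ?F t))"
    unfolding R by blast
  also have "(input_at w x = In S1 \<and> (\<exists>t. ?R\<^sup>*\<^sup>* [Suc x, c div 2] t \<and> ?F t)) \<longleftrightarrow>
      (input_at w x = In S1 \<and> le_num w (Suc x) (c div 2))"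
    using le[of "Suc x" "c div 2"] lt assms by auto
  also have "(input_at w x = In S0 \<and> (\<exists>t. ?R\<^sup>*\<^sup>* [Suc x, Suc c div 2] t \<and> ?F t)) \<longleftrightarrow>
      (input_at w x = In S0 \<and> le_num w (Suc x) (Suc c div 2))"
    using le[of "Suc x" "Suc c div 2"] lt assms by auto
  finally show ?thesis by simp
qed

section \<open>Canonical binary numerals and their values\<close>

lemma bits_0: "bits 0 = []"
  by (simp add: bits.simps)

lemma bits_pos: "n \<noteq> 0 \<Longrightarrow> bits n = (if odd n then S1 else S0) # bits (n div 2)"
  by (subst bits.simps) simp

lemma set_bits: "set (bits n) \<subseteq> {S0, S1}"
proof (induction n rule: bits.induct)
  case (1 n)
  then show ?case by (cases "n = 0") (auto simp: bits_0 bits_pos)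
qed

lemma bits_inj: "bits m = bits n \<longleftrightarrow> m = n"
proof
  assume "bits m = bits n"
  then show "m = n"
  proof (induction m arbitrary: n rule: bits.induct)
    case (1 m)
    show ?case
    proof (cases "m = 0 \<or> n = 0")
      case True
      then show ?thesis using "1.prems"
        by (cases "m = 0"; cases "n = 0") (auto simp: bits_0 bits_pos)
    next
      case False
      then have "odd m = odd n" "bits (m div 2) = bits (n div 2)"
        using "1.prems" by (auto simp: bits_pos split: if_splits)
      then have "m div 2 = n div 2" using "1.IH" False by simp
      then show ?thesis using \<open>odd m = odd n\<close> by presburger
    qed
  qed
qed simp

lemma le_num_iff:
  assumes "w = u @ bits v @ SNum # z" "c \<le> Suc (length w)"
  shows "le_num w (Suc (length u)) c \<longleftrightarrow> c \<le> v"
  using assms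
proof (induction v arbitrary: u c rule: bits.induct)
  case (1 v)
  have x: "Suc (length u) \<le> Suc (length w)" using "1.prems"(1) by simp
  show ?case
  proof (cases "v = 0")
    case True
    then have "input_at w (Suc (length u)) = In SNum" using "1.prems"(1) by (auto simp: input_at_In bits_0)
    then show ?thesis unfolding le_num_unfold[OF x "1.prems"(2)] using True by simp
  next
    case False
    let ?b = "if odd v then S1 else S0"
    have w: "w = (u @ [?b]) @ bits (v div 2) @ SNum # z" using "1.prems"(1) False by (simp add: bits_pos)
    then have i: "input_at w (Suc (length u)) = In ?b" by (auto simp: input_at_In)
    have IH: "le_num w (Suc (Suc (length u))) c' \<longleftrightarrow> c' \<le> v div 2" if "c' \<le> Suc (length w)" for c'
      using "1.IH"[OF False w that] by simp
    have "c div 2 \<le> Suc (length w)" "Suc c div 2 \<le> Suc (length w)" using "1.prems"(2) by auto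
    from IH[OF this(1)] IH[OF this(2)] show ?thesis
      unfolding le_num_unfold[OF x "1.prems"(2)] using i False by (auto; presburger)
  qed
qed

lemma range_bits: "range bits = {[]} \<union> conc (kstar {[S0], [S1]}) {[S1]}"
proof -
  have k: "kstar {[S0], [S1]} = {bs. set bs \<subseteq> {S0, S1}}"
  proof (intro set_eqI iffI)
    fix bs assume "bs \<in> kstar {[S0], [S1]}"
    then obtain us where us: "bs = concat us" "set us \<subseteq> {[S0], [S1]}" by (auto simp: kstar_def)
    then have "\<forall>u\<in>set us. set u \<subseteq> {S0, S1}" by auto
    then show "bs \<in> {bs. set bs \<subseteq> {S0, S1}}" using us(1) by auto
  next
    fix bs assume "bs \<in> {bs. set bs \<subseteq> {S0, S1}}"
    then show "bs \<in> kstar {[S0], [S1]}"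
      unfolding kstar_def by (auto intro!: exI[of _ "map (\<lambda>b. [b]) bs"] simp: concat_map_singleton)
  qed
  have 1: "n = 0 \<or> (\<exists>bs. bits n = bs @ [S1] \<and> set bs \<subseteq> {S0, S1})" for n
  proof (induction n rule: bits.induct)
    case (1 n)
    consider "n = 0" | "n = 1" | "n div 2 \<noteq> 0" by linarith
    then show ?case
    proof cases
      case 2
      then show ?thesis by (auto simp: bits_pos bits_0)
    next
      case 3
      then have "n \<noteq> 0" by (cases n) auto
      with 1 3 obtain bs where "bits (n div 2) = bs @ [S1]" "set bs \<subseteq> {S0, S1}" by auto
      then show ?thesis using 3
        by (intro disjI2 exI[of _ "(if odd n then S1 else S0) # bs"]) (auto simp: bits_pos)
    qed simp
  qed
  have 2: "\<exists>n. n \<noteq> 0 \<and> bits n = bs @ [S1]" if "set bs \<subseteq> {S0, S1}" for bs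
    using that
  proof (induction bs)
    case Nil
    then show ?case by (intro exI[of _ 1]) (simp add: bits_pos bits_0)
  next
    case (Cons b bs)
    then obtain n where n: "n \<noteq> 0" "bits n = bs @ [S1]" by auto
    have "bits (2 * n + (if b = S1 then 1 else 0)) = b # bits n"
      using n(1) Cons.prems by (subst bits_pos) auto
    then show ?case using n by (intro exI[of _ "2 * n + (if b = S1 then 1 else 0)"]) auto
  qed
  show ?thesis
  proof (intro set_eqI iffI)
    fix v assume "v \<in> range bits"
    then obtain n where "v = bits n" by blast
    with 1[of n] show "v \<in> {[]} \<union> conc (kstar {[S0], [S1]}) {[S1]}"
      unfolding k conc_def by (auto simp: bits_0)
  next
    fix v assume "v \<in> {[]} \<union> conc (kstar {[S0], [S1]}) {[S1]}"
    then show "v \<in> range bits"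
      using 2 bits_0 unfolding k conc_def by (auto simp: image_iff) (metis, metis)
  qed
qed

section \<open>The word behind \<open>p\<close> as a list of items, bins and separators\<close>

definition enc_item :: "bin option \<Rightarrow> sym list" where
  "enc_item it = (case it of None \<Rightarrow> [SSeq] | Some b \<Rightarrow> enc_bin b)"

definition enc_items :: "bin option list \<Rightarrow> sym list" where
  "enc_items its = concat (map enc_item its)"

lemma enc_items_simps [simp]: "enc_items [] = []" "enc_items (it # its) = enc_item it @ enc_items its"
  "enc_items (its @ its') = enc_items its @ enc_items its'"
  by (simp_all add: enc_items_def)

lemma regular_num: "regular (range enc_num)"
proof -
  have "range enc_num = conc (range bits) {[SNum]}"
    by (auto simp: conc_def enc_num_def image_iff)
  moreover have "{[S0], [S1]} = {[S0]} \<union> {[S1]}" by blast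
  ultimately show ?thesis unfolding range_bits
    by (metis regular_Un regular_Nil regular_conc regular_kstar regular_single)
qed

lemma enc_items_bin: "enc_items ` range (\<lambda>b. [Some b]) = conc (range enc_num) (range enc_num)"
proof -
  have "enc_items ` range (\<lambda>b. [Some b]) = {enc_num m @ enc_num n | m n. True}"
    by (auto simp: image_iff enc_item_def enc_bin_def) blast+
  then show ?thesis unfolding conc_def by blast
qed

text \<open>The encoding \<open>enc_items\<close> is a homomorphism from lists of items to words and
  so commutes with star and concatenation. Regular sets of words can thus be described at the level
  of items.\<close>

lemma kstar_enc_items: "kstar (enc_items ` (\<lambda>it. [it]) ` X) = enc_items ` {its. set its \<subseteq> X}"
proof (intro set_eqI iffI)
  fix v assume "v \<in> kstar (enc_items ` (\<lambda>it. [it]) ` X)"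
  then obtain us where "v = concat us" "set us \<subseteq> enc_item ` X"
    by (auto simp: kstar_def image_image)
  \<comment> \<open>Each block is the code of some item of \<open>X\<close>, and a preimage is
    chosen for each.\<close>
  define its where "its = map (inv_into X enc_item) us"
  have "us = map enc_item its" "set its \<subseteq> X"
    using \<open>set us \<subseteq> enc_item ` X\<close> unfolding its_def
    by (auto simp: map_idI f_inv_into_f subset_iff inv_into_into intro!: map_idI[symmetric])
  with \<open>v = concat us\<close> show "v \<in> enc_items ` {its. set its \<subseteq> X}" by (auto simp: enc_items_def)
next
  fix v assume "v \<in> enc_items ` {its. set its \<subseteq> X}"
  then obtain its where "v = concat (map enc_item its)" "set its \<subseteq> X" by (auto simp: enc_items_def)
  then show "v \<in> kstar (enc_items ` (\<lambda>it. [it]) ` X)"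
    unfolding kstar_def image_image by (intro CollectI exI[of _ "map enc_item its"]) auto
qed

lemma conc_enc_items: "conc (enc_items ` X) (enc_items ` Y) = enc_items ` conc X Y"
  unfolding conc_def by (auto simp: image_iff) (metis enc_items_simps(3))+

lemma regular_bin: "regular (enc_items ` range (\<lambda>b. [Some b]))"
  unfolding enc_items_bin by (intro regular_conc regular_num)

lemma regular_sep: "regular (enc_items ` {[None]})"
  using regular_single[of SSeq] by (simp add: enc_item_def)

lemma regular_bins: "regular (enc_items ` range (map Some))"
proof -
  have e: "range (map Some) = {its. set its \<subseteq> range Some}"
    using ex_map_conv[of _ Some] by (auto simp: image_iff subset_iff)
  have "(\<lambda>it. [it]) ` range Some = range (\<lambda>b. [Some b])" by (simp add: image_image)
  then show ?thesis
    unfolding e using regular_kstar[OF regular_bin] kstar_enc_items[of "range Some"] by metis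
qed

lemma regular_bins1: "regular (enc_items ` conc (range (\<lambda>b. [Some b])) (range (map Some)))"
  unfolding conc_enc_items[symmetric] by (intro regular_conc regular_bin regular_bins)

lemma regular_seq: "regular (enc_items ` conc (range (map Some)) {[None]})"
  unfolding conc_enc_items[symmetric] by (intro regular_conc regular_sep regular_bins)

lemma regular_items: "regular (enc_items ` UNIV)"
proof -
  have "enc_items ` (\<lambda>it. [it]) ` UNIV = enc_items ` range (\<lambda>b. [Some b]) \<union> enc_items ` {[None]}"
    unfolding UNIV_option_conv image_Un[symmetric] by (simp add: image_image)
  then have "enc_items ` UNIV = kstar (enc_items ` range (\<lambda>b. [Some b]) \<union> enc_items ` {[None]})"
    using kstar_enc_items[of UNIV] by simp
  then show ?thesis using regular_kstar[OF regular_Un[OF regular_bin regular_sep]] by simp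
qed

text \<open>Bits never contain \<open>SNum\<close>, so its first occurrence ends the
  numeral.\<close>

lemma enc_num_prefix_free: "enc_num m @ z = enc_num n @ z' \<longleftrightarrow> m = n \<and> z = z'"
proof
  assume eq: "enc_num m @ z = enc_num n @ z'"
  have tw: "takeWhile (\<lambda>a. a \<noteq> SNum) (enc_num m @ z) = bits m" for m and z
  proof -
    have "\<forall>a\<in>set (bits m). a \<noteq> SNum" using set_bits[of m] by auto
    then show ?thesis by (simp add: enc_num_def takeWhile_append)
  qed
  have "bits m = bits n" using arg_cong[OF eq, of "takeWhile (\<lambda>a. a \<noteq> SNum)"] unfolding tw .
  with eq show "m = n \<and> z = z'" by (simp add: bits_inj)
qed simp

lemma hd_enc_num: "enc_num n \<noteq> [] \<and> hd (enc_num n) \<noteq> SSeq"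
  using set_bits[of n] by (cases "bits n") (auto simp: enc_num_def)

text \<open>The first symbol tells a separator from a bin, and a bin consists of two numerals from a
  prefix code.\<close>

lemma enc_item_prefix_free: "enc_item a @ z = enc_item b @ z' \<longleftrightarrow> a = b \<and> z = z'"
proof
  assume eq: "enc_item a @ z = enc_item b @ z'"
  have h: "enc_bin x @ u \<noteq> SSeq # u'" for x u u'
    using hd_enc_num[of "fst x"] by (cases "enc_num (fst x)") (auto simp: enc_bin_def)
  have 1: "a = b" if "a = None \<or> b = None"
    using that eq h h[symmetric] by (cases a; cases b) (simp_all add: enc_item_def)
  have 2: "a = b" if "a = Some x" "b = Some y" for x y
  proof -
    have "enc_num (fst x) @ enc_num (snd x) @ z = enc_num (fst y) @ enc_num (snd y) @ z'"
      using eq unfolding that by (simp add: enc_item_def enc_bin_def)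
    then have "fst x = fst y" "snd x = snd y" unfolding enc_num_prefix_free by blast+
    then show ?thesis using that by (simp add: prod_eqI)
  qed
  have "a = b"
  proof (cases "a = None \<or> b = None")
    case False
    then obtain x y where "a = Some x" "b = Some y" unfolding de_Morgan_disj not_None_eq by blast
    then show ?thesis by (rule 2)
  qed (rule 1)
  with eq show "a = b \<and> z = z'" by simp
qed simp

lemma enc_item_not_Nil: "enc_item a \<noteq> []"
  using hd_enc_num by (auto simp: enc_item_def enc_bin_def split: option.splits)

lemma enc_items_parse: "enc_items xs @ z = enc_items ys \<Longrightarrow> \<exists>zs. ys = xs @ zs \<and> z = enc_items zs"
proof (induction xs arbitrary: ys)
  case (Cons x xs)
  show ?case
  proof (cases ys)
    case Nil
    then show ?thesis using Cons.prems enc_item_not_Nil[of x] by simp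
  next
    case c: (Cons y ys')
    then have "x = y" "enc_items xs @ z = enc_items ys'" using Cons.prems by (auto simp: enc_item_prefix_free)
    moreover from this(2) obtain zs where "ys' = xs @ zs" "z = enc_items zs" using Cons.IH by blast
    ultimately show ?thesis using c by simp
  qed
qed simp

definition ipos :: "nat \<Rightarrow> bin option list \<Rightarrow> nat \<Rightarrow> nat" where
  "ipos p its n = Suc (length (enc_num p @ enc_items (take n its)))"

lemma length_enc_items: "length its \<le> length (enc_items its)"
proof (induction its)
  case (Cons a its)
  have "length (enc_item a) > 0" using enc_item_not_Nil[of a] by simp
  then have "1 \<le> length (enc_item a)" by linarith
  with Cons show ?case by simp
qed simp

lemma ipos_less: "m < n \<Longrightarrow> n \<le> length its \<Longrightarrow> ipos p its m < ipos p its n"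
proof -
  assume mn: "m < n" "n \<le> length its"
  then have "take n its = take m its @ take (n - m) (drop m its)"
    by (metis le_add_diff_inverse less_imp_le_nat take_add)
  moreover have "length (take (n - m) (drop m its)) > 0" using mn by simp
  then have "length (enc_items (take (n - m) (drop m its))) > 0"
    using length_enc_items[of "take (n - m) (drop m its)"] by linarith
  ultimately show ?thesis unfolding ipos_def by simp
qed

lemma ipos_eq: "m \<le> length its \<Longrightarrow> n \<le> length its \<Longrightarrow> ipos p its m = ipos p its n \<longleftrightarrow> m = n"
  using ipos_less[of m n its p] ipos_less[of n m its p] by (metis less_irrefl nat_neq_iff)

lemma ipos_le: "ipos p its n \<le> Suc (length (enc_num p @ enc_items its))"
proof -
  have "enc_items its = enc_items (take n its) @ enc_items (drop n its)"
    by (metis append_take_drop_id enc_items_simps(3))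
  then show ?thesis by (simp add: ipos_def)
qed

text \<open>By unique parsing, a factor that starts at an item boundary and encodes items also ends
  at one. From here on, positions in the word can be replaced by indices into the item list.\<close>

lemma factor_items:
  assumes w: "w = enc_num p @ enc_items its" and n: "n \<le> length its"
  shows "factor w (ipos p its n) y (enc_items ` X) \<longleftrightarrow>
    (\<exists>m. n \<le> m \<and> m \<le> length its \<and> y = ipos p its m \<and> take (m - n) (drop n its) \<in> X)"
proof
  assume "factor w (ipos p its n) y (enc_items ` X)"
  then obtain u xs z where *: "w = u @ enc_items xs @ z" "xs \<in> X" "ipos p its n = Suc (length u)"
    "y = ipos p its n + length (enc_items xs)" by (auto simp: factor_def)
  have w2: "w = (enc_num p @ enc_items (take n its)) @ enc_items (drop n its)"
    unfolding w by (metis append.assoc append_take_drop_id enc_items_simps(3))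
  have "length u = length (enc_num p @ enc_items (take n its))" using *(3) by (simp add: ipos_def)
  with w2 *(1) have "enc_items xs @ z = enc_items (drop n its)" using append_eq_append_conv by metis
  then obtain zs where zs: "drop n its = xs @ zs" using enc_items_parse by blast
  have l: "n + length xs \<le> length its" using arg_cong[OF zs, of length] n by simp
  have "take (n + length xs) its = take n its @ xs" using zs by (simp add: take_add)
  then have "y = ipos p its (n + length xs)" using *(4) by (simp add: ipos_def)
  then show "\<exists>m. n \<le> m \<and> m \<le> length its \<and> y = ipos p its m \<and> take (m - n) (drop n its) \<in> X"
    using l zs *(2) by (intro exI[of _ "n + length xs"]) simp
next
  assume "\<exists>m. n \<le> m \<and> m \<le> length its \<and> y = ipos p its m \<and> take (m - n) (drop n its) \<in> X"
  then obtain m where m: "n \<le> m" "m \<le> length its" "y = ipos p its m" "take (m - n) (drop n its) \<in> X"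
    by blast
  have "take m its = take n its @ take (m - n) (drop n its)"
    using m(1) by (metis le_add_diff_inverse take_add)
  moreover have "its = take n its @ take (m - n) (drop n its) @ drop m its"
    using calculation by (metis append.assoc append_take_drop_id)
  then have "w = (enc_num p @ enc_items (take n its)) @ enc_items (take (m - n) (drop n its)) @ enc_items (drop m its)"
    unfolding w by (metis append.assoc enc_items_simps(3))
  ultimately show "factor w (ipos p its n) y (enc_items ` X)" unfolding factor_def using m(3,4)
    by (intro exI[of _ "enc_num p @ enc_items (take n its)"] exI[of _ "enc_items (take (m - n) (drop n its))"]
      exI[of _ "enc_items (drop m its)"]) (simp add: ipos_def)
qed

lemma factor_num:
  assumes "w = u @ enc_num v @ z"
  shows "factor w (Suc (length u)) y (range enc_num) \<longleftrightarrow> y = Suc (length (u @ enc_num v))"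
proof
  assume "factor w (Suc (length u)) y (range enc_num)"
  then obtain u' v' z' where *: "w = u' @ enc_num v' @ z'" "length u' = length u"
    "y = Suc (length u) + length (enc_num v')" by (auto simp: factor_def)
  then have "enc_num v' @ z' = enc_num v @ z" using assms append_eq_append_conv by metis
  then show "y = Suc (length (u @ enc_num v))" using * by (simp add: enc_num_prefix_free)
next
  assume "y = Suc (length (u @ enc_num v))"
  then show "factor w (Suc (length u)) y (range enc_num)" unfolding factor_def
    using assms by (intro exI[of _ u] exI[of _ "enc_num v"] exI[of _ z]) simp
qed

section \<open>A definable description of the language\<close>

abbreviation "num_lang \<equiv> range enc_num"
abbreviation "bin_lang \<equiv> enc_items ` range (\<lambda>b. [Some b])"
abbreviation "sep_lang \<equiv> enc_items ` {[None]}"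
abbreviation "bins1_lang \<equiv> enc_items ` conc (range (\<lambda>b. [Some b])) (range (map Some))"
abbreviation "seq_lang \<equiv> enc_items ` conc (range (map Some)) {[None]}"
abbreviation "items_lang \<equiv> enc_items ` (UNIV :: bin option list set)"

text \<open>A bin at \<open>x\<close> is two numerals, identifier and pallet symbol. Skipping one
  numeral leads to the pallet symbol at \<open>x'\<close>.\<close>

definition same_plt :: "sym list \<Rightarrow> nat \<Rightarrow> nat \<Rightarrow> bool" where
  "same_plt w x y \<longleftrightarrow> (\<exists>x'\<le>Suc (length w). \<exists>y'\<le>Suc (length w).
     factor w x x' num_lang \<and> factor w y y' num_lang \<and> same_num w x' y')"

definition diff_plt :: "sym list \<Rightarrow> nat \<Rightarrow> nat \<Rightarrow> bool" where
  "diff_plt w x y \<longleftrightarrow> (\<exists>x'\<le>Suc (length w). \<exists>y'\<le>Suc (length w).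
     factor w x x' num_lang \<and> factor w y y' num_lang \<and> diff_num w x' y')"

definition diff_bin :: "sym list \<Rightarrow> nat \<Rightarrow> nat \<Rightarrow> bool" where
  "diff_bin w x y \<longleftrightarrow> diff_num w x y \<or> diff_plt w x y"

text \<open>The numeral of 0 has no bits, so a number is positive iff its numeral does not begin
  with \<open>SNum\<close>.\<close>

definition pos_plt :: "sym list \<Rightarrow> nat \<Rightarrow> bool" where
  "pos_plt w x \<longleftrightarrow> (\<exists>x'\<le>Suc (length w). factor w x x' num_lang \<and> input_at w x' \<in> {In S0, In S1})"

text \<open>Quantification over all bins is expressed by reachability: one walks along the word from
item to item and checks each bin on the way.\<close>
definition all_bins :: "sym list \<Rightarrow> nat \<Rightarrow> (nat \<Rightarrow> bool) \<Rightarrow> bool" where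
  "all_bins w x G \<longleftrightarrow> (\<exists>y\<le>Suc (length w). y = Suc (length w) \<and>
     (bounded_rel 1 w (\<lambda>s s'. factor w (s ! 0) (s' ! 0) sep_lang \<or>
       (factor w (s ! 0) (s' ! 0) bin_lang \<and> G (s ! 0))))\<^sup>*\<^sup>* [x] [y])"

text \<open>Distinctness is stated by position: different positions carry different bins. The second
  bin for the pallet is also only required to stand elsewhere, which together with distinctness
  makes it a different bin.\<close>

definition valid_at :: "sym list \<Rightarrow> nat \<Rightarrow> bool" where
  "valid_at w a \<longleftrightarrow> all_bins w a (\<lambda>x. pos_plt w x \<and> all_bins w a (\<lambda>y. x = y \<or> diff_bin w x y) \<and>
     (\<exists>y\<le>Suc (length w). \<exists>y'\<le>Suc (length w).
       factor w a y items_lang \<and> factor w y y' bin_lang \<and> y \<noteq> x \<and> same_plt w x y))"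

text \<open>Doubles as the syntax check. The guessed positions must cut the word into a numeral and
  \<open>k\<close> complete sequences, the last one ending at the end of the word; a leading bit
  expresses that \<open>p\<close> is positive.\<close>

definition starts_at :: "nat \<Rightarrow> sym list \<Rightarrow> (nat \<Rightarrow> nat) \<Rightarrow> bool" where
  "starts_at k w f \<longleftrightarrow> (\<exists>x\<le>Suc (length w). x = Suc 0 \<and> factor w x (f 0) num_lang \<and>
      input_at w x \<in> {In S0, In S1}) \<and>
     (\<forall>j<k - 1. factor w (f j) (f (Suc j)) seq_lang) \<and>
     (\<exists>y\<le>Suc (length w). y = Suc (length w) \<and> factor w (f (k - 1)) y seq_lang)"

text \<open>A bin at \<open>x\<close> is gone iff the current position of some sequence is reached
  from \<open>x\<close> by passing at least one bin and no separator. A plain comparison of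
  positions would not reveal to which sequence the bin belongs.\<close>

definition plt_removed :: "nat \<Rightarrow> sym list \<Rightarrow> nat \<Rightarrow> (nat \<Rightarrow> nat) \<Rightarrow> nat \<Rightarrow> bool" where
  "plt_removed k w a f y \<longleftrightarrow> (\<exists>x\<le>Suc (length w). factor w a x items_lang \<and>
     (\<exists>i<k. factor w x (f i) bins1_lang) \<and> same_plt w x y)"

text \<open>Positive form of the statement that no bin of the pallet is left.\<close>

definition plt_exhausted :: "nat \<Rightarrow> sym list \<Rightarrow> nat \<Rightarrow> (nat \<Rightarrow> nat) \<Rightarrow> nat \<Rightarrow> bool" where
  "plt_exhausted k w a f y \<longleftrightarrow>
     all_bins w a (\<lambda>x. (\<exists>i<k. factor w x (f i) bins1_lang) \<or> diff_plt w x y)"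

text \<open>The entries \<open>f j\<close> with \<open>j < k\<close> are the positions in \<open>w\<close> of the remaining sequences, and
\<open>f k\<close> is an upper bound on the number of open pallets: incrementing it is always allowed.\<close>
definition moves :: "nat \<Rightarrow> sym list \<Rightarrow> nat \<Rightarrow> (nat \<Rightarrow> nat) \<Rightarrow> (nat \<Rightarrow> nat) \<Rightarrow> bool" where
  "moves k w a f f' \<longleftrightarrow> (\<exists>x\<le>Suc (length w). x = Suc 0 \<and> le_num w x (f' k)) \<and>
     (\<exists>j<k. factor w (f j) (f' j) bin_lang \<and> (\<forall>i<k. i = j \<or> f' i = f i) \<and>
       (f' k = Suc (f k) \<or> (plt_removed k w a f (f j) \<and>
         (f' k = f k \<or> (f k = Suc (f' k) \<and> plt_exhausted k w a f' (f j))))))"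

text \<open>The start \<open>s ! 0\<close> of the first sequence is at the same time the start of
  the item list and serves as the parameter \<open>a\<close> of the other predicates. A sequence is
  used up when its position has arrived at its separator.\<close>

definition accepts_word :: "nat \<Rightarrow> sym list \<Rightarrow> bool" where
  "accepts_word k w \<longleftrightarrow> (\<exists>s. length s = Suc k \<and> (\<forall>x\<in>set s. x \<le> Suc (length w)) \<and>
     s ! k = 0 \<and> starts_at k w ((!) s) \<and> valid_at w (s ! 0) \<and>
     (\<exists>t. length t = Suc k \<and> (\<forall>x\<in>set t. x \<le> Suc (length w)) \<and>
       (bounded_rel (Suc k) w (\<lambda>u u'. moves k w (s ! 0) ((!) u) ((!) u')))\<^sup>*\<^sup>* s t \<and>
       (\<forall>j<k. input_at w (t ! j) \<in> {In SSeq})))"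

section \<open>Definability of the acceptance condition\<close>

lemma definable_const: "definable k (\<lambda>w e. c)"
  by (cases c) (simp_all add: definable_True definable_False)

lemma definable_same_plt: "x < k \<Longrightarrow> y < k \<Longrightarrow> definable k (\<lambda>w e. same_plt w (e x) (e y))"
  unfolding same_plt_def
  by (intro definable_ex definable_conj definable_factor definable_same_num regular_num) auto

lemma definable_diff_plt: "x < k \<Longrightarrow> y < k \<Longrightarrow> definable k (\<lambda>w e. diff_plt w (e x) (e y))"
  unfolding diff_plt_def
  by (intro definable_ex definable_conj definable_factor definable_diff_num regular_num) auto

lemma definable_diff_bin: "x < k \<Longrightarrow> y < k \<Longrightarrow> definable k (\<lambda>w e. diff_bin w (e x) (e y))"
  unfolding diff_bin_def by (intro definable_disj definable_diff_num definable_diff_plt)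

lemma definable_pos_plt: "x < k \<Longrightarrow> definable k (\<lambda>w e. pos_plt w (e x))"
  unfolding pos_plt_def
  by (intro definable_ex definable_conj definable_factor definable_input regular_num) auto

text \<open>The walk adds registers of its own behind the arguments, and \<open>G\<close> is
  evaluated on one of these. Therefore \<open>G\<close> has to be definable for every larger number
  of arguments, which also permits nested walks.\<close>

lemma definable_all_bins:
  assumes G: "\<And>k' y. k \<le> k' \<Longrightarrow> y < k' \<Longrightarrow> definable k' (\<lambda>w e. G w e (e y))"
    and loc: "\<And>w e e' v. (\<And>j. j < k \<Longrightarrow> e j = e' j) \<Longrightarrow> G w e v = G w e' v"
    and x: "x < k"
  shows "definable k (\<lambda>w e. all_bins w (e x) (G w e))"
proof -
  have G_eq: "G w e = G w e'" if "\<And>j. j < k \<Longrightarrow> e j = e' j" for w e e'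
    using loc[OF that] by (simp add: fun_eq_iff)
  show ?thesis unfolding all_bins_def
  proof (rule definable_ex, rule definable_conj)
    show "definable (Suc k) (\<lambda>w e. e k = Suc (length w))" by (rule definable_last) simp
    show "definable (Suc k) (\<lambda>w e. (bounded_rel 1 w (\<lambda>s s'. factor w (s ! 0) (s' ! 0) sep_lang \<or>
       (factor w (s ! 0) (s' ! 0) bin_lang \<and> G w e (s ! 0))))\<^sup>*\<^sup>* [e x] [e k])"
    proof (rule definable_TC1)
      show "definable (Suc k + 2) (\<lambda>w e. factor w (e (Suc k)) (e (Suc (Suc k))) sep_lang \<or>
         (factor w (e (Suc k)) (e (Suc (Suc k))) bin_lang \<and> G w e (e (Suc k))))"
        by (intro definable_disj definable_conj definable_factor regular_sep regular_bin G) auto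
      show "(factor w x x' sep_lang \<or> (factor w x x' bin_lang \<and> G w e x)) =
          (factor w x x' sep_lang \<or> (factor w x x' bin_lang \<and> G w e' x))"
        if "\<And>j. j < Suc k \<Longrightarrow> e j = e' j" for w and e e' :: "nat \<Rightarrow> nat" and x x'
        using G_eq[of e e' w] that by simp
    qed (use x in auto)
    fix w v and e e' :: "nat \<Rightarrow> nat"
    assume e: "\<And>j. j < k \<Longrightarrow> e j = e' j"
    have "G w e = G w e'" "e x = e' x" using G_eq e x by blast+
    then show "(v = Suc (length w) \<and> (bounded_rel 1 w (\<lambda>s s'. factor w (s ! 0) (s' ! 0) sep_lang \<or>
       (factor w (s ! 0) (s' ! 0) bin_lang \<and> G w e (s ! 0))))\<^sup>*\<^sup>* [e x] [v]) =
      (v = Suc (length w) \<and> (bounded_rel 1 w (\<lambda>s s'. factor w (s ! 0) (s' ! 0) sep_lang \<or>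
       (factor w (s ! 0) (s' ! 0) bin_lang \<and> G w e' (s ! 0))))\<^sup>*\<^sup>* [e' x] [v])" by simp
  qed
qed

lemma definable_valid_at:
  assumes "x < k"
  shows "definable k (\<lambda>w e. valid_at w (e x))"
  unfolding valid_at_def
proof (rule definable_all_bins)
  fix k' y assume "k \<le> k'" "y < k'"
  with assms show "definable k' (\<lambda>w e. pos_plt w (e y) \<and>
      all_bins w (e x) (\<lambda>z. e y = z \<or> diff_bin w (e y) z) \<and>
     (\<exists>z\<le>Suc (length w). \<exists>y'\<le>Suc (length w).
       factor w (e x) z items_lang \<and> factor w z y' bin_lang \<and> z \<noteq> e y \<and> same_plt w (e y) z))"
    by (intro definable_conj definable_pos_plt definable_all_bins definable_disj definable_eq
      definable_diff_bin definable_ex definable_factor regular_items regular_bin definable_neq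
      definable_same_plt) auto
qed (use assms in auto)

lemma definable_starts_at:
  assumes "0 < k" "k \<le> m"
  shows "definable m (\<lambda>w e. starts_at k w e)"
  unfolding starts_at_def using assms
  by (intro definable_conj definable_ex definable_ball definable_factor regular_num regular_seq
    definable_input definable_1 definable_last) auto

lemma definable_plt_removed:
  assumes "x < m" "y < m" "b + k \<le> m"
  shows "definable m (\<lambda>w e. plt_removed k w (e x) (\<lambda>j. e (b + j)) (e y))"
  unfolding plt_removed_def using assms
  by (intro definable_conj definable_ex definable_bex definable_factor regular_items regular_bins1
    definable_same_plt) auto

lemma definable_plt_exhausted:
  assumes "x < m" "y < m" "b + k \<le> m"
  shows "definable m (\<lambda>w e. plt_exhausted k w (e x) (\<lambda>j. e (b + j)) (e y))"
  unfolding plt_exhausted_def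
proof (rule definable_all_bins)
  fix k' z assume "m \<le> k'" "z < k'"
  then show "definable k' (\<lambda>w e. (\<exists>i<k. factor w (e z) (e (b + i)) bins1_lang) \<or> diff_plt w (e z) (e y))"
    using assms by (intro definable_disj definable_bex definable_factor regular_bins1 definable_diff_plt) auto
next
  fix w v and e e' :: "nat \<Rightarrow> nat"
  assume "\<And>j. j < m \<Longrightarrow> e j = e' j"
  then show "((\<exists>i<k. factor w v (e (b + i)) bins1_lang) \<or> diff_plt w v (e y)) =
    ((\<exists>i<k. factor w v (e' (b + i)) bins1_lang) \<or> diff_plt w v (e' y))"
    using assms by (auto cong: conj_cong)
qed (use assms in auto)

lemma definable_moves:
  assumes "x < m" "b + Suc k \<le> m" "c + Suc k \<le> m"
  shows "definable m (\<lambda>w e. moves k w (e x) (\<lambda>j. e (b + j)) (\<lambda>j. e (c + j)))"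
  unfolding moves_def using assms
  by (intro definable_conj definable_ex definable_bex definable_ball definable_disj definable_const
    definable_1 definable_le_num definable_eq definable_Suc definable_factor regular_bin
    definable_plt_removed definable_plt_exhausted) auto

lemma starts_at_cong:
  assumes "0 < k" "\<And>j. j < k \<Longrightarrow> f j = g j"
  shows "starts_at k w f = starts_at k w g"
proof -
  have "f 0 = g 0" "f (k - 1) = g (k - 1)" "\<forall>j<k - 1. f j = g j \<and> f (Suc j) = g (Suc j)"
    using assms by auto
  then show ?thesis unfolding starts_at_def by simp
qed

lemma moves_cong:
  assumes "\<And>j. j \<le> k \<Longrightarrow> f j = g j" "\<And>j. j \<le> k \<Longrightarrow> f' j = g' j"
  shows "moves k w a f f' = moves k w a g g'"
proof -
  have f: "f k = g k" "f' k = g' k" "\<forall>j<k. f j = g j" "\<forall>j<k. f' j = g' j" using assms by auto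
  then have 1: "plt_removed k w a f = plt_removed k w a g" "plt_exhausted k w a f' = plt_exhausted k w a g'"
    by (simp_all add: plt_removed_def plt_exhausted_def fun_eq_iff cong: conj_cong)
  show ?thesis unfolding moves_def 1 using f by (simp cong: conj_cong)
qed

lemma definable_accepts_word:
  assumes k: "0 < k"
  shows "definable 0 (\<lambda>w e. accepts_word k w)"
  unfolding accepts_word_def
proof (rule definable_exs)
  let ?n = "Suc k"
  have nth: "map e [b..<b + ?n] ! j = e (b + j)" if "j \<le> k" for e :: "nat \<Rightarrow> nat" and b j
    using that by (simp del: upt_Suc)
  have nth0: "map e [0..<?n] ! j = e j" if "j \<le> k" for e :: "nat \<Rightarrow> nat" and j
    using nth[OF that, of e 0] by simp
  have st: "starts_at k w ((!) (map e [0..<?n])) = starts_at k w e" for w and e :: "nat \<Rightarrow> nat"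
    using nth0 by (intro starts_at_cong k) simp
  have mv: "moves k w a ((!) (map e [b..<b + ?n])) ((!) (map e [c..<c + ?n])) =
      moves k w a (\<lambda>j. e (b + j)) (\<lambda>j. e (c + j))" for w a b c and e :: "nat \<Rightarrow> nat"
    by (rule moves_cong) (rule nth, assumption)+
  have TC: "definable (?n + ?n) (\<lambda>w e. (bounded_rel ?n w (\<lambda>u u'. moves k w (e 0) ((!) u) ((!) u')))\<^sup>*\<^sup>*
      (map e [0..<?n]) (map e [?n..<?n + ?n]))"
  proof (rule definable_TC)
    \<comment> \<open>Four blocks of \<open>k + 1\<close> registers: the start \<open>s\<close>, the
      goal \<open>t\<close>, and the current and the next tuple of the search.\<close>
    show "definable (?n + ?n + ?n + ?n) (\<lambda>w e. moves k w (e 0) ((!) (map e [?n + ?n..<?n + ?n + ?n]))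
        ((!) (map e [?n + ?n + ?n..<?n + ?n + ?n + ?n])))"
      unfolding mv by (intro definable_moves) auto
    show "moves k w (e 0) ((!) s) ((!) s') = moves k w (e' 0) ((!) s) ((!) s')"
      if "\<And>j. j < ?n + ?n \<Longrightarrow> e j = e' j" for w and e e' :: "nat \<Rightarrow> nat" and s s'
      using that[of 0] by simp
  qed auto
  have ex: "definable ?n (\<lambda>w e. \<exists>t. length t = ?n \<and> (\<forall>x\<in>set t. x \<le> Suc (length w)) \<and>
       ((bounded_rel ?n w (\<lambda>u u'. moves k w (e 0) ((!) u) ((!) u')))\<^sup>*\<^sup>* (map e [0..<?n]) t \<and>
       (\<forall>j<k. input_at w (t ! j) \<in> {In SSeq})))"
  proof (rule definable_exs, rule definable_conj)
    have "definable (?n + ?n) (\<lambda>w e. \<forall>j<k. input_at w (e (?n + j)) \<in> {In SSeq})"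
      by (intro definable_ball definable_input) auto
    then show "definable (?n + ?n) (\<lambda>w e. \<forall>j<k. input_at w (map e [?n..<?n + ?n] ! j) \<in> {In SSeq})"
      by (simp del: upt_Suc)
  next
    fix w s and e e' :: "nat \<Rightarrow> nat"
    assume e: "\<And>j. j < ?n \<Longrightarrow> e j = e' j"
    have "map e [0..<?n] = map e' [0..<?n]" "e 0 = e' 0" using e by auto
    then show "((bounded_rel ?n w (\<lambda>u u'. moves k w (e 0) ((!) u) ((!) u')))\<^sup>*\<^sup>* (map e [0..<?n]) s \<and>
        (\<forall>j<k. input_at w (s ! j) \<in> {In SSeq})) =
      ((bounded_rel ?n w (\<lambda>u u'. moves k w (e' 0) ((!) u) ((!) u')))\<^sup>*\<^sup>* (map e' [0..<?n]) s \<and>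
        (\<forall>j<k. input_at w (s ! j) \<in> {In SSeq}))" by (simp only:)
  qed (rule TC)
  show "definable (0 + ?n) (\<lambda>w e. map e [0..<0 + ?n] ! k = 0 \<and>
      starts_at k w ((!) (map e [0..<0 + ?n])) \<and> valid_at w (map e [0..<0 + ?n] ! 0) \<and>
     (\<exists>t. length t = ?n \<and> (\<forall>x\<in>set t. x \<le> Suc (length w)) \<and>
       (bounded_rel ?n w (\<lambda>u u'. moves k w (map e [0..<0 + ?n] ! 0) ((!) u) ((!) u')))\<^sup>*\<^sup>* (map e [0..<0 + ?n]) t \<and>
       (\<forall>j<k. input_at w (t ! j) \<in> {In SSeq})))"
    unfolding add_0 st nth0[OF order.refl] nth0[OF le0]
    using k by (intro definable_conj definable_0 definable_starts_at definable_valid_at ex) auto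
qed simp

section \<open>Meaning of the predicates on an encoded list of items\<close>

lemma rtranclp_first_step: "R\<^sup>*\<^sup>* x y \<longleftrightarrow> x = y \<or> (\<exists>z. R x z \<and> R\<^sup>*\<^sup>* z y)"
  by (auto elim: converse_rtranclpE intro: converse_rtranclp_into_rtranclp)

lemma take_drop_single:
  assumes "n \<le> m" "m \<le> length its"
  shows "take (m - n) (drop n its) = [a] \<longleftrightarrow> m = Suc n \<and> its ! n = a"
proof
  assume eq: "take (m - n) (drop n its) = [a]"
  have "m - n = 1" using arg_cong[OF eq, of length] assms by simp
  moreover have "take (m - n) (drop n its) ! 0 = a" using eq by simp
  ultimately show "m = Suc n \<and> its ! n = a" using assms by auto
next
  assume "m = Suc n \<and> its ! n = a"
  then show "take (m - n) (drop n its) = [a]" using assms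
    by (auto simp: take_Suc_conv_app_nth Cons_nth_drop_Suc[symmetric])
qed

lemma bins1_iff: "its \<in> conc (range (\<lambda>b. [Some b])) (range (map Some)) \<longleftrightarrow> its \<noteq> [] \<and> None \<notin> set its"
proof
  assume "its \<noteq> [] \<and> None \<notin> set its"
  then obtain b r where its: "its = Some b # r" "None \<notin> set r" by (cases its) (auto, metis not_None_eq)
  have "r = map Some (map the r)" using its(2) by (induction r) auto
  then show "its \<in> conc (range (\<lambda>b. [Some b])) (range (map Some))"
    unfolding conc_def its(1) by (metis (mono_tags, lifting) append_Cons append_Nil mem_Collect_eq rangeI)
qed (auto simp: conc_def)

context
  fixes w p its
  assumes w: "w = enc_num p @ enc_items its"
begin

abbreviation "ip \<equiv> ipos p its"

lemma ip_last: "ip (length its) = Suc (length w)"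
  by (simp add: ipos_def w)

lemma factor_one:
  assumes n: "n \<le> length its"
  shows "factor w (ip n) y (enc_items ` (\<lambda>a. [a]) ` A) \<longleftrightarrow> n < length its \<and> y = ip (Suc n) \<and> its ! n \<in> A"
proof -
  have "take (m - n) (drop n its) \<in> (\<lambda>a. [a]) ` A \<longleftrightarrow> m = Suc n \<and> its ! n \<in> A"
    if "n \<le> m" "m \<le> length its" for m
    using take_drop_single[OF that] by (auto simp: image_iff)
  then have "factor w (ip n) y (enc_items ` (\<lambda>a. [a]) ` A) \<longleftrightarrow>
      (\<exists>m. n \<le> m \<and> m \<le> length its \<and> y = ip m \<and> m = Suc n \<and> its ! n \<in> A)"
    unfolding factor_items[OF w n] by blast
  then show ?thesis by auto
qed

lemma factor_sep: "n \<le> length its \<Longrightarrow>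
  factor w (ip n) y sep_lang \<longleftrightarrow> n < length its \<and> y = ip (Suc n) \<and> its ! n = None"
  using factor_one[of n y "{None}"] by simp

lemma factor_bin: "n \<le> length its \<Longrightarrow>
  factor w (ip n) y bin_lang \<longleftrightarrow> n < length its \<and> y = ip (Suc n) \<and> its ! n \<noteq> None"
  using factor_one[of n y "range Some"] by (simp only: image_image notin_range_Some[symmetric] not_not)

lemma factor_bins1:
  assumes "n \<le> length its" "m \<le> length its"
  shows "factor w (ip n) (ip m) bins1_lang \<longleftrightarrow> n < m \<and> (\<forall>l. n \<le> l \<and> l < m \<longrightarrow> its ! l \<noteq> None)"
proof -
  have 1: "factor w (ip n) (ip m) bins1_lang \<longleftrightarrow> n \<le> m \<and>
      take (m - n) (drop n its) \<noteq> [] \<and> None \<notin> set (take (m - n) (drop n its))"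
    unfolding factor_items[OF w assms(1)] bins1_iff using assms ipos_eq[of m its _ p] by auto
  have 2: "set (take (m - n) (drop n its)) = {its ! l | l. n \<le> l \<and> l < m}" if "n \<le> m"
  proof (intro set_eqI iffI)
    fix z assume "z \<in> set (take (m - n) (drop n its))"
    then obtain i where "i < m - n" "z = its ! (n + i)" using assms by (auto simp: in_set_conv_nth)
    then show "z \<in> {its ! l | l. n \<le> l \<and> l < m}" by (intro CollectI exI[of _ "n + i"]) auto
  next
    fix z assume "z \<in> {its ! l | l. n \<le> l \<and> l < m}"
    then obtain l where l: "n \<le> l" "l < m" "z = its ! l" by blast
    then have "take (m - n) (drop n its) ! (l - n) = z" "l - n < length (take (m - n) (drop n its))"
      using assms by auto
    then show "z \<in> set (take (m - n) (drop n its))" by (metis nth_mem)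
  qed
  show ?thesis
  proof (cases "n \<le> m")
    case True
    show ?thesis unfolding 1 2[OF True] using assms True by (auto simp: eq_commute[of None])
  qed (simp add: 1)
qed

lemma factor_all_items: "factor w (ip 0) y items_lang \<longleftrightarrow> (\<exists>n\<le>length its. y = ip n)"
  unfolding factor_items[OF w le0] by auto

text \<open>From an item boundary the walk has at most one continuation, and at a bin it has one
  only if \<open>G\<close> holds. Reaching the end is thus the conjunction of all checks, by
  induction backwards from the end of the word.\<close>

lemma all_bins_iff:
  "all_bins w (ip 0) G \<longleftrightarrow> (\<forall>n<length its. its ! n \<noteq> None \<longrightarrow> G (ip n))"
proof -
  let ?R = "bounded_rel 1 w (\<lambda>s s'. factor w (s ! 0) (s' ! 0) sep_lang \<or>
       (factor w (s ! 0) (s' ! 0) bin_lang \<and> G (s ! 0)))"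
  have b: "ip n \<le> Suc (length w)" for n using ipos_le[of p its n] by (simp add: w)
  have R: "?R [ip n] s \<longleftrightarrow> n < length its \<and> s = [ip (Suc n)] \<and> (its ! n \<noteq> None \<longrightarrow> G (ip n))"
    if "n \<le> length its" for n s
    using factor_sep[OF that, of "s ! 0"] factor_bin[OF that, of "s ! 0"] b[of "Suc n"]
    by (auto simp: bounded_rel_def length_Suc_conv)
  have "?R\<^sup>*\<^sup>* [ip n] [Suc (length w)] \<longleftrightarrow> (\<forall>m. n \<le> m \<and> m < length its \<longrightarrow> its ! m \<noteq> None \<longrightarrow> G (ip m))"
    if "n \<le> length its" for n
    using that
  proof (induction rule: inc_induct)
    case base
    then show ?case by (auto simp: ip_last)
  next
    case (step n)
    have "ip n \<noteq> Suc (length w)"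
      using ipos_less[of n "length its" its p] step.hyps by (simp add: ip_last)
    then have "?R\<^sup>*\<^sup>* [ip n] [Suc (length w)] \<longleftrightarrow> (\<exists>s. ?R [ip n] s \<and> ?R\<^sup>*\<^sup>* s [Suc (length w)])"
      by (subst rtranclp_first_step) simp
    also have "\<dots> \<longleftrightarrow> (its ! n \<noteq> None \<longrightarrow> G (ip n)) \<and> ?R\<^sup>*\<^sup>* [ip (Suc n)] [Suc (length w)]"
      using R[of n] step.hyps by auto
    also have "\<dots> \<longleftrightarrow> (\<forall>m. n \<le> m \<and> m < length its \<longrightarrow> its ! m \<noteq> None \<longrightarrow> G (ip m))"
      unfolding step.IH using step.hyps by (metis Suc_leD le_antisym not_less_eq_eq)
    finally show ?case .
  qed
  from this[of 0] show ?thesis by (simp add: all_bins_def)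
qed

lemma item_at:
  assumes "n < length its" "its ! n = Some b"
  obtains u z where "w = u @ enc_bin b @ z" "ip n = Suc (length u)"
proof
  have "its = take n its @ Some b # drop (Suc n) its"
    using id_take_nth_drop[OF assms(1)] unfolding assms(2) .
  then have "enc_items its = enc_items (take n its) @ enc_bin b @ enc_items (drop (Suc n) its)"
    by (metis enc_items_simps(2,3) enc_item_def option.simps(5))
  then show "w = (enc_num p @ enc_items (take n its)) @ enc_bin b @ enc_items (drop (Suc n) its)"
    by (simp add: w)
  show "ip n = Suc (length (enc_num p @ enc_items (take n its)))" by (simp add: ipos_def)
qed

end

lemma compare_nums:
  assumes "w = u1 @ enc_num m @ z1" "w = u2 @ enc_num n @ z2"
  shows "same_num w (Suc (length u1)) (Suc (length u2)) \<longleftrightarrow> m = n"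
    "diff_num w (Suc (length u1)) (Suc (length u2)) \<longleftrightarrow> m \<noteq> n"
  using compare_bits[of w u1 "bits m" z1 u2 "bits n" z2] assms set_bits
  by (simp_all add: enc_num_def bits_inj)

lemma input_at_num:
  assumes "w = u @ enc_num v @ z"
  shows "input_at w (Suc (length u)) \<in> {In S0, In S1} \<longleftrightarrow> v > 0"
proof -
  have "input_at w (Suc (length u)) = In (hd (enc_num v))"
    unfolding input_at_In using assms hd_enc_num[of v]
    by (intro exI[of _ u] exI[of _ "tl (enc_num v) @ z"]) (simp flip: append_Cons)
  moreover have "hd (enc_num v) \<in> {S0, S1} \<longleftrightarrow> v > 0"
    by (cases "v = 0") (simp_all add: enc_num_def bits_0 bits_pos)
  ultimately show ?thesis by auto
qed

lemma compare_bins: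
  assumes 1: "w = u1 @ enc_bin b @ z1" and 2: "w = u2 @ enc_bin c @ z2"
  shows "same_plt w (Suc (length u1)) (Suc (length u2)) \<longleftrightarrow> plt b = plt c"
    "diff_plt w (Suc (length u1)) (Suc (length u2)) \<longleftrightarrow> plt b \<noteq> plt c"
    "diff_bin w (Suc (length u1)) (Suc (length u2)) \<longleftrightarrow> b \<noteq> c"
    "pos_plt w (Suc (length u1)) \<longleftrightarrow> plt b > 0"
proof -
  have w1: "w = u1 @ enc_num (fst b) @ enc_num (snd b) @ z1" "w = (u1 @ enc_num (fst b)) @ enc_num (snd b) @ z1"
    using 1 by (simp_all add: enc_bin_def)
  have w2: "w = u2 @ enc_num (fst c) @ enc_num (snd c) @ z2" "w = (u2 @ enc_num (fst c)) @ enc_num (snd c) @ z2"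
    using 2 by (simp_all add: enc_bin_def)
  have l: "Suc (length (u1 @ enc_num (fst b))) \<le> Suc (length w)" by (simp add: w1(1))
  have l2: "Suc (length (u2 @ enc_num (fst c))) \<le> Suc (length w)" by (simp add: w2(1))
  note f = factor_num[OF w1(1)] factor_num[OF w2(1)]
  show s: "same_plt w (Suc (length u1)) (Suc (length u2)) \<longleftrightarrow> plt b = plt c"
    unfolding same_plt_def f plt_def using compare_nums(1)[OF w1(2) w2(2)] l l2 by auto
  show d: "diff_plt w (Suc (length u1)) (Suc (length u2)) \<longleftrightarrow> plt b \<noteq> plt c"
    unfolding diff_plt_def f plt_def using compare_nums(2)[OF w1(2) w2(2)] l l2 by auto
  show "diff_bin w (Suc (length u1)) (Suc (length u2)) \<longleftrightarrow> b \<noteq> c"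
    unfolding diff_bin_def d compare_nums(2)[OF w1(1) w2(1)] by (auto simp: plt_def prod_eq_iff)
  show "pos_plt w (Suc (length u1)) \<longleftrightarrow> plt b > 0"
    unfolding pos_plt_def f plt_def using l input_at_num[OF w1(2)] by auto
qed

section \<open>Encoded instances\<close>

definition flat :: "bin list list \<Rightarrow> bin option list" where
  "flat Q = concat (map (\<lambda>q. map Some q @ [None]) Q)"

definition start_of :: "bin list list \<Rightarrow> nat \<Rightarrow> nat" where
  "start_of Q j = length (flat (take j Q))"

lemma flat_append: "flat (Q @ R) = flat Q @ flat R"
  by (simp add: flat_def)

lemma enc_items_seq: "enc_items (map Some q @ [None]) = enc_seq q"
  by (simp add: enc_items_def enc_seq_def enc_item_def comp_def)

lemma encode_flat: "encode Q p = enc_num p @ enc_items (flat Q)"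
proof -
  have "enc_items (flat Q) = concat (map enc_seq Q)"
  proof (induction Q)
    case (Cons q Q)
    have "flat (q # Q) = (map Some q @ [None]) @ flat Q" by (simp add: flat_def)
    then have "enc_items (flat (q # Q)) = enc_seq q @ enc_items (flat Q)"
      by (metis enc_items_simps(3) enc_items_seq)
    then show ?case using Cons by simp
  qed (simp add: flat_def)
  then show ?thesis by (simp add: encode_def)
qed

lemma flat_split:
  assumes "j < length Q"
  shows "flat Q = flat (take j Q) @ map Some (Q ! j) @ None # flat (drop (Suc j) Q)"
proof -
  have "Q = take j Q @ [Q ! j] @ drop (Suc j) Q" using id_take_nth_drop[OF assms] by simp
  then have "flat Q = flat (take j Q) @ flat [Q ! j] @ flat (drop (Suc j) Q)"
    by (metis flat_append)
  then show ?thesis by (simp add: flat_def)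
qed

lemma flat_nth:
  assumes "j < length Q"
  shows "m < length (Q ! j) \<Longrightarrow> flat Q ! (start_of Q j + m) = Some (Q ! j ! m)"
    "flat Q ! (start_of Q j + length (Q ! j)) = None"
  by (subst flat_split[OF assms], simp add: start_of_def nth_append)+

lemma start_of_0: "start_of Q 0 = 0"
  by (simp add: start_of_def flat_def)

lemma start_of_Suc: "j < length Q \<Longrightarrow> start_of Q (Suc j) = Suc (start_of Q j + length (Q ! j))"
  by (simp add: start_of_def take_Suc_conv_app_nth flat_append) (simp add: flat_def)

lemma start_of_length: "start_of Q (length Q) = length (flat Q)"
  by (simp add: start_of_def)

lemma start_of_less: "i < j \<Longrightarrow> j \<le> length Q \<Longrightarrow> start_of Q i + length (Q ! i) < start_of Q j"
proof (induction j)
  case (Suc j)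
  then show ?case using start_of_Suc[of j Q] by (cases "i = j") auto
qed simp

lemma start_of_bound: "j < length Q \<Longrightarrow> start_of Q j + length (Q ! j) < length (flat Q)"
  using start_of_less[of j "length Q" Q] by (simp add: start_of_length)

lemma flat_cases:
  assumes "n < length (flat Q)"
  obtains j m where "j < length Q" "m \<le> length (Q ! j)" "n = start_of Q j + m"
proof -
  have "\<exists>j<length Q. \<exists>m\<le>length (Q ! j). n = start_of Q j + m" if "n < start_of Q i" "i \<le> length Q" for i
    using that
  proof (induction i)
    case (Suc i)
    show ?case
    proof (cases "n < start_of Q i")
      case False
      then have "n - start_of Q i \<le> length (Q ! i)" "n = start_of Q i + (n - start_of Q i)"
        using Suc.prems start_of_Suc[of i Q] by auto
      then show ?thesis using Suc.prems(2) by (meson Suc_le_eq)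
    qed (use Suc in auto)
  qed (simp add: start_of_0)
  from this[of "length Q"] show ?thesis using assms that start_of_length by auto
qed

lemma flat_Some_cases:
  assumes "n < length (flat Q)" "flat Q ! n \<noteq> None"
  obtains j m where "j < length Q" "m < length (Q ! j)" "n = start_of Q j + m"
proof -
  obtain j m where jm: "j < length Q" "m \<le> length (Q ! j)" "n = start_of Q j + m"
    using flat_cases[OF assms(1)] .
  have "m \<noteq> length (Q ! j)" using assms(2) flat_nth(2)[OF jm(1)] jm(3) by auto
  with jm show ?thesis using that[of j m] by simp
qed

text \<open>Every sequence is closed by a separator, so a stretch without separators stays within
  one sequence. This is why \<open>bins1_lang\<close> expresses that a bin has been removed.\<close>

lemma bins_between:
  assumes "i < length Q" "l < length (Q ! i)" "j < length Q" "r \<le> length (Q ! j)"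
  shows "start_of Q i + l < start_of Q j + r \<and>
      (\<forall>n. start_of Q i + l \<le> n \<and> n < start_of Q j + r \<longrightarrow> flat Q ! n \<noteq> None) \<longleftrightarrow> i = j \<and> l < r"
    (is "?lt \<and> ?all \<longleftrightarrow> _")
proof
  assume a: "?lt \<and> ?all"
  consider "i < j" | "j < i" | "i = j" by linarith
  then show "i = j \<and> l < r"
  proof cases
    case 1
    then have "start_of Q i + length (Q ! i) < start_of Q j" using start_of_less assms(3) by simp
    then have "flat Q ! (start_of Q i + length (Q ! i)) \<noteq> None" using a assms(2) by simp
    then show ?thesis using flat_nth(2)[OF assms(1)] by simp
  next
    case 2
    then have "start_of Q j + length (Q ! j) < start_of Q i" using start_of_less assms(1) by simp
    then show ?thesis using a assms(4) by simp
  qed (use a in auto)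
next
  assume a: "i = j \<and> l < r"
  have "flat Q ! n \<noteq> None" if "start_of Q i + l \<le> n" "n < start_of Q j + r" for n
    using flat_nth(1)[OF assms(1), of "n - start_of Q i"] that a assms by auto
  then show "?lt \<and> ?all" using a by auto
qed

lemma ipos_start_of: "ipos p (flat Q) (start_of Q j) = Suc (length (encode (take j Q) p))"
proof -
  have "flat Q = flat (take j Q) @ flat (drop j Q)" by (metis append_take_drop_id flat_append)
  then have "take (start_of Q j) (flat Q) = flat (take j Q)" by (simp add: start_of_def)
  then show ?thesis by (simp add: ipos_def encode_flat)
qed

lemma seq_lang_eq: "seq_lang = range enc_seq"
proof -
  have "conc (range (map Some)) {[None]} = range (\<lambda>q :: bin list. map Some q @ [None])"
    by (auto simp: conc_def)
  then have "seq_lang = enc_items ` range (\<lambda>q. map Some q @ [None])" by (simp only:)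
  also have "\<dots> = range enc_seq" by (simp only: image_image enc_items_seq)
  finally show ?thesis .
qed

lemma encode_snoc: "encode (Q @ [q]) p = encode Q p @ enc_seq q"
  by (simp add: encode_def)

text \<open>From left to right the sequences are recovered one by one; the induction keeps the list
  parsed so far together with the unread rest \<open>z\<close> of the word.\<close>

lemma starts_at_iff:
  assumes k: "0 < k"
  shows "starts_at k w f \<longleftrightarrow> (\<exists>Q p. length Q = k \<and> 0 < p \<and> w = encode Q p \<and>
    (\<forall>j<k. f j = ipos p (flat Q) (start_of Q j)))"
proof
  assume st: "starts_at k w f"
  then obtain v z where v: "w = v @ z" "v \<in> num_lang" "f 0 = Suc (length v)"
    by (auto simp: starts_at_def factor_def)
  then obtain p where p: "v = enc_num p" by blast
  have "p > 0" using st input_at_num[of w "[]" p z] v(1) p by (simp add: starts_at_def)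
  \<comment> \<open>The end of the word is added as position number \<open>k\<close>, so that the
    last sequence is treated like the others.\<close>
  define g where "g j = (if j < k then f j else Suc (length w))" for j
  have g: "factor w (g j) (g (Suc j)) seq_lang" if "j < k" for j
    using st that by (cases "Suc j < k") (auto simp: starts_at_def g_def less_Suc_eq not_less_eq
        dest: le_antisym)
  have "\<exists>Q z. length Q = j \<and> (\<forall>i\<le>j. g i = Suc (length (encode (take i Q) p))) \<and> w = encode Q p @ z"
    if "j \<le> k" for j
    using that
  proof (induction j)
    case 0
    have "g 0 = Suc (length (encode [] p))" using k v(3) p by (simp add: g_def encode_def)
    then show ?case using v(1) p by (intro exI[of _ "[]"] exI[of _ z]) (simp add: encode_def)
  next
    case (Suc j)
    then obtain Q z where Q: "length Q = j" "\<forall>i\<le>j. g i = Suc (length (encode (take i Q) p))"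
      "w = encode Q p @ z" by auto
    obtain u q z' where u: "w = u @ enc_seq q @ z'" "g j = Suc (length u)" "g (Suc j) = g j + length (enc_seq q)"
      using g[of j] Suc.prems unfolding seq_lang_eq factor_def by auto
    have "length u = length (encode Q p)" using u(2) Q(1,2) by simp
    then have "u = encode Q p" using u(1) Q(3) append_eq_append_conv by metis
    then have w: "w = encode (Q @ [q]) p @ z'" using u(1) by (simp add: encode_snoc)
    have "g i = Suc (length (encode (take i (Q @ [q])) p))" if "i \<le> Suc j" for i
    proof (cases "i = Suc j")
      case True
      then show ?thesis using u(2,3) Q(1) \<open>u = _\<close> by (simp add: encode_snoc)
    next
      case False
      then show ?thesis using that Q(1,2) by simp
    qed
    with w Q(1) show ?case by (intro exI[of _ "Q @ [q]"] exI[of _ z']) simp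
  qed
  from this[of k] obtain Q z where Q: "length Q = k" "\<forall>i\<le>k. g i = Suc (length (encode (take i Q) p))"
      "w = encode Q p @ z" by auto
  have "Suc (length w) = Suc (length (encode Q p))" using Q(1) Q(2)[rule_format, of k] by (simp add: g_def)
  then have "w = encode Q p" using Q(3) by simp
  moreover have "f j = ipos p (flat Q) (start_of Q j)" if "j < k" for j
    unfolding ipos_start_of using Q(2)[rule_format, of j] that by (simp add: g_def)
  ultimately show "\<exists>Q p. length Q = k \<and> 0 < p \<and> w = encode Q p \<and>
      (\<forall>j<k. f j = ipos p (flat Q) (start_of Q j))" using Q(1) \<open>p > 0\<close> by blast
next
  assume "\<exists>Q p. length Q = k \<and> 0 < p \<and> w = encode Q p \<and> (\<forall>j<k. f j = ipos p (flat Q) (start_of Q j))"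
  then obtain Q p where Q: "length Q = k" "0 < p" "w = encode Q p"
    "\<And>j. j < k \<Longrightarrow> f j = Suc (length (encode (take j Q) p))" unfolding ipos_start_of by blast
  have seq: "factor w (Suc (length (encode (take j Q) p))) (Suc (length (encode (take (Suc j) Q) p))) seq_lang"
    if "j < k" for j
  proof -
    have t: "encode (take (Suc j) Q) p = encode (take j Q) p @ enc_seq (Q ! j)"
      using that Q(1) by (simp add: take_Suc_conv_app_nth encode_snoc)
    have "w = encode (take (Suc j) Q) p @ concat (map enc_seq (drop (Suc j) Q))"
      unfolding Q(3) encode_def by (metis append.assoc append_take_drop_id concat_append map_append)
    then show ?thesis unfolding seq_lang_eq factor_def t
      by (intro exI[of _ "encode (take j Q) p"] exI[of _ "enc_seq (Q ! j)"]
        exI[of _ "concat (map enc_seq (drop (Suc j) Q))"]) simp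
  qed
  have w: "w = [] @ enc_num p @ concat (map enc_seq Q)" by (simp add: Q(3) encode_def)
  have "factor w (Suc 0) (f 0) num_lang"
    using factor_num[OF w] Q(4)[OF k] by (simp add: encode_def)
  moreover have "input_at w (Suc 0) \<in> {In S0, In S1}" using input_at_num[OF w] Q(2) by simp
  moreover have "factor w (f j) (f (Suc j)) seq_lang" if "j < k - 1" for j
    using seq[of j] Q(4)[of j] Q(4)[of "Suc j"] that by simp
  moreover have "factor w (f (k - 1)) (Suc (length w)) seq_lang"
    using seq[of "k - 1"] Q(4)[of "k - 1"] k Q(1,3) by simp
  ultimately show "starts_at k w f" unfolding starts_at_def by auto
qed

section \<open>Validity of the instance\<close>

definition bins_of :: "bin option list \<Rightarrow> bin list" where
  "bins_of its = concat (map (\<lambda>it. case it of None \<Rightarrow> [] | Some b \<Rightarrow> [b]) its)"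

lemma bins_of_flat: "bins_of (flat Q) = concat Q"
proof (induction Q)
  case (Cons q Q)
  have "concat (map ((\<lambda>it. case it of None \<Rightarrow> [] | Some b \<Rightarrow> [b]) \<circ> Some) q) = q" for q :: "bin list"
    by (induction q) auto
  with Cons show ?case by (simp add: flat_def bins_of_def)
qed (simp add: flat_def bins_of_def)

lemma set_bins_of: "set (bins_of its) = {b. Some b \<in> set its}"
  by (auto simp: bins_of_def split: option.splits)

lemma distinct_bins_of: "distinct (bins_of its) \<longleftrightarrow>
  (\<forall>n<length its. \<forall>m<length its. n \<noteq> m \<longrightarrow> its ! n \<noteq> None \<longrightarrow> its ! n \<noteq> its ! m)"
proof (induction its)
  case (Cons it its)
  have "distinct (bins_of (it # its)) \<longleftrightarrow> distinct (bins_of its) \<and> (it \<noteq> None \<longrightarrow> it \<notin> set its)"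
    using set_bins_of[of its] by (auto simp: bins_of_def split: option.splits)
  also have "\<dots> \<longleftrightarrow> (\<forall>n<length its. \<forall>m<length its. n \<noteq> m \<longrightarrow> its ! n \<noteq> None \<longrightarrow> its ! n \<noteq> its ! m) \<and>
      (it \<noteq> None \<longrightarrow> (\<forall>m<length its. it \<noteq> its ! m))"
    unfolding Cons.IH by (auto simp: in_set_conv_nth)
  also have "\<dots> \<longleftrightarrow> (\<forall>n<length (it # its). \<forall>m<length (it # its). n \<noteq> m \<longrightarrow>
      (it # its) ! n \<noteq> None \<longrightarrow> (it # its) ! n \<noteq> (it # its) ! m)"
    by (simp add: All_less_Suc2) metis
  finally show ?case .
qed (simp add: bins_of_def)

lemma valid_at_iff:
  assumes w: "w = enc_num p @ enc_items its"
  shows "valid_at w (ipos p its 0) \<longleftrightarrow> distinct (bins_of its) \<and>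
    (\<forall>b\<in>set (bins_of its). plt b > 0 \<and> (\<exists>b'\<in>set (bins_of its). b' \<noteq> b \<and> plt b' = plt b))"
proof -
  let ?n = "length its"
  have cmp: "same_plt w (ipos p its n) (ipos p its m) \<longleftrightarrow> plt b = plt c"
    "diff_bin w (ipos p its n) (ipos p its m) \<longleftrightarrow> b \<noteq> c"
    "pos_plt w (ipos p its n) \<longleftrightarrow> plt b > 0"
    if nm: "n < ?n" "its ! n = Some b" "m < ?n" "its ! m = Some c" for n m b c
  proof -
    obtain u1 z1 where 1: "w = u1 @ enc_bin b @ z1" "ipos p its n = Suc (length u1)"
      using item_at[OF w nm(1,2)] .
    obtain u2 z2 where 2: "w = u2 @ enc_bin c @ z2" "ipos p its m = Suc (length u2)"
      using item_at[OF w nm(3,4)] .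
    show "same_plt w (ipos p its n) (ipos p its m) \<longleftrightarrow> plt b = plt c"
      "diff_bin w (ipos p its n) (ipos p its m) \<longleftrightarrow> b \<noteq> c"
      "pos_plt w (ipos p its n) \<longleftrightarrow> plt b > 0"
      unfolding 1(2) 2(2) using compare_bins[OF 1(1) 2(1)] by blast+
  qed
  have bd: "ipos p its n \<le> Suc (length w)" for n using ipos_le[of p its n] by (simp add: w)
  have twin: "(\<exists>y\<le>Suc (length w). \<exists>y'\<le>Suc (length w). factor w (ipos p its 0) y items_lang \<and>
       factor w y y' bin_lang \<and> y \<noteq> ipos p its n \<and> same_plt w (ipos p its n) y) \<longleftrightarrow>
    (\<exists>m<?n. m \<noteq> n \<and> (\<exists>c. its ! m = Some c \<and> plt c = plt b))"
    if nb: "n < ?n" "its ! n = Some b" for n b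
  proof
    assume "\<exists>y\<le>Suc (length w). \<exists>y'\<le>Suc (length w). factor w (ipos p its 0) y items_lang \<and>
       factor w y y' bin_lang \<and> y \<noteq> ipos p its n \<and> same_plt w (ipos p its n) y"
    then obtain m y' where m: "m \<le> ?n" "factor w (ipos p its m) y' bin_lang" "ipos p its m \<noteq> ipos p its n"
      "same_plt w (ipos p its n) (ipos p its m)" unfolding factor_all_items[OF w] by blast
    then have "m < ?n" "its ! m \<noteq> None" using factor_bin[OF w m(1)] by auto
    then obtain c where "its ! m = Some c" by blast
    with m cmp(1)[OF nb \<open>m < ?n\<close> this] \<open>m < ?n\<close>
    show "\<exists>m<?n. m \<noteq> n \<and> (\<exists>c. its ! m = Some c \<and> plt c = plt b)" by metis
  next
    assume "\<exists>m<?n. m \<noteq> n \<and> (\<exists>c. its ! m = Some c \<and> plt c = plt b)"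
    then obtain m c where m: "m < ?n" "m \<noteq> n" "its ! m = Some c" "plt c = plt b" by blast
    have "factor w (ipos p its m) (ipos p its (Suc m)) bin_lang" using factor_bin[OF w] m by simp
    moreover have "ipos p its m \<noteq> ipos p its n" using ipos_eq m nb by simp
    moreover have "same_plt w (ipos p its n) (ipos p its m)" using cmp(1)[OF nb m(1,3)] m(4) by simp
    moreover have "factor w (ipos p its 0) (ipos p its m) items_lang"
      unfolding factor_all_items[OF w] using m(1) less_imp_le by blast
    ultimately show "\<exists>y\<le>Suc (length w). \<exists>y'\<le>Suc (length w). factor w (ipos p its 0) y items_lang \<and>
       factor w y y' bin_lang \<and> y \<noteq> ipos p its n \<and> same_plt w (ipos p its n) y" using bd by blast
  qed
  have dist: "all_bins w (ipos p its 0) (\<lambda>y. ipos p its n = y \<or> diff_bin w (ipos p its n) y) \<longleftrightarrow>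
      (\<forall>m<?n. n \<noteq> m \<longrightarrow> its ! n \<noteq> its ! m)" if nb: "n < ?n" "its ! n = Some b" for n b
  proof -
    have "(its ! m \<noteq> None \<longrightarrow> ipos p its n = ipos p its m \<or> diff_bin w (ipos p its n) (ipos p its m)) \<longleftrightarrow>
        (n \<noteq> m \<longrightarrow> its ! n \<noteq> its ! m)" if "m < ?n" for m
      using cmp(2)[OF nb that] ipos_eq[of n its m p] nb that by (cases "its ! m") auto
    then show ?thesis unfolding all_bins_iff[OF w] by blast
  qed
  have in_bins: "b \<in> set (bins_of its) \<longleftrightarrow> (\<exists>n<?n. its ! n = Some b)" for b
    by (auto simp: set_bins_of in_set_conv_nth)
  have all_bins_of: "(\<forall>n<?n. \<forall>b. its ! n = Some b \<longrightarrow> P b) \<longleftrightarrow> (\<forall>b\<in>set (bins_of its). P b)" for P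
    unfolding Ball_def in_bins by blast
  have "valid_at w (ipos p its 0) \<longleftrightarrow> (\<forall>n<?n. \<forall>b. its ! n = Some b \<longrightarrow> plt b > 0 \<and>
      (\<forall>m<?n. n \<noteq> m \<longrightarrow> its ! n \<noteq> its ! m) \<and> (\<exists>m<?n. m \<noteq> n \<and> (\<exists>c. its ! m = Some c \<and> plt c = plt b)))"
  proof -
    define G where "G = (\<lambda>x. pos_plt w x \<and>
      all_bins w (ipos p its 0) (\<lambda>y. x = y \<or> diff_bin w x y) \<and>
      (\<exists>y\<le>Suc (length w). \<exists>y'\<le>Suc (length w). factor w (ipos p its 0) y items_lang \<and>
        factor w y y' bin_lang \<and> y \<noteq> x \<and> same_plt w x y))"
    have v: "valid_at w (ipos p its 0) \<longleftrightarrow> (\<forall>n<?n. its ! n \<noteq> None \<longrightarrow> G (ipos p its n))"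
      unfolding all_bins_iff[OF w, symmetric] by (simp only: valid_at_def G_def)
    have g: "G (ipos p its n) \<longleftrightarrow> plt b > 0 \<and> (\<forall>m<?n. n \<noteq> m \<longrightarrow> its ! n \<noteq> its ! m) \<and>
        (\<exists>m<?n. m \<noteq> n \<and> (\<exists>c. its ! m = Some c \<and> plt c = plt b))"
      if "n < ?n" "its ! n = Some b" for n b
      unfolding G_def using cmp(3)[OF that that] dist[OF that] twin[OF that] by blast
    have "(its ! n \<noteq> None \<longrightarrow> G (ipos p its n)) \<longleftrightarrow> (\<forall>b. its ! n = Some b \<longrightarrow> plt b > 0 \<and>
        (\<forall>m<?n. n \<noteq> m \<longrightarrow> its ! n \<noteq> its ! m) \<and> (\<exists>m<?n. m \<noteq> n \<and> (\<exists>c. its ! m = Some c \<and> plt c = plt b)))"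
      if "n < ?n" for n
    proof (cases "its ! n")
      case (Some b)
      show ?thesis using g[OF that Some] unfolding Some by simp
    qed simp
    then show ?thesis unfolding v by (intro all_cong1 imp_cong[OF refl])
  qed
  also have "\<dots> \<longleftrightarrow> distinct (bins_of its) \<and> (\<forall>n<?n. \<forall>b. its ! n = Some b \<longrightarrow> plt b > 0 \<and>
      (\<exists>m<?n. m \<noteq> n \<and> (\<exists>c. its ! m = Some c \<and> plt c = plt b)))"
    unfolding distinct_bins_of by blast
  also have "\<dots> \<longleftrightarrow> distinct (bins_of its) \<and>
    (\<forall>b\<in>set (bins_of its). plt b > 0 \<and> (\<exists>b'\<in>set (bins_of its). b' \<noteq> b \<and> plt b' = plt b))"
  \<comment> \<open>Distinctness may be assumed here: it turns the bin at another position into a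
    different bin.\<close>
  proof (rule conj_cong[OF refl])
    assume d: "distinct (bins_of its)"
    have twin': "(\<exists>m<?n. m \<noteq> n \<and> (\<exists>c. its ! m = Some c \<and> plt c = plt b)) \<longleftrightarrow>
        (\<exists>b'\<in>set (bins_of its). b' \<noteq> b \<and> plt b' = plt b)" if nb: "n < ?n" "its ! n = Some b" for n b
    proof
      assume "\<exists>m<?n. m \<noteq> n \<and> (\<exists>c. its ! m = Some c \<and> plt c = plt b)"
      then obtain m c where m: "m < ?n" "m \<noteq> n" "its ! m = Some c" "plt c = plt b" by blast
      then have "c \<noteq> b" using d[unfolded distinct_bins_of, rule_format, of m n] nb by auto
      then show "\<exists>b'\<in>set (bins_of its). b' \<noteq> b \<and> plt b' = plt b" using m in_bins by blast
    next
      assume "\<exists>b'\<in>set (bins_of its). b' \<noteq> b \<and> plt b' = plt b"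
      then obtain c m where "c \<noteq> b" "plt c = plt b" "m < ?n" "its ! m = Some c" using in_bins by blast
      then show "\<exists>m<?n. m \<noteq> n \<and> (\<exists>c. its ! m = Some c \<and> plt c = plt b)"
        using nb by (intro exI[of _ m]) auto
    qed
    have "(\<forall>n<?n. \<forall>b. its ! n = Some b \<longrightarrow> plt b > 0 \<and>
      (\<exists>m<?n. m \<noteq> n \<and> (\<exists>c. its ! m = Some c \<and> plt c = plt b))) \<longleftrightarrow>
      (\<forall>n<?n. \<forall>b. its ! n = Some b \<longrightarrow> plt b > 0 \<and> (\<exists>b'\<in>set (bins_of its). b' \<noteq> b \<and> plt b' = plt b))"
      by (intro all_cong1 imp_cong[OF refl]) (simp only: twin')
    then show "(\<forall>n<?n. \<forall>b. its ! n = Some b \<longrightarrow> plt b > 0 \<and>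
      (\<exists>m<?n. m \<noteq> n \<and> (\<exists>c. its ! m = Some c \<and> plt c = plt b))) \<longleftrightarrow>
      (\<forall>b\<in>set (bins_of its). plt b > 0 \<and> (\<exists>b'\<in>set (bins_of its). b' \<noteq> b \<and> plt b' = plt b))"
      by (simp only: all_bins_of)
  qed
  finally show ?thesis .
qed

section \<open>Processings\<close>

text \<open>A configuration is given by the numbers \<open>m j\<close> of bins already removed from the sequences.\<close>

definition config :: "bin list list \<Rightarrow> (nat \<Rightarrow> nat) \<Rightarrow> bin list list" where
  "config Q m = map (\<lambda>j. drop (m j) (Q ! j)) [0..<length Q]"

definition gone :: "bin list list \<Rightarrow> (nat \<Rightarrow> nat) \<Rightarrow> nat set" where
  "gone Q m = {t. \<exists>i<length Q. \<exists>l<m i. plt (Q ! i ! l) = t}"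

definition left :: "bin list list \<Rightarrow> (nat \<Rightarrow> nat) \<Rightarrow> nat set" where
  "left Q m = {t. \<exists>i<length Q. \<exists>l<length (Q ! i). m i \<le> l \<and> plt (Q ! i ! l) = t}"

definition within :: "bin list list \<Rightarrow> (nat \<Rightarrow> nat) \<Rightarrow> bool" where
  "within Q m \<longleftrightarrow> (\<forall>j<length Q. m j \<le> length (Q ! j))"

text \<open>The bound is checked on the configuration after the step. In the initial one nothing is
  gone and no pallet is open, so this covers every configuration of a processing.\<close>

definition mstep :: "bin list list \<Rightarrow> nat \<Rightarrow> (nat \<Rightarrow> nat) \<Rightarrow> (nat \<Rightarrow> nat) \<Rightarrow> bool" where
  "mstep Q p m m' \<longleftrightarrow> (\<exists>j<length Q. m j < length (Q ! j) \<and> m' = m(j := Suc (m j)) \<and>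
     card (left Q m' \<inter> gone Q m') \<le> p)"

abbreviation "mreach Q p \<equiv> (mstep Q p)\<^sup>*\<^sup>* (\<lambda>_. 0)"

lemma mstep_within: "mreach Q p m \<Longrightarrow> within Q m"
  by (induction rule: rtranclp_induct) (auto simp: mstep_def within_def)

lemma open_pallets_config:
  assumes "within Q m"
  shows "open_pallets Q (config Q m) = left Q m \<inter> gone Q m"
proof -
  have 1: "(\<exists>b\<in>set (drop (m i) (Q ! i)). plt b = t) \<longleftrightarrow>
      (\<exists>l<length (Q ! i). m i \<le> l \<and> plt (Q ! i ! l) = t)" if "i < length Q" for i t
  proof
    assume "\<exists>b\<in>set (drop (m i) (Q ! i)). plt b = t"
    then obtain l where "l < length (Q ! i) - m i" "plt (Q ! i ! (m i + l)) = t"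
      using assms that by (auto simp: in_set_conv_nth within_def)
    then show "\<exists>l<length (Q ! i). m i \<le> l \<and> plt (Q ! i ! l) = t"
      by (intro exI[of _ "m i + l"]) auto
  next
    assume "\<exists>l<length (Q ! i). m i \<le> l \<and> plt (Q ! i ! l) = t"
    then obtain l where "l < length (Q ! i)" "m i \<le> l" "plt (Q ! i ! l) = t" by blast
    then show "\<exists>b\<in>set (drop (m i) (Q ! i)). plt b = t"
      by (intro bexI[of _ "Q ! i ! l"]) (auto simp: in_set_conv_nth intro!: exI[of _ "l - m i"])
  qed
  have 2: "(\<exists>b\<in>set (seq_minus (Q ! i) (drop (m i) (Q ! i))). plt b = t) \<longleftrightarrow>
      (\<exists>l<m i. plt (Q ! i ! l) = t)" if "i < length Q" for i t
  proof -
    have "m i \<le> length (Q ! i)" using assms that by (simp add: within_def)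
    then have "seq_minus (Q ! i) (drop (m i) (Q ! i)) = take (m i) (Q ! i)" by (simp add: seq_minus_def)
    then show ?thesis using \<open>m i \<le> length (Q ! i)\<close>
      by (auto simp: nth_image[symmetric])
  qed
  have "(\<exists>i<length (config Q m). \<exists>b\<in>set (config Q m ! i). plt b = t) \<longleftrightarrow> t \<in> left Q m" for t
    using 1 by (simp add: config_def left_def cong: conj_cong)
  moreover have "(\<exists>i<length Q. \<exists>b\<in>set (seq_minus (Q ! i) (config Q m ! i)). plt b = t) \<longleftrightarrow> t \<in> gone Q m" for t
    using 2 by (simp add: config_def gone_def cong: conj_cong)
  ultimately show ?thesis unfolding open_pallets_def by blast
qed

lemma config_0: "config Q (\<lambda>_. 0) = Q"
  by (simp add: config_def map_nth)

lemma transformation_config: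
  "transformation_step (config Q m) C \<longleftrightarrow>
    (\<exists>j<length Q. m j < length (Q ! j) \<and> C = config Q (m(j := Suc (m j))))"
proof -
  have "(config Q m)[j := tl (config Q m ! j)] = config Q (m(j := Suc (m j)))" if "j < length Q" for j
    using that by (intro nth_equalityI) (auto simp: config_def nth_list_update tl_drop drop_Suc)
  then show ?thesis unfolding transformation_step_def by (auto simp: config_def)
qed

lemma has_processing_iff:
  "has_processing_with Q p \<longleftrightarrow>
    (\<exists>m. mreach Q p m \<and> (\<forall>j<length Q. m j = length (Q ! j)))"
proof
  assume "has_processing_with Q p"
  then obtain cs where cs: "cs \<noteq> []" "hd cs = Q"
    "\<And>i. Suc i < length cs \<Longrightarrow> transformation_step (cs ! i) (cs ! Suc i)"
    "\<forall>q\<in>set (last cs). q = []" "\<forall>c\<in>set cs. card (open_pallets Q c) \<le> p"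
    unfolding has_processing_with_def is_processing_def by blast
  have "\<exists>m. mreach Q p m \<and> cs ! i = config Q m" if "i < length cs" for i
    using that
  proof (induction i)
    case 0
    then show ?case using cs(1,2) by (intro exI[of _ "\<lambda>_. 0"]) (simp add: config_0 hd_conv_nth)
  next
    case (Suc i)
    then obtain m where m: "mreach Q p m" "cs ! i = config Q m" by auto
    from cs(3)[OF Suc.prems] obtain j where j: "j < length Q" "m j < length (Q ! j)"
      "cs ! Suc i = config Q (m(j := Suc (m j)))" unfolding m(2) transformation_config by blast
    have "within Q (m(j := Suc (m j)))" using mstep_within[OF m(1)] j by (auto simp: within_def)
    from open_pallets_config[OF this] have "card (left Q (m(j := Suc (m j))) \<inter> gone Q (m(j := Suc (m j)))) \<le> p"
      using cs(5) Suc.prems j(3) by (metis nth_mem)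
    then have "mstep Q p m (m(j := Suc (m j)))" using j by (auto simp: mstep_def)
    then have "mreach Q p (m(j := Suc (m j)))"
      using m(1) rtranclp.rtrancl_into_rtrancl[of "mstep Q p" "\<lambda>_. 0" m] by blast
    then show ?case using j(3) by blast
  qed
  from this[of "length cs - 1"] obtain m where m: "mreach Q p m" "last cs = config Q m"
    using cs(1) by (auto simp: last_conv_nth)
  have "m j = length (Q ! j)" if "j < length Q" for j
  proof -
    have "drop (m j) (Q ! j) \<in> set (config Q m)" using that by (auto simp: config_def)
    then have "drop (m j) (Q ! j) = []" using cs(4) unfolding m(2) by blast
    then show ?thesis using mstep_within[OF m(1)] that by (auto simp: within_def)
  qed
  with m(1) show "\<exists>m. mreach Q p m \<and> (\<forall>j<length Q. m j = length (Q ! j))" by blast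
next
  have "\<exists>cs. cs \<noteq> [] \<and> hd cs = Q \<and> (\<forall>i. Suc i < length cs \<longrightarrow> transformation_step (cs ! i) (cs ! Suc i)) \<and>
      last cs = config Q m \<and> (\<forall>c\<in>set cs. card (open_pallets Q c) \<le> p)"
    if "mreach Q p m" for m
    using that
  proof (induction rule: rtranclp_induct)
    case base
    have "within Q (\<lambda>_. 0)" by (simp add: within_def)
    from open_pallets_config[OF this] have "open_pallets Q Q = {}" by (simp add: config_0 gone_def)
    then show ?case by (intro exI[of _ "[Q]"]) (simp add: config_0)
  next
    case (step m m')
    then obtain cs where cs: "cs \<noteq> []" "hd cs = Q" "last cs = config Q m"
      "\<And>i. Suc i < length cs \<Longrightarrow> transformation_step (cs ! i) (cs ! Suc i)"
      "\<forall>c\<in>set cs. card (open_pallets Q c) \<le> p" by blast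
    have "within Q m'" using mstep_within[OF step.hyps(1)] step.hyps(2) by (auto simp: within_def mstep_def)
    then have "card (open_pallets Q (config Q m')) \<le> p"
      using step.hyps(2) open_pallets_config by (auto simp: mstep_def)
    moreover have "transformation_step (config Q m) (config Q m')"
      using step.hyps(2) transformation_config by (auto simp: mstep_def)
    then have "transformation_step ((cs @ [config Q m']) ! i) ((cs @ [config Q m']) ! Suc i)"
      if "Suc i < length (cs @ [config Q m'])" for i
    proof (cases "Suc i < length cs")
      case False
      then have "i = length cs - 1" "Suc i = length cs" using that by simp_all
      then show ?thesis using cs(1,3) \<open>transformation_step (config Q m) _\<close>
        by (simp add: nth_append last_conv_nth)
    qed (use cs(4)[of i] in \<open>simp add: nth_append\<close>)
    ultimately show ?case using cs by (intro exI[of _ "cs @ [config Q m']"]) auto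
  qed
  moreover assume "\<exists>m. mreach Q p m \<and> (\<forall>j<length Q. m j = length (Q ! j))"
  moreover have "\<forall>q\<in>set (config Q m). q = []" if "\<forall>j<length Q. m j = length (Q ! j)" for m
    using that by (auto simp: config_def)
  ultimately show "has_processing_with Q p"
    unfolding has_processing_with_def is_processing_def by metis
qed

section \<open>Change of the number of open pallets in one step\<close>

lemma finite_gone: "finite (gone Q m)"
proof -
  have "gone Q m = (\<Union>i<length Q. \<Union>l<m i. {plt (Q ! i ! l)})" by (auto simp: gone_def)
  then show ?thesis by simp
qed

lemma mem_concat_nth: "b \<in> set (concat Q) \<longleftrightarrow> (\<exists>i<length Q. \<exists>l<length (Q ! i). Q ! i ! l = b)"
  by (auto simp: in_set_conv_nth) (metis in_set_conv_nth)+

text \<open>The second case is where the hypothesis of at least two bins for each pallet is used.\<close>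
lemma card_open_update:
  assumes Q: "valid_instance Q" and m: "within Q m"
    and j: "j < length Q" "m j < length (Q ! j)"
  defines "t \<equiv> plt (Q ! j ! m j)" and "m' \<equiv> m(j := Suc (m j))"
  shows "t \<in> gone Q m \<Longrightarrow> t \<in> left Q m' \<Longrightarrow>
      card (left Q m' \<inter> gone Q m') = card (left Q m \<inter> gone Q m)"
    and "t \<notin> gone Q m \<Longrightarrow>
      t \<in> left Q m' \<and> card (left Q m' \<inter> gone Q m') = Suc (card (left Q m \<inter> gone Q m))"
    and "t \<in> gone Q m \<Longrightarrow> t \<notin> left Q m' \<Longrightarrow>
      card (left Q m \<inter> gone Q m) = Suc (card (left Q m' \<inter> gone Q m'))"
proof -
  have g: "gone Q m' = insert t (gone Q m)"
    using j by (auto simp: gone_def m'_def t_def less_Suc_eq)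
  have l: "left Q m = insert t (left Q m')"
  proof (intro set_eqI iffI)
    fix s assume "s \<in> left Q m"
    then obtain i l where il: "i < length Q" "l < length (Q ! i)" "m i \<le> l" "plt (Q ! i ! l) = s"
      by (auto simp: left_def)
    show "s \<in> insert t (left Q m')"
    proof (cases "i = j \<and> l = m j")
      case False
      then have "m' i \<le> l" using il(3) by (auto simp: m'_def)
      then show ?thesis using il by (auto simp: left_def)
    qed (use il in \<open>auto simp: t_def\<close>)
  next
    fix s assume "s \<in> insert t (left Q m')"
    moreover have "m i \<le> m' i" for i by (simp add: m'_def)
    ultimately show "s \<in> left Q m" using j unfolding left_def t_def by (auto intro: order.trans)
  qed
  note fin = finite_gone[of Q m]
  show "card (left Q m' \<inter> gone Q m') = card (left Q m \<inter> gone Q m)"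
    if t: "t \<in> gone Q m" "t \<in> left Q m'"
    unfolding g l insert_absorb[OF t(1)] insert_absorb[OF t(2)] ..
  show "t \<in> left Q m' \<and> card (left Q m' \<inter> gone Q m') = Suc (card (left Q m \<inter> gone Q m))"
    if t: "t \<notin> gone Q m"
  proof -
    \<comment> \<open>No bin for \<open>t\<close> is gone, hence the second bin \<open>b\<close> for
      \<open>t\<close> has not been removed; being different from the bin removed now, it is still
      left after the step.\<close>
    have "Q ! j ! m j \<in> set (concat Q)" unfolding mem_concat_nth using j by blast
    then obtain b where b: "b \<in> set (concat Q)" "b \<noteq> Q ! j ! m j" "plt b = t"
      using Q unfolding valid_instance_def t_def by blast
    then obtain i l where il: "i < length Q" "l < length (Q ! i)" "Q ! i ! l = b"
      unfolding mem_concat_nth by blast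
    have "plt (Q ! i ! l) = t" using il(3) b(3) by simp
    then have "\<not> l < m i" using t il(1) unfolding gone_def by blast
    then have "m' i \<le> l" using il(3) b(2) by (auto simp: m'_def not_less le_less)
    then have tl: "t \<in> left Q m'" using il b(3) by (auto simp: left_def)
    then have "left Q m' \<inter> gone Q m' = insert t (left Q m \<inter> gone Q m)" unfolding g l by auto
    then show ?thesis using tl t fin by simp
  qed
  show "card (left Q m \<inter> gone Q m) = Suc (card (left Q m' \<inter> gone Q m'))"
    if t: "t \<in> gone Q m" "t \<notin> left Q m'"
  proof -
    have "left Q m \<inter> gone Q m = insert t (left Q m' \<inter> gone Q m')" unfolding g l using t by auto
    moreover have "finite (left Q m' \<inter> gone Q m')" unfolding g using fin by simp
    ultimately show ?thesis using t(2) by simp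
  qed
qed

section \<open>Runs on positions versus processings\<close>

lemma length_bins_of: "length (bins_of its) \<le> length its"
  by (induction its) (auto simp: bins_of_def split: option.splits)

context
  fixes Q :: "bin list list" and p :: nat and w :: "sym list"
  assumes w: "w = encode Q p"
begin

abbreviation "its \<equiv> flat Q"
abbreviation "at n \<equiv> ipos p its n"

lemma w_items: "w = enc_num p @ enc_items its"
  by (simp add: w encode_flat)

definition represents :: "(nat \<Rightarrow> nat) \<Rightarrow> (nat \<Rightarrow> nat) \<Rightarrow> bool" where
  "represents f m \<longleftrightarrow> (\<forall>j<length Q. f j = at (start_of Q j + m j))"

lemma at_bound: "at n \<le> Suc (length w)"
  using ipos_le[of p its n] by (simp add: w_items)

lemma idx_bound: "j < length Q \<Longrightarrow> r \<le> length (Q ! j) \<Longrightarrow> start_of Q j + r < length its"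
  using start_of_bound[of j Q] by simp

lemma factor_between:
  assumes "i < length Q" "l < length (Q ! i)" "j < length Q" "r \<le> length (Q ! j)"
  shows "factor w (at (start_of Q i + l)) (at (start_of Q j + r)) bins1_lang \<longleftrightarrow> i = j \<and> l < r"
proof -
  have "start_of Q i + l \<le> length its" "start_of Q j + r \<le> length its"
    using idx_bound[of i l] idx_bound[of j r] assms by auto
  from factor_bins1[OF w_items this] show ?thesis using bins_between[OF assms] by simp
qed

lemma compare_at:
  assumes "i < length Q" "l < length (Q ! i)" "j < length Q" "r < length (Q ! j)"
  shows "same_plt w (at (start_of Q i + l)) (at (start_of Q j + r)) \<longleftrightarrow> plt (Q ! i ! l) = plt (Q ! j ! r)"
    "diff_plt w (at (start_of Q i + l)) (at (start_of Q j + r)) \<longleftrightarrow> plt (Q ! i ! l) \<noteq> plt (Q ! j ! r)"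
proof -
  have b: "start_of Q i + l < length its" "start_of Q j + r < length its"
    using idx_bound[of i l] idx_bound[of j r] assms by auto
  obtain u1 z1 where 1: "w = u1 @ enc_bin (Q ! i ! l) @ z1" "at (start_of Q i + l) = Suc (length u1)"
    using item_at[OF w_items b(1) flat_nth(1)[OF assms(1,2)]] .
  obtain u2 z2 where 2: "w = u2 @ enc_bin (Q ! j ! r) @ z2" "at (start_of Q j + r) = Suc (length u2)"
    using item_at[OF w_items b(2) flat_nth(1)[OF assms(3,4)]] .
  show "same_plt w (at (start_of Q i + l)) (at (start_of Q j + r)) \<longleftrightarrow> plt (Q ! i ! l) = plt (Q ! j ! r)"
    "diff_plt w (at (start_of Q i + l)) (at (start_of Q j + r)) \<longleftrightarrow> plt (Q ! i ! l) \<noteq> plt (Q ! j ! r)"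
    unfolding 1(2) 2(2) using compare_bins[OF 1(1) 2(1)] by blast+
qed

lemma plt_removed_iff:
  assumes f: "represents f m" and m: "within Q m" and j: "j < length Q" "r < length (Q ! j)"
  shows "plt_removed (length Q) w (at 0) f (at (start_of Q j + r)) \<longleftrightarrow> plt (Q ! j ! r) \<in> gone Q m"
proof
  assume "plt_removed (length Q) w (at 0) f (at (start_of Q j + r))"
  then obtain n i where n: "n \<le> length its" "i < length Q" "factor w (at n) (f i) bins1_lang"
    "same_plt w (at n) (at (start_of Q j + r))"
    unfolding plt_removed_def factor_all_items[OF w_items] by blast
  have mi: "m i \<le> length (Q ! i)" using m n(2) by (simp add: within_def)
  have fi: "f i = at (start_of Q i + m i)" using f n(2) by (simp add: represents_def)
  have "n < start_of Q i + m i \<and> (\<forall>l. n \<le> l \<and> l < start_of Q i + m i \<longrightarrow> its ! l \<noteq> None)"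
    using factor_bins1[OF w_items n(1), of "start_of Q i + m i"] n(3) fi idx_bound[OF n(2) mi] by simp
  then have "n < length its" "its ! n \<noteq> None" using idx_bound[OF n(2) mi] by auto
  then obtain i' l where il: "i' < length Q" "l < length (Q ! i')" "n = start_of Q i' + l"
    using flat_Some_cases by blast
  have "i' = i \<and> l < m i" using n(3) factor_between[OF il(1,2) n(2) mi] unfolding fi il(3) by blast
  then show "plt (Q ! j ! r) \<in> gone Q m"
    using n(2,4) compare_at(1)[OF il(1,2) j] unfolding il(3) gone_def by auto
next
  assume "plt (Q ! j ! r) \<in> gone Q m"
  then obtain i l where il: "i < length Q" "l < m i" "plt (Q ! i ! l) = plt (Q ! j ! r)"
    by (auto simp: gone_def)
  have mi: "m i \<le> length (Q ! i)" using m il(1) by (simp add: within_def)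
  have fi: "f i = at (start_of Q i + m i)" using f il(1) by (simp add: represents_def)
  have l: "l < length (Q ! i)" using il(2) mi by simp
  have "factor w (at 0) (at (start_of Q i + l)) items_lang"
    unfolding factor_all_items[OF w_items] using idx_bound[OF il(1), of l] l less_imp_le by blast
  moreover have "factor w (at (start_of Q i + l)) (f i) bins1_lang"
    unfolding fi using factor_between[OF il(1) l il(1) mi] il(2) by simp
  moreover have "same_plt w (at (start_of Q i + l)) (at (start_of Q j + r))"
    using compare_at(1)[OF il(1) l j] il(3) by simp
  ultimately show "plt_removed (length Q) w (at 0) f (at (start_of Q j + r))"
    unfolding plt_removed_def using at_bound il(1) by blast
qed

lemma plt_exhausted_iff:
  assumes f: "represents f m" and m: "within Q m" and j: "j < length Q" "r < length (Q ! j)"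
  shows "plt_exhausted (length Q) w (at 0) f (at (start_of Q j + r)) \<longleftrightarrow> plt (Q ! j ! r) \<notin> left Q m"
proof -
  have *: "(\<exists>i<length Q. factor w (at (start_of Q i' + l)) (f i) bins1_lang) \<longleftrightarrow> l < m i'"
    if il: "i' < length Q" "l < length (Q ! i')" for i' l
  proof -
    have "factor w (at (start_of Q i' + l)) (f i) bins1_lang \<longleftrightarrow> i' = i \<and> l < m i" if "i < length Q" for i
      using factor_between[OF il that, of "m i"] f m that by (simp add: within_def represents_def)
    then show ?thesis using il(1) by blast
  qed
  have "plt_exhausted (length Q) w (at 0) f (at (start_of Q j + r)) \<longleftrightarrow>
    (\<forall>n<length its. its ! n \<noteq> None \<longrightarrow> (\<exists>i<length Q. factor w (at n) (f i) bins1_lang) \<or>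
      diff_plt w (at n) (at (start_of Q j + r)))"
    unfolding plt_exhausted_def by (rule all_bins_iff[OF w_items])
  also have "\<dots> \<longleftrightarrow> (\<forall>i<length Q. \<forall>l<length (Q ! i). l < m i \<or> plt (Q ! i ! l) \<noteq> plt (Q ! j ! r))"
  proof (intro iffI allI impI)
    fix i l
    assume a: "\<forall>n<length its. its ! n \<noteq> None \<longrightarrow> (\<exists>i<length Q. factor w (at n) (f i) bins1_lang) \<or>
      diff_plt w (at n) (at (start_of Q j + r))" and il: "i < length Q" "l < length (Q ! i)"
    show "l < m i \<or> plt (Q ! i ! l) \<noteq> plt (Q ! j ! r)"
      using a[rule_format, of "start_of Q i + l"] idx_bound[OF il(1), of l] il(2) flat_nth(1)[OF il]
        *[OF il] compare_at(2)[OF il j] by auto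
  next
    fix n
    assume a: "\<forall>i<length Q. \<forall>l<length (Q ! i). l < m i \<or> plt (Q ! i ! l) \<noteq> plt (Q ! j ! r)"
      and n: "n < length its" "its ! n \<noteq> None"
    obtain i l where il: "i < length Q" "l < length (Q ! i)" "n = start_of Q i + l"
      using flat_Some_cases[OF n] .
    show "(\<exists>i<length Q. factor w (at n) (f i) bins1_lang) \<or> diff_plt w (at n) (at (start_of Q j + r))"
      using a il(1,2) *[OF il(1,2)] compare_at(2)[OF il(1,2) j] unfolding il(3) by blast
  qed
  also have "\<dots> \<longleftrightarrow> plt (Q ! j ! r) \<notin> left Q m"
    unfolding left_def mem_Collect_eq not_le[symmetric] by blast
  finally show ?thesis .
qed

lemma le_num_p: "c \<le> Suc (length w) \<Longrightarrow> le_num w (Suc 0) c \<longleftrightarrow> c \<le> p"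
  using le_num_iff[of w "[]" p "enc_items its" c] by (simp add: w_items enc_num_def)

lemma moves_iff:
  assumes f: "represents f m" and m: "within Q m" and c: "f' (length Q) \<le> Suc (length w)"
  shows "moves (length Q) w (at 0) f f' \<longleftrightarrow>
    f' (length Q) \<le> p \<and>
    (\<exists>j<length Q. m j < length (Q ! j) \<and> represents f' (m(j := Suc (m j))) \<and>
     (f' (length Q) = Suc (f (length Q)) \<or> (plt (Q ! j ! m j) \<in> gone Q m \<and>
       (f' (length Q) = f (length Q) \<or> (f (length Q) = Suc (f' (length Q)) \<and>
         plt (Q ! j ! m j) \<notin> left Q (m(j := Suc (m j))))))))"
proof -
  have fj: "f j = at (start_of Q j + m j)" "m j \<le> length (Q ! j)" if "j < length Q" for j
    using f m that by (auto simp: represents_def within_def)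
  have r: "factor w (f j) (f' j) bin_lang \<and> (\<forall>i<length Q. i = j \<or> f' i = f i) \<longleftrightarrow>
      m j < length (Q ! j) \<and> represents f' (m(j := Suc (m j)))" if j: "j < length Q" for j
  proof -
    have b: "start_of Q j + m j < length its" using idx_bound[OF j] fj(2)[OF j] by blast
    have "its ! (start_of Q j + m j) \<noteq> None \<longleftrightarrow> m j < length (Q ! j)"
      using flat_nth[OF j] fj(2)[OF j] by (cases "m j = length (Q ! j)") auto
    then have "factor w (f j) (f' j) bin_lang \<longleftrightarrow> m j < length (Q ! j) \<and> f' j = at (start_of Q j + Suc (m j))"
      using factor_bin[OF w_items, of "start_of Q j + m j"] b fj(1)[OF j] by auto
    moreover have "represents f' (m(j := Suc (m j))) \<longleftrightarrow>
        f' j = at (start_of Q j + Suc (m j)) \<and> (\<forall>i<length Q. i = j \<or> f' i = f i)"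
      using j fj(1) unfolding represents_def by auto
    ultimately show ?thesis by blast
  qed
  have pr: "plt_removed (length Q) w (at 0) f (f j) \<longleftrightarrow> plt (Q ! j ! m j) \<in> gone Q m"
    if "j < length Q" "m j < length (Q ! j)" for j
    using plt_removed_iff[OF f m that] fj(1)[OF that(1)] by simp
  have pe: "plt_exhausted (length Q) w (at 0) f' (f j) \<longleftrightarrow> plt (Q ! j ! m j) \<notin> left Q (m(j := Suc (m j)))"
    if "j < length Q" "m j < length (Q ! j)" "represents f' (m(j := Suc (m j)))" for j
  proof -
    have "within Q (m(j := Suc (m j)))" using m that(2) by (auto simp: within_def)
    then show ?thesis using plt_exhausted_iff[OF that(3) _ that(1,2)] fj(1)[OF that(1)] by simp
  qed
  have le: "(\<exists>x\<le>Suc (length w). x = Suc 0 \<and> le_num w x (f' (length Q))) \<longleftrightarrow> f' (length Q) \<le> p"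
    using le_num_p[OF c] by auto
  show ?thesis unfolding moves_def le
  proof (rule conj_cong[OF refl], rule ex_cong1, rule conj_cong[OF refl])
    fix j assume j: "j < length Q"
    show "(factor w (f j) (f' j) bin_lang \<and> (\<forall>i<length Q. i = j \<or> f' i = f i) \<and>
       (f' (length Q) = Suc (f (length Q)) \<or> (plt_removed (length Q) w (at 0) f (f j) \<and>
         (f' (length Q) = f (length Q) \<or> (f (length Q) = Suc (f' (length Q)) \<and>
           plt_exhausted (length Q) w (at 0) f' (f j)))))) \<longleftrightarrow>
      (m j < length (Q ! j) \<and> represents f' (m(j := Suc (m j))) \<and>
       (f' (length Q) = Suc (f (length Q)) \<or> (plt (Q ! j ! m j) \<in> gone Q m \<and>
        (f' (length Q) = f (length Q) \<or> (f (length Q) = Suc (f' (length Q)) \<and>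
         plt (Q ! j ! m j) \<notin> left Q (m(j := Suc (m j))))))))"
      using r[OF j] pr[OF j] pe[OF j] by blast
  qed
qed

abbreviation "run \<equiv> bounded_rel (Suc (length Q)) w (\<lambda>u u'. moves (length Q) w (at 0) ((!) u) ((!) u'))"

text \<open>Invariant: the counter never falls below the true number of open pallets. One step
  raises this number by at most one, does not raise it if the pallet was opened before, and lowers
  it by one if moreover no bin is left; these are the three licences in \<open>moves\<close>. As the
  counter stays at most \<open>p\<close>, so does the true number.\<close>

lemma run_sound:
  assumes V: "valid_instance Q" and s: "represents ((!) s) (\<lambda>_. 0)" and r: "run\<^sup>*\<^sup>* s t"
  shows "\<exists>m. mreach Q p m \<and> represents ((!) t) m \<and>
    card (left Q m \<inter> gone Q m) \<le> t ! length Q"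
  using r
proof (induction rule: rtranclp_induct)
  case base
  have "gone Q (\<lambda>_. 0) = {}" by (simp add: gone_def)
  then show ?case using s by (intro exI[of _ "\<lambda>_. 0"]) simp
next
  case (step u u')
  then obtain m where m: "mreach Q p m" "represents ((!) u) m"
    "card (left Q m \<inter> gone Q m) \<le> u ! length Q" by blast
  note wi = mstep_within[OF m(1)]
  have "u' ! length Q \<le> Suc (length w)" using step.hyps(2) by (auto simp: bounded_rel_def)
  from moves_iff[of "(!) u" m "(!) u'", OF m(2) wi this] obtain j where j: "u' ! length Q \<le> p" "j < length Q" "m j < length (Q ! j)"
    "represents ((!) u') (m(j := Suc (m j)))"
    "u' ! length Q = Suc (u ! length Q) \<or> (plt (Q ! j ! m j) \<in> gone Q m \<and>
       (u' ! length Q = u ! length Q \<or> (u ! length Q = Suc (u' ! length Q) \<and>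
         plt (Q ! j ! m j) \<notin> left Q (m(j := Suc (m j))))))"
    using step.hyps(2) by (auto simp: bounded_rel_def)
  note card = card_open_update[OF V wi j(2,3)]
  have c: "card (left Q (m(j := Suc (m j))) \<inter> gone Q (m(j := Suc (m j)))) \<le> u' ! length Q"
  proof (cases "plt (Q ! j ! m j) \<in> gone Q m")
    case True
    show ?thesis
    proof (cases "plt (Q ! j ! m j) \<in> left Q (m(j := Suc (m j)))")
      case l: True
      then show ?thesis using card(1)[OF True l] j(5) m(3) by auto
    next
      case l: False
      then show ?thesis using card(3)[OF True l] j(5) m(3) by auto
    qed
  next
    case False
    then show ?thesis using card(2)[OF False] j(5) m(3) by auto
  qed
  then have "mstep Q p m (m(j := Suc (m j)))" using j(1-3) unfolding mstep_def by (auto intro: order.trans)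
  then have "mreach Q p (m(j := Suc (m j)))"
    using m(1) rtranclp.rtrancl_into_rtrancl[of "mstep Q p" "\<lambda>_. 0" m] by blast
  then show ?case using j(4) c by blast
qed

text \<open>For completeness the counter is kept exact.\<close>

definition state_of :: "(nat \<Rightarrow> nat) \<Rightarrow> nat list" where
  "state_of m = map (\<lambda>j. at (start_of Q j + m j)) [0..<length Q] @ [card (left Q m \<inter> gone Q m)]"

lemma state_of_simps: "length (state_of m) = Suc (length Q)" "represents ((!) (state_of m)) m"
  "state_of m ! length Q = card (left Q m \<inter> gone Q m)"
  by (auto simp: state_of_def represents_def nth_append)

text \<open>The exact counter fits into a register: open pallets are at most as many as bins, bins
  as items, and items as symbols of \<open>w\<close>. The bound \<open>p\<close> would give no such
  estimate.\<close>

lemma state_of_bounded: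
  "\<forall>x\<in>set (state_of m). x \<le> Suc (length w)"
proof -
  have "Q ! i ! l \<in> set (concat Q)" if "i < length Q" "l < length (Q ! i)" for i l
    unfolding mem_concat_nth using that by blast
  then have "left Q m \<subseteq> plt ` set (concat Q)" unfolding left_def by blast
  then have "card (left Q m \<inter> gone Q m) \<le> card (plt ` set (concat Q))" by (intro card_mono) auto
  also have "\<dots> \<le> length (concat Q)" using card_image_le card_length order.trans by (metis List.finite_set)
  also have "\<dots> \<le> length its"
    unfolding bins_of_flat[symmetric] by (rule length_bins_of)
  also have "\<dots> \<le> length w" using length_enc_items[of its] by (simp add: w_items)
  finally show ?thesis using at_bound by (auto simp: state_of_def)
qed

lemma run_complete:
  assumes V: "valid_instance Q" and r: "mreach Q p m"
  shows "run\<^sup>*\<^sup>* (state_of (\<lambda>_. 0)) (state_of m)"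
  using r
proof (induction rule: rtranclp_induct)
  case (step m m')
  obtain j where j: "j < length Q" "m j < length (Q ! j)" "m' = m(j := Suc (m j))"
    "card (left Q m' \<inter> gone Q m') \<le> p" using step.hyps(2) by (auto simp: mstep_def)
  note wi = mstep_within[OF step.hyps(1)]
  note card = card_open_update[OF V wi j(1,2), folded j(3)]
  have b: "state_of m' ! length Q \<le> Suc (length w)"
    using state_of_bounded[of m'] by (simp add: state_of_def nth_append)
  \<comment> \<open>The three cases of \<open>card_open_update\<close> match the three permitted
    changes of the counter.\<close>
  have "moves (length Q) w (at 0) ((!) (state_of m)) ((!) (state_of m'))"
    unfolding moves_iff[of "(!) (state_of m)" m "(!) (state_of m')", OF state_of_simps(2) wi b] unfolding state_of_simps
    using j state_of_simps(2)[of m'] card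
    by (intro conjI exI[of _ j]) (simp_all, metis)
  then have "run (state_of m) (state_of m')"
    using state_of_bounded[of m'] state_of_simps(1) by (simp add: bounded_rel_def)
  with step.IH show ?case by (rule rtranclp.rtrancl_into_rtrancl)
qed simp

lemma input_SSeq_iff:
  assumes "n < length its"
  shows "input_at w (at n) = In SSeq \<longleftrightarrow> its ! n = None"
proof -
  have "enc_items ` {[None]} = {[SSeq]}" by (simp add: enc_item_def)
  then have *: "factor w (at n) y sep_lang \<longleftrightarrow> input_at w (at n) = In SSeq \<and> y = Suc (at n)" for y
    using factor_single[of w "at n" y SSeq] by (simp only:)
  have "factor w (at n) y sep_lang \<longleftrightarrow> y = at (Suc n) \<and> its ! n = None" for y
    using factor_sep[OF w_items, of n y] assms by auto
  with * show ?thesis by blast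
qed

lemma final_iff:
  assumes f: "represents f m" and m: "within Q m"
  shows "(\<forall>j<length Q. input_at w (f j) \<in> {In SSeq}) \<longleftrightarrow> (\<forall>j<length Q. m j = length (Q ! j))"
proof -
  have "input_at w (f j) \<in> {In SSeq} \<longleftrightarrow> m j = length (Q ! j)" if j: "j < length Q" for j
  proof -
    have mj: "m j \<le> length (Q ! j)" "f j = at (start_of Q j + m j)"
      using f m j by (auto simp: represents_def within_def)
    show ?thesis using input_SSeq_iff[OF idx_bound[OF j mj(1)]] flat_nth[OF j] mj
      by (cases "m j = length (Q ! j)") auto
  qed
  then show ?thesis by blast
qed

end

lemma accepts_word_iff:
  assumes k: "0 < k"
  shows "accepts_word k w \<longleftrightarrow> w \<in> stackup_lang k"
proof
  assume "accepts_word k w"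
  then obtain s t where s: "starts_at k w ((!) s)" "valid_at w (s ! 0)" "length t = Suc k"
    and run: "(bounded_rel (Suc k) w (\<lambda>u u'. moves k w (s ! 0) ((!) u) ((!) u')))\<^sup>*\<^sup>* s t"
    and fin: "\<forall>j<k. input_at w (t ! j) \<in> {In SSeq}" and s0: "s ! k = 0"
    unfolding accepts_word_def by blast
  obtain Q p where Q: "length Q = k" "0 < p" "w = encode Q p"
    "\<forall>j<k. s ! j = ipos p (flat Q) (start_of Q j)" using s(1) unfolding starts_at_iff[OF k] by blast
  have 0: "s ! 0 = ipos p (flat Q) 0" using Q(4) k by (simp add: start_of_0)
  have V: "valid_instance Q"
    using s(2) unfolding 0 valid_at_iff[OF w_items[OF Q(3)]] bins_of_flat valid_instance_def .
  have "represents Q p ((!) s) (\<lambda>_. 0)" using Q(1,4) by (simp add: represents_def[OF Q(3)])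
  from run_sound[OF Q(3) V this] run obtain m where m: "mreach Q p m" "represents Q p ((!) t) m"
    unfolding 0 Q(1) by blast
  have "\<forall>j<length Q. m j = length (Q ! j)"
    using final_iff[OF Q(3) m(2) mstep_within[OF m(1)]] fin Q(1) by simp
  then have "has_processing_with Q p" using m(1) has_processing_iff by blast
  then show "w \<in> stackup_lang k" using Q V by (auto simp: stackup_lang_def)
next
  assume "w \<in> stackup_lang k"
  then obtain Q p where Q: "w = encode Q p" "length Q = k" "valid_instance Q" "0 < p"
    "has_processing_with Q p" by (auto simp: stackup_lang_def)
  obtain m where m: "mreach Q p m" "\<forall>j<length Q. m j = length (Q ! j)"
    using Q(5) has_processing_iff by blast
  let ?s = "state_of Q p (\<lambda>_. 0)" and ?t = "state_of Q p m"
  have r: "represents Q p ((!) ?s) (\<lambda>_. 0)" "represents Q p ((!) ?t) m"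
    using state_of_simps(2)[OF Q(1)] by blast+
  have sj: "\<forall>j<k. ?s ! j = ipos p (flat Q) (start_of Q j)"
    using r(1) Q(2) by (simp add: represents_def[OF Q(1)])
  have 0: "?s ! 0 = ipos p (flat Q) 0" using sj k by (simp add: start_of_0)
  have "starts_at k w ((!) ?s)" unfolding starts_at_iff[OF k] using Q sj by blast
  moreover have "valid_at w (?s ! 0)"
    using Q(3) unfolding 0 valid_at_iff[OF w_items[OF Q(1)]] bins_of_flat valid_instance_def .
  moreover have "?s ! k = 0"
    using state_of_simps(3)[OF Q(1), of "\<lambda>_. 0"] Q(2) by (simp add: gone_def)
  moreover have "(bounded_rel (Suc k) w (\<lambda>u u'. moves k w (?s ! 0) ((!) u) ((!) u')))\<^sup>*\<^sup>* ?s ?t"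
    using run_complete[OF Q(1,3) m(1)] unfolding 0 Q(2) .
  moreover have "\<forall>j<k. input_at w (?t ! j) \<in> {In SSeq}"
    using final_iff[OF Q(1) r(2) mstep_within[OF m(1)]] m(2) Q(2) by simp
  ultimately show "accepts_word k w"
    unfolding accepts_word_def using state_of_simps(1)[OF Q(1)] state_of_bounded[OF Q(1)] Q(2) by blast
qed

theorem theorem8:
  fixes k :: nat
  assumes "0 < k"
  shows "in_NL (stackup_lang k)"
proof -
  have "stackup_lang k = {w. accepts_word k w}" using accepts_word_iff[OF assms] by blast
  then show ?thesis using in_NL_definable[OF definable_accepts_word[OF assms]] by simp
qed

end
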